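(* Let $Y$ be an ICCSS$(p,q)$ process with $p>q>0$. Then, for $h\ge0$, $t\in\mathbb R$ and $a\in V=\{1,\dots,k\}$, it holds $\mathbb P$-a.s. that $$Y_a(t+h)=\int_{-\infty}^te_a^\top\mathbf M(h)e^{\mathbf\Lambda(t-u)}\mathbf\Theta Y(u)\,du+\sum_{m=0}^{p-q-1}e_a^\top\mathbf M_m(h)\mathbf\Theta D^{(m)}Y(t)+e_a^\top\varepsilon(t,h)$$ and $$D^{(p-q-1)}Y_a(t+h)=\int_{-\infty}^te_a^\top\mathsf M(h)e^{\mathbf\Lambda(t-u)}\mathbf\Theta Y(u)\,du+\sum_{m=0}^{p-q-1}e_a^\top\mathsf M_m(h)\mathbf\Theta D^{(m)}Y(t)+e_a^\top\eta(t,h),$$ where $$\mathbf M(h)=\mathbf Ce^{\mathbf Ah}\Big(\mathbf E+\sum_{j=1}^{p-q}\mathbf E_{q+j}\mathsf E^\top\mathbf\Lambda^j\Big),\qquad \mathsf M(h)=\mathsf Ce^{\mathbf Ah}\Big(\mathbf E+\sum_{j=1}^{p-q}\mathbf E_{q+j}\mathsf E^\top\mathbf\Lambda^j\Big),$$ $$\mathbf M_m(h)=\mathbf Ce^{\mathbf Ah}\sum_{j=m+1}^{p-q}\mathbf E_{q+j}\mathsf E^\top\mathbf\Lambda^{j-1-m},\qquad \mathsf M_m(h)=\mathsf Ce^{\mathbf Ah}\sum_{j=m+1}^{p-q}\mathbf E_{q+j}\mathsf E^\top\mathbf\Lambda^{j-1-m},$$ $$\varepsilon(t,h)=\mathbf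 C\int_t^{t+h}e^{\mathbf A(t+h-u)}\mathbf B\,dL(u),\qquad \eta(t,h)=\mathsf C\int_t^{t+h}e^{\mathbf A(t+h-u)}\mathbf B\,dL(u),$$ and $\varepsilon(t,0)=\eta(t,0)=0_k\in\mathbb R^k$.
   Context: Setting. Let $k\ge1$ and let $p>q>0$ be integers. $L=(L(t))_{t\in\mathbb R}$ is a two-sided $\mathbb R^k$-valued Lévy process with $\mathbb E L(1)=0$, $\mathbb E\|L(1)\|^2<\infty$. Let $P(z)=I_kz^p+A_1z^{p-1}+\dots+A_p$ and $Q(z)=C_0+C_1z+\dots+C_qz^q$ with $A_i,C_j\in M_k(\mathbb R)$ be right coprime (the stacked $2k\times k$ matrix $\begin{pmatrix} P(z) \\ Q(z) \end{pmatrix}$ has rank $k$ for all $z\in\mathbb C$), with $\operatorname{rank}(C_q)=k$ and such that all zeros of $\det P(z)$ and of $\det Q(z)$ have strictly negative real part. Put $$\mathbf A=\begin{pmatrix} 0_k & I_k & 0_k & \cdots & 0_k \\ \vdots & & \ddots & \ddots & \vdots \\ 0_k & \cdots & \cdots & 0_k & I_k \\ -A_p & -A_{p-1} & \cdots & \cdots & -A_1 \end{pmatrix}\in M_{kp}(\mathbb R),\quad \mathbf B=\begin{pmatrix} 0_k \\ \vdots \\ 0_k \\ I_k \end{pmatrix}\in M_{kp\times k}(\mathbb R),\quad \mathbf C=(C_0,\dots,C_q,0_k,\dots,0_k)\in M_{k\times kp}(\mathbb R).$$ The stationary processes $X(t)=\int_{-\infty}^te^{\mathbf A(t-u)}\mathbf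 B\,dL(u)$ and $Y(t)=\mathbf CX(t)$, $t\in\mathbb R$, are the input process and the ICCSS$(p,q)$ process, respectively. Matrices: $\mathsf C=(0_k,\dots,0_k,C_0,\dots,C_q)\in M_{k\times kp}(\mathbb R)$; $$\mathbf\Lambda=\begin{pmatrix} 0_k & I_k & 0_k & \cdots & 0_k \\ \vdots & & \ddots & \ddots & \vdots \\ 0_k & \cdots & \cdots & 0_k & I_k \\ -C_q^{-1}C_0 & -C_q^{-1}C_1 & \cdots & \cdots & -C_q^{-1}C_{q-1} \end{pmatrix}\in M_{kq}(\mathbb R),\qquad \mathbf\Theta=\begin{pmatrix} 0_k \\ \vdots \\ 0_k \\ C_q^{-1} \end{pmatrix}\in M_{kq\times k}(\mathbb R);$$ $\mathbf E_j\in M_{kp\times k}(\mathbb R)$ ($j=1,\dots,p$) is the block column whose $j$-th $k\times k$ block is $I_k$ and whose other blocks are $0_k$; $\mathbf E^\top=(I_{kq},0_{kq\times k(p-q)})\in M_{kq\times kp}(\mathbb R)$; $\mathsf E^\top=(0_{k\times k(q-1)},I_k)\in M_{k\times kq}(\mathbb R)$. $e_a\in\mathbb R^k$ is the $a$-th unit vector. $D^{(m)}Y$ is the $m$-th mean-square derivative of $Y$ ($D^{(0)}Y=Y$); $Y$ is $(p-q-1)$ times mean-square differentiable. Integrals over $(-\infty,t]$ of $Y$ are almost sure limits of the pathwise integrals over $[s,t]$ as $s\to-\infty$. *)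

theory Defs
  imports "HOL-Probability.Probability"
begin

section \<open>Block matrices\<close>

text \<open>
  The block dimensions are the cardinalities of finite linearly ordered index types: vectors with
  \<open>CARD('p)\<close> blocks of size \<open>CARD('k)\<close> have type \<open>real ^ ('p \<times> 'k)\<close>. Blocks are numbered by
  their position, starting at 1, so that block matrices can be given by functions of natural
  numbers.
\<close>

definition block_pos :: "'p::{finite,linorder} \<Rightarrow> nat" where
  "block_pos i = card {j. j \<le> i}"

lemma bij_betw_block_pos:
  "bij_betw block_pos (UNIV :: 'p::{finite,linorder} set) {1..CARD('p)}"
proof -
  have lt: "block_pos i < block_pos j" if "i < j" for i j :: 'p
  proof -
    have "j \<in> {l. l \<le> j} - {l. l \<le> i}"
      using that by auto
    then have "{l. l \<le> i} \<subset> {l. l \<le> j}"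
      using that by fastforce
    then show ?thesis
      unfolding block_pos_def by (intro psubset_card_mono) auto
  qed
  have inj: "inj (block_pos :: 'p \<Rightarrow> nat)"
  proof (rule injI)
    fix i j :: 'p
    assume "block_pos i = block_pos j"
    then show "i = j"
      using lt[of i j] lt[of j i] by (cases i j rule: linorder_cases) auto
  qed
  have sub: "range (block_pos :: 'p \<Rightarrow> nat) \<subseteq> {1..CARD('p)}"
  proof (clarsimp simp: block_pos_def)
    fix i :: 'p
    have "0 < card {j. j \<le> i}"
      by (auto simp: card_gt_0_iff)
    moreover have "card {j. j \<le> i} \<le> CARD('p)"
      by (intro card_mono) auto
    ultimately show "Suc 0 \<le> card {j. j \<le> i} \<and> card {j. j \<le> i} \<le> CARD('p)"
      by simp
  qed
  have "range (block_pos :: 'p \<Rightarrow> nat) = {1..CARD('p)}"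
    using sub by (intro card_subset_eq) (auto simp: card_image[OF inj])
  with inj show ?thesis
    by (simp add: bij_betw_def)
qed

definition block_mat ::
  "(nat \<Rightarrow> nat \<Rightarrow> real^'k^'k) \<Rightarrow> real^('m::{finite,linorder} \<times> 'k)^('n::{finite,linorder} \<times> 'k)" where
  "block_mat F = (\<chi> i j. F (block_pos (fst i)) (block_pos (fst j)) $ snd i $ snd j)"

definition block_col :: "(nat \<Rightarrow> real^'k^'k) \<Rightarrow> real^'k^('n::{finite,linorder} \<times> 'k)" where
  "block_col F = (\<chi> i b. F (block_pos (fst i)) $ snd i $ b)"

definition block_row :: "(nat \<Rightarrow> real^'k^'k) \<Rightarrow> real^('m::{finite,linorder} \<times> 'k)^'k" where
  "block_row F = (\<chi> a j. F (block_pos (fst j)) $ a $ snd j)"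

text \<open>Powers and exponential with respect to the matrix product \<open>**\<close>.\<close>

definition mat_power :: "real^'n^'n \<Rightarrow> nat \<Rightarrow> real^'n^'n" where
  "mat_power A n = (((**) A) ^^ n) (mat 1)"

definition mat_exp :: "real^'n^'n \<Rightarrow> real^'n^'n" where
  "mat_exp A = (\<Sum>n. (1 / fact n) *\<^sub>R mat_power A n)"


section \<open>The matrices of the state space model\<close>

definition poly_P :: "nat \<Rightarrow> (nat \<Rightarrow> real^'k^'k) \<Rightarrow> complex \<Rightarrow> complex^'k^'k" where
  "poly_P p A z =
     (\<chi> i j. z ^ p * (if i = j then 1 else 0) + (\<Sum>n=1..p. z ^ (p - n) * of_real (A n $ i $ j)))"

definition poly_Q :: "nat \<Rightarrow> (nat \<Rightarrow> real^'k^'k) \<Rightarrow> complex \<Rightarrow> complex^'k^'k" where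
  "poly_Q q C z = (\<chi> i j. \<Sum>n=0..q. z ^ n * of_real (C n $ i $ j))"

definition stack_mat :: "'c^'m^'n \<Rightarrow> 'c^'m^'l \<Rightarrow> 'c^'m^('n + 'l)" where
  "stack_mat U V = (\<chi> i. case i of Inl r \<Rightarrow> U $ r | Inr r \<Rightarrow> V $ r)"

definition right_coprime :: "(complex \<Rightarrow> complex^'k^'k) \<Rightarrow> (complex \<Rightarrow> complex^'k^'k) \<Rightarrow> bool" where
  "right_coprime P Q \<longleftrightarrow> (\<forall>z. rank (stack_mat (P z) (Q z)) = CARD('k))"

definition state_A :: "(nat \<Rightarrow> real^'k^'k) \<Rightarrow> real^('p::{finite,linorder} \<times> 'k)^('p \<times> 'k)" where
  "state_A A = block_mat (\<lambda>i j.
     if i < CARD('p) then (if j = i + 1 then mat 1 else 0) else - A (CARD('p) + 1 - j))"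

definition state_B :: "real^'k^('p::{finite,linorder} \<times> 'k)" where
  "state_B = block_col (\<lambda>i. if i = CARD('p) then mat 1 else 0)"

definition state_C :: "nat \<Rightarrow> (nat \<Rightarrow> real^'k^'k) \<Rightarrow> real^('p::{finite,linorder} \<times> 'k)^'k" where
  "state_C q C = block_row (\<lambda>j. if j \<le> q + 1 then C (j - 1) else 0)"

text \<open>The matrix \<open>(0, \<dots>, 0, C\<^sub>0, \<dots>, C\<^sub>q)\<close>, with the coefficients shifted to the last blocks.\<close>

definition state_C_shift :: "nat \<Rightarrow> (nat \<Rightarrow> real^'k^'k) \<Rightarrow> real^('p::{finite,linorder} \<times> 'k)^'k" where
  "state_C_shift q C = block_row (\<lambda>j. if CARD('p) - q \<le> j then C (j - (CARD('p) - q)) else 0)"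

definition inv_Lambda :: "(nat \<Rightarrow> real^'k^'k) \<Rightarrow> real^('q::{finite,linorder} \<times> 'k)^('q \<times> 'k)" where
  "inv_Lambda C = block_mat (\<lambda>i j.
     if i < CARD('q) then (if j = i + 1 then mat 1 else 0)
     else - (matrix_inv (C CARD('q)) ** C (j - 1)))"

definition inv_Theta :: "(nat \<Rightarrow> real^'k^'k) \<Rightarrow> real^'k^('q::{finite,linorder} \<times> 'k)" where
  "inv_Theta C = block_col (\<lambda>i. if i = CARD('q) then matrix_inv (C CARD('q)) else 0)"

definition E_block :: "nat \<Rightarrow> real^'k^('p::{finite,linorder} \<times> 'k)" where
  "E_block j = block_col (\<lambda>i. if i = j then mat 1 else 0)"

definition E_top :: "real^('p::{finite,linorder} \<times> 'k::finite)^('q::{finite,linorder} \<times> 'k)" where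
  "E_top = block_mat (\<lambda>i j. if i = j then mat 1 else 0)"

definition E_last :: "real^('q::{finite,linorder} \<times> 'k::finite)^'k" where
  "E_last = block_row (\<lambda>j. if j = CARD('q) then mat 1 else 0)"

text \<open>
  The coefficient matrices of the two representations differ only in the first factor \<open>K\<close>, which is
  \<^const>\<open>state_C\<close> for the process and \<^const>\<open>state_C_shift\<close> for its highest derivative.
\<close>

definition coeff_int ::
  "real^('p::{finite,linorder} \<times> 'k)^'k \<Rightarrow> real^('p \<times> 'k)^('p \<times> 'k) \<Rightarrow>
   real^('q::{finite,linorder} \<times> 'k)^('q \<times> 'k) \<Rightarrow> real \<Rightarrow> real^('q \<times> 'k)^'k" where
  "coeff_int K AA \<Lambda> h =
     K ** mat_exp (h *\<^sub>R AA) **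
       (transpose E_top +
        (\<Sum>j=1..CARD('p) - CARD('q). E_block (CARD('q) + j) ** E_last ** mat_power \<Lambda> j))"

definition coeff_deriv ::
  "real^('p::{finite,linorder} \<times> 'k)^'k \<Rightarrow> real^('p \<times> 'k)^('p \<times> 'k) \<Rightarrow>
   real^('q::{finite,linorder} \<times> 'k)^('q \<times> 'k) \<Rightarrow> nat \<Rightarrow> real \<Rightarrow> real^('q \<times> 'k)^'k" where
  "coeff_deriv K AA \<Lambda> m h =
     K ** mat_exp (h *\<^sub>R AA) **
       (\<Sum>j=m+1..CARD('p) - CARD('q). E_block (CARD('q) + j) ** E_last ** mat_power \<Lambda> (j - 1 - m))"


section \<open>Two-sided Levy processes and stochastic integrals\<close>

definition cadlag :: "(real \<Rightarrow> 'b::topological_space) \<Rightarrow> bool" where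
  "cadlag f \<longleftrightarrow> (\<forall>t. (f \<longlongrightarrow> f t) (at_right t) \<and> (\<exists>l. (f \<longlongrightarrow> l) (at_left t)))"

definition levy_process :: "'a measure \<Rightarrow> (real \<Rightarrow> 'a \<Rightarrow> real^'k) \<Rightarrow> bool" where
  "levy_process M L \<longleftrightarrow>
     (\<forall>t. L t \<in> borel_measurable M) \<and>
     (AE \<omega> in M. L 0 \<omega> = 0) \<and>
     (\<forall>(n::nat) (s :: nat \<Rightarrow> real). (\<forall>i<n. s i \<le> s (Suc i)) \<longrightarrow>
        prob_space.indep_vars M (\<lambda>_. borel) (\<lambda>i \<omega>. L (s (Suc i)) \<omega> - L (s i) \<omega>) {..<n}) \<and>
     (\<forall>s t. s \<le> t \<longrightarrow> distr M borel (\<lambda>\<omega>. L t \<omega> - L s \<omega>) = distr M borel (L (t - s))) \<and>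
     (AE \<omega> in M. cadlag (\<lambda>t. L t \<omega>))"

text \<open>Convergence in mean square; the extended integral makes integrability part of the claim.\<close>

definition ms_tendsto ::
  "'a measure \<Rightarrow> ('i \<Rightarrow> 'a \<Rightarrow> 'b::real_normed_vector) \<Rightarrow> ('a \<Rightarrow> 'b) \<Rightarrow> 'i filter \<Rightarrow> bool" where
  "ms_tendsto M Z W F \<longleftrightarrow> ((\<lambda>i. \<integral>\<^sup>+\<omega>. ennreal ((norm (Z i \<omega> - W \<omega>))\<^sup>2) \<partial>M) \<longlongrightarrow> 0) F"

text \<open>
  A list of triples \<open>(a, b, G)\<close> represents the matrix-valued step function that is the sum of the
  functions with value \<open>G\<close> on the interval \<open>(a, b]\<close>.
\<close>

definition step_fun :: "(real \<times> real \<times> (real^'k^'n)) list \<Rightarrow> real \<Rightarrow> real^'k^'n" where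
  "step_fun D u = (\<Sum>(a, b, G)\<leftarrow>D. indicator {a<..b} u *\<^sub>R G)"

definition step_integral ::
  "(real \<Rightarrow> 'a \<Rightarrow> real^'k) \<Rightarrow> (real \<times> real \<times> (real^'k^'n)) list \<Rightarrow> 'a \<Rightarrow> real^'n" where
  "step_integral L D \<omega> = (\<Sum>(a, b, G)\<leftarrow>D. G *v (L b \<omega> - L a \<omega>))"

text \<open>
  The integral of a deterministic integrand over \<open>S\<close>, as the mean-square limit of the integrals of
  step functions that approximate the integrand in \<open>L\<^sup>2\<close>. For a centred square integrable process it
  is determined up to almost sure equality, by the isometry for step functions.
\<close>

definition has_levy_integral ::
  "'a measure \<Rightarrow> (real \<Rightarrow> 'a \<Rightarrow> real^'k) \<Rightarrow> real set \<Rightarrow> (real \<Rightarrow> real^'k^'n) \<Rightarrow> ('a \<Rightarrow> real^'n) \<Rightarrow> bool" where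
  "has_levy_integral M L S f I \<longleftrightarrow>
     I \<in> borel_measurable M \<and>
     (\<exists>D :: nat \<Rightarrow> (real \<times> real \<times> (real^'k^'n)) list.
        (\<forall>n. \<forall>(a, b, G) \<in> set (D n). a \<le> b) \<and>
        ms_tendsto lborel (\<lambda>n. step_fun (D n)) (\<lambda>u. indicator S u *\<^sub>R f u) sequentially \<and>
        ms_tendsto M (\<lambda>n. step_integral L (D n)) I sequentially)"

definition levy_integral ::
  "'a measure \<Rightarrow> (real \<Rightarrow> 'a \<Rightarrow> real^'k) \<Rightarrow> real set \<Rightarrow> (real \<Rightarrow> real^'k^'n) \<Rightarrow> 'a \<Rightarrow> real^'n" where
  "levy_integral M L S f = (SOME I. has_levy_integral M L S f I)"

text \<open>A version of the mean-square derivative, for each time point.\<close>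

definition ms_deriv ::
  "'a measure \<Rightarrow> (real \<Rightarrow> 'a \<Rightarrow> 'b::{real_normed_vector,second_countable_topology}) \<Rightarrow> real \<Rightarrow> 'a \<Rightarrow> 'b" where
  "ms_deriv M Z t =
     (SOME W. W \<in> borel_measurable M \<and>
        ms_tendsto M (\<lambda>h \<omega>. (Z (t + h) \<omega> - Z t \<omega>) /\<^sub>R h) W (at 0))"

definition ms_deriv_n ::
  "'a measure \<Rightarrow> nat \<Rightarrow> (real \<Rightarrow> 'a \<Rightarrow> 'b::{real_normed_vector,second_countable_topology}) \<Rightarrow> real \<Rightarrow> 'a \<Rightarrow> 'b" where
  "ms_deriv_n M m = (ms_deriv M ^^ m)"

definition measurable_process :: "'a measure \<Rightarrow> (real \<Rightarrow> 'a \<Rightarrow> 'b::topological_space) \<Rightarrow> bool" where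
  "measurable_process M Z \<longleftrightarrow> (\<lambda>(t, \<omega>). Z t \<omega>) \<in> borel_measurable (lborel \<Otimes>\<^sub>M M)"

definition has_integral_from_minus_inf :: "(real \<Rightarrow> real) \<Rightarrow> real \<Rightarrow> real \<Rightarrow> bool" where
  "has_integral_from_minus_inf f t I \<longleftrightarrow>
     (\<forall>s\<le>t. set_integrable lborel {s..t} f) \<and>
     ((\<lambda>s. LINT u:{s..t}|lborel. f u) \<longlongrightarrow> I) at_bot"

text \<open>The input process is fixed up to modification by its defining integrals.\<close>

definition is_input_process ::
  "'a measure \<Rightarrow> (real \<Rightarrow> 'a \<Rightarrow> real^'k) \<Rightarrow> (nat \<Rightarrow> real^'k^'k) \<Rightarrow>
   (real \<Rightarrow> 'a \<Rightarrow> real^('p::{finite,linorder} \<times> 'k)) \<Rightarrow> bool" where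
  "is_input_process M L A X \<longleftrightarrow>
     (\<forall>t. AE \<omega> in M.
        X t \<omega> = levy_integral M L {..t} (\<lambda>u. mat_exp ((t - u) *\<^sub>R state_A A) ** state_B) \<omega>)"

text \<open>
  The innovations \<open>\<epsilon>(t,h)\<close> (for \<open>K = \<close> \<^const>\<open>state_C\<close>) and \<open>\<eta>(t,h)\<close>
  (for \<open>K = \<close> \<^const>\<open>state_C_shift\<close>).
\<close>

definition innovation ::
  "'a measure \<Rightarrow> (real \<Rightarrow> 'a \<Rightarrow> real^'k) \<Rightarrow> real^('p::{finite,linorder} \<times> 'k)^'k \<Rightarrow>
   real^('p \<times> 'k)^('p \<times> 'k) \<Rightarrow> real \<Rightarrow> real \<Rightarrow> 'a \<Rightarrow> real^'k" where
  "innovation M L K AA t h \<omega> =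
     K *v levy_integral M L {t<..t + h} (\<lambda>u. mat_exp ((t + h - u) *\<^sub>R AA) ** state_B) \<omega>"

end

theory Submission
  imports Defs "HOL-Computational_Algebra.Fundamental_Theorem_Algebra"
begin

text \<open>
  The first \<open>q\<close> blocks of the input process solve the linear equation \<open>D x = \<Lambda> x + \<Theta> Y\<close>, because the
  rows of \<open>\<^bold>A\<close> above the last one are shifts and \<open>C\<^sub>q\<close> is invertible. Since \<open>\<Lambda>\<close> is stable, they are
  recovered from the past of \<open>Y\<close> by the variation of constants formula. The block \<open>q + j\<close> is the
  \<open>j\<close>-th derivative of the block \<open>q\<close>, so that the remaining blocks are combinations of the first ones
  and of the derivatives of \<open>Y\<close>, which in turn are images of the input process under the shifted
  coefficient rows, as long as no noise enters. The representation then follows from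
  \<open>X(t + h) = exp(h A) X(t) + \<integral>\<^bsub>(t, t + h]\<^esub> exp((t + h - u) A) B dL(u)\<close>.

  Two steps replace general theory. Stability comes from an annihilating polynomial of the
  companion matrix, whose eigenvectors are \<open>(v, z v, z\<^sup>2 v, \<dots>)\<close> with \<open>v\<close> in the kernel of the matrix
  polynomial at \<open>z\<close>. The stochastic differential equation for the first \<open>q\<close> blocks is solved after
  taking expectations over arbitrary events, where it is an ordinary one.
\<close>

section \<open>Exponentials of real matrices and their decay\<close>

text \<open>\<open>levy_integral\<close> and \<open>ms_deriv\<close> are choices, so each identity
  about them is obtained by exhibiting a mean-square limit and comparing it with the chosen one
  through almost sure uniqueness. For the integral, existence and uniqueness both rest on one bound
  of the second moment by the L2 norm of the integrand.

  The obstacle to solving the equation path by path is that each relation between \<open>Y t\<close>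
  and the state holds outside a null set depending on t, and that mean-square derivatives say
  nothing about paths. Integrated over a fixed event, they become ordinary derivatives. Fubini,
  available through the joint measurability of Y and the decay of exp(t \<Lambda>), brings back the
  pathwise integral of Y.

  The noise over an interval of length d has a second moment bounded by a multiple of d, too large
  for a difference quotient. A row K with \<open>K ** B = 0\<close> improves this to the order d^3;
  the shifted coefficient rows have this property until they reach the last block, which allows p -
  q - 1 differentiations.\<close>

lemma scaleR_matrix_mult_left: "(r *\<^sub>R A) ** B = r *\<^sub>R (A ** B)" for A :: "real^'m^'n" and B :: "real^'k^'m"
  by (simp add: matrix_matrix_mult_def vec_eq_iff sum_distrib_left mult_ac)

lemma scaleR_matrix_mult_right: "A ** (r *\<^sub>R B) = r *\<^sub>R (A ** B)" for A :: "real^'m^'n" and B :: "real^'k^'m"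
  by (simp add: matrix_matrix_mult_def vec_eq_iff sum_distrib_left mult_ac)

lemma bounded_bilinear_matrix_mult:
  "bounded_bilinear ((**) :: real^'m^'n \<Rightarrow> real^'k^'m \<Rightarrow> real^'k^'n)"
  by (auto simp: bilinear_conv_bounded_bilinear[symmetric] bilinear_def scaleR_matrix_mult_left
      scaleR_matrix_mult_right matrix_add_ldistrib matrix_matrix_mult_def vec_eq_iff sum.distrib
      sum_distrib_left algebra_simps intro!: linearI)

interpretation mmult: bounded_bilinear "(**) :: real^'m^'n \<Rightarrow> real^'k^'m \<Rightarrow> real^'k^'n"
  by (rule bounded_bilinear_matrix_mult)

lemma bounded_bilinear_matrix_vector_mult:
  "bounded_bilinear ((*v) :: real^'m^'n \<Rightarrow> real^'m \<Rightarrow> real^'n)"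
  by (auto simp: bilinear_conv_bounded_bilinear[symmetric] bilinear_def algebra_simps
      scaleR_matrix_vector_assoc intro!: linearI)

interpretation mvmult: bounded_bilinear "(*v) :: real^'m^'n \<Rightarrow> real^'m \<Rightarrow> real^'n"
  by (rule bounded_bilinear_matrix_vector_mult)

lemma mat_power_0 [simp]: "mat_power A 0 = mat 1"
  and mat_power_Suc: "mat_power A (Suc n) = A ** mat_power A n"
  by (simp_all add: mat_power_def)

lemma mat_power_commute: "A ** mat_power A n = mat_power A n ** A"
proof (induction n)
  case (Suc n)
  then show ?case by (metis mat_power_Suc matrix_mul_assoc)
qed simp

lemma mat_power_Suc2: "mat_power A (Suc n) = mat_power A n ** A"
  by (simp add: mat_power_Suc mat_power_commute)

lemma mat_power_scaleR: "mat_power (t *\<^sub>R A) n = t ^ n *\<^sub>R mat_power A n"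
  by (induction n) (simp_all add: mat_power_Suc scaleR_matrix_mult_left scaleR_matrix_mult_right)

text \<open>K is a bound of the linear map that multiplies by A from the left. The factor
  \<open>norm (mat 1)\<close> stays because the Euclidean norm of the unit matrix need not be
  1.\<close>

lemma norm_mat_power_bound: "\<exists>K\<ge>0. \<forall>n. norm (mat_power A n) \<le> norm (mat 1 :: real^'n^'n) * K ^ n"
  for A :: "real^'n^'n"
proof -
  obtain K where K: "K \<ge> 0" "\<And>B :: real^'n^'n. norm (A ** B) \<le> norm B * K"
    using bounded_linear.nonneg_bounded[OF mmult.bounded_linear_right[of A]] by blast
  have "norm (mat_power A n) \<le> norm (mat 1 :: real^'n^'n) * K ^ n" for n
  proof (induction n)
    case (Suc n)
    have "norm (mat_power A (Suc n)) \<le> norm (mat_power A n) * K"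
      by (simp add: mat_power_Suc K)
    also have "\<dots> \<le> (norm (mat 1 :: real^'n^'n) * K ^ n) * K"
      by (rule mult_right_mono[OF Suc K(1)])
    finally show ?case by (simp add: mult_ac)
  qed simp
  with K(1) show ?thesis by blast
qed

lemma mat_exp_summable: "summable (\<lambda>n. norm ((t ^ n / fact n) *\<^sub>R mat_power A n))"
  for A :: "real^'n^'n"
proof -
  obtain K where K: "K \<ge> 0" "\<And>n. norm (mat_power A n) \<le> norm (mat 1 :: real^'n^'n) * K ^ n"
    using norm_mat_power_bound[of A] by blast
  have "norm ((t ^ n / fact n) *\<^sub>R mat_power A n) \<le> norm (mat 1 :: real^'n^'n) * (inverse (fact n) * (\<bar>t\<bar> * K) ^ n)" for n
  proof -
    have "norm ((t ^ n / fact n) *\<^sub>R mat_power A n) = \<bar>t\<bar>^n / fact n * norm (mat_power A n)"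
      by (simp add: power_abs)
    also have "\<dots> \<le> \<bar>t\<bar>^n / fact n * (norm (mat 1 :: real^'n^'n) * K ^ n)"
      by (intro mult_left_mono K) simp
    finally show ?thesis by (simp add: field_simps power_mult_distrib)
  qed
  then show ?thesis
    by (intro summable_comparison_test'[OF summable_mult[OF summable_exp]]) simp
qed

lemma mat_exp_sums: "(\<lambda>n. (t ^ n / fact n) *\<^sub>R mat_power A n) sums mat_exp (t *\<^sub>R A)"
  for A :: "real^'n^'n"
  using summable_sums[OF summable_norm_cancel[OF mat_exp_summable[of t A]]]
  by (simp add: mat_exp_def mat_power_scaleR)

text \<open>Each entry is a scalar power series in t that converges everywhere, so it can be
  differentiated term by term.\<close>

lemma mat_exp_nth: "mat_exp (t *\<^sub>R A) $ i $ j = (\<Sum>n. (mat_power A n $ i $ j / fact n) * t ^ n)"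
  and mat_exp_nth_summable: "summable (\<lambda>n. (mat_power A n $ i $ j / fact n) * t ^ n)"
  for A :: "real^'n^'n"
proof -
  have "bounded_linear (\<lambda>X :: real^'n^'n. X $ i $ j)"
    by (intro bounded_linear_compose[OF bounded_linear_vec_nth bounded_linear_vec_nth])
  from bounded_linear.sums[OF this mat_exp_sums]
  have "(\<lambda>n. (mat_power A n $ i $ j / fact n) * t ^ n) sums (mat_exp (t *\<^sub>R A) $ i $ j)"
    by (simp add: field_simps)
  then show "mat_exp (t *\<^sub>R A) $ i $ j = (\<Sum>n. (mat_power A n $ i $ j / fact n) * t ^ n)"
    "summable (\<lambda>n. (mat_power A n $ i $ j / fact n) * t ^ n)"
    by (simp_all add: sums_iff)
qed

lemma mat_exp_mult_left_nth:
  "(A ** mat_exp (t *\<^sub>R A)) $ i $ j = (\<Sum>n. (mat_power A (Suc n) $ i $ j / fact n) * t ^ n)"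
  and mat_exp_commute: "A ** mat_exp (t *\<^sub>R A) = mat_exp (t *\<^sub>R A) ** A"
  for A :: "real^'n^'n"
proof -
  have "bounded_linear (\<lambda>X :: real^'n^'n. (A ** X) $ i $ j)"
    by (intro bounded_linear_compose[OF bounded_linear_vec_nth]
        bounded_linear_compose[OF bounded_linear_vec_nth] mmult.bounded_linear_right)
  from bounded_linear.sums[OF this mat_exp_sums]
  show "(A ** mat_exp (t *\<^sub>R A)) $ i $ j = (\<Sum>n. (mat_power A (Suc n) $ i $ j / fact n) * t ^ n)"
    by (simp add: sums_iff scaleR_matrix_mult_right mat_power_Suc field_simps)
  have "(\<lambda>n. A ** ((t ^ n / fact n) *\<^sub>R mat_power A n)) sums (A ** mat_exp (t *\<^sub>R A))"
    by (rule bounded_linear.sums[OF mmult.bounded_linear_right mat_exp_sums])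
  moreover have "(\<lambda>n. ((t ^ n / fact n) *\<^sub>R mat_power A n) ** A) sums (mat_exp (t *\<^sub>R A) ** A)"
    by (rule bounded_linear.sums[OF mmult.bounded_linear_left mat_exp_sums])
  ultimately show "A ** mat_exp (t *\<^sub>R A) = mat_exp (t *\<^sub>R A) ** A"
    by (simp add: sums_iff scaleR_matrix_mult_right scaleR_matrix_mult_left mat_power_commute)
qed

text \<open>The Euclidean norm is at most the sum of the norms of the components, so the remainder
  quotients of the components dominate that of the vector.\<close>

lemma has_vector_derivative_vec_lambda:
  fixes f :: "real \<Rightarrow> 'b::real_normed_vector^'n"
  assumes "\<And>i. ((\<lambda>t. f t $ i) has_vector_derivative (D $ i)) (at t)"
  shows "(f has_vector_derivative D) (at t)"
proof -
  have "(\<lambda>h. norm (f (t + h) - f t - h *\<^sub>R D) / norm h) \<midarrow>0\<rightarrow> 0"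
  proof (rule tendsto_sandwich[OF _ _ tendsto_const])
    show "(\<lambda>h. \<Sum>i\<in>UNIV. norm (f (t + h) $ i - f t $ i - h *\<^sub>R (D $ i)) / norm h) \<midarrow>0\<rightarrow> 0"
      using assms by (intro tendsto_null_sum)
        (simp add: has_vector_derivative_def has_derivative_at)
    show "\<forall>\<^sub>F h in at 0. norm (f (t + h) - f t - h *\<^sub>R D) / norm h
        \<le> (\<Sum>i\<in>UNIV. norm (f (t + h) $ i - f t $ i - h *\<^sub>R (D $ i)) / norm h)"
      unfolding sum_divide_distrib[symmetric] norm_vec_def
      by (intro always_eventually allI divide_right_mono order_trans[OF L2_set_le_sum]) auto
  qed simp
  then show ?thesis
    by (simp add: has_vector_derivative_def has_derivative_at bounded_linear_scaleR_left)
qed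

lemma mat_exp_has_vector_derivative:
  "((\<lambda>t. mat_exp (t *\<^sub>R A)) has_vector_derivative A ** mat_exp (t *\<^sub>R A)) (at t)"
  for A :: "real^'n^'n"
proof (intro has_vector_derivative_vec_lambda)
  fix i j
  have "((\<lambda>t. \<Sum>n. (mat_power A n $ i $ j / fact n) * t ^ n) has_field_derivative
      (\<Sum>n. diffs (\<lambda>n. mat_power A n $ i $ j / fact n) n * t ^ n)) (at t)"
    by (rule termdiffs_strong_converges_everywhere[OF mat_exp_nth_summable])
  moreover have "diffs (\<lambda>n. mat_power A n $ i $ j / fact n) = (\<lambda>n. mat_power A (Suc n) $ i $ j / fact n)"
    by (simp add: diffs_def fun_eq_iff field_simps del: of_nat_Suc)
  ultimately show "((\<lambda>t. mat_exp (t *\<^sub>R A) $ i $ j) has_vector_derivative (A ** mat_exp (t *\<^sub>R A)) $ i $ j) (at t)"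
    by (simp add: has_real_derivative_iff_has_vector_derivative mat_exp_nth mat_exp_mult_left_nth)
qed

lemma mat_exp_0 [simp]: "mat_exp 0 = (mat 1 :: real^'n^'n)"
proof -
  have "(\<lambda>n. if n = 0 then mat 1 :: real^'n^'n else 0) sums mat 1"
    using sums_single[of 0 "\<lambda>_. mat 1 :: real^'n^'n"] by simp
  moreover have "(0 ^ n / fact n) *\<^sub>R mat_power 0 n = (if n = 0 then mat 1 :: real^'n^'n else 0)" for n
    by (cases n) auto
  ultimately show ?thesis
    using mat_exp_sums[of 0 "0 :: real^'n^'n"] by (simp add: sums_iff)
qed

lemma continuous_on_mat_exp [continuous_intros]:
  assumes "continuous_on S f"
  shows "continuous_on S (\<lambda>u. mat_exp (f u *\<^sub>R A))"
proof -
  have "continuous_on UNIV (\<lambda>t. mat_exp (t *\<^sub>R A))"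
    by (intro continuous_at_imp_continuous_on ballI has_vector_derivative_continuous[OF mat_exp_has_vector_derivative])
  from continuous_on_compose2[OF this assms] show ?thesis by simp
qed

text \<open>The product \<open>?F r\<close> has derivative zero, since A commutes with its
  exponential and the two product-rule terms cancel. Comparing r = 0 with r = t gives the
  claim.\<close>

lemma mat_exp_add: "mat_exp ((s + t) *\<^sub>R A) = mat_exp (s *\<^sub>R A) ** mat_exp (t *\<^sub>R A)"
  for A :: "real^'n^'n"
proof -
  let ?F = "\<lambda>r. mat_exp ((s + t - r) *\<^sub>R A) ** mat_exp (r *\<^sub>R A)"
  have "(?F has_vector_derivative 0) (at r)" for r
  proof -
    have "((\<lambda>r. mat_exp ((s + t - r) *\<^sub>R A)) has_vector_derivative
        - (A ** mat_exp ((s + t - r) *\<^sub>R A))) (at r)"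
    proof -
      have "((\<lambda>r. s + t - r) has_vector_derivative -1) (at r)"
        by (auto intro!: derivative_eq_intros)
      from vector_diff_chain_at[OF this mat_exp_has_vector_derivative] show ?thesis
        by (simp add: o_def)
    qed
    from mmult.has_vector_derivative[OF this mat_exp_has_vector_derivative[of A r]]
    show ?thesis
      by (simp add: mmult.minus_left mat_exp_commute[of A "s + t - r"] matrix_mul_assoc)
  qed
  then obtain c where "\<And>r. ?F r = c"
    using has_vector_derivative_zero_constant[of UNIV ?F] by auto
  then have "?F 0 = ?F t" by metis
  then show ?thesis by simp
qed

text \<open>The rate is existentially quantified because it shrinks: sums take the smaller rate, and
  solving a differential equation loses a further part.\<close>

definition exp_decay :: "(real \<Rightarrow> 'b::real_normed_vector) \<Rightarrow> bool" where
  "exp_decay f \<longleftrightarrow> (\<exists>c a. a > 0 \<and> (\<forall>t\<ge>0. norm (f t) \<le> c * exp (- a * t)))"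

lemma exp_decay_0: "exp_decay (\<lambda>_. 0)"
  unfolding exp_decay_def by (intro exI[of _ 0] exI[of _ 1]) auto

lemma exp_decay_add:
  assumes "exp_decay f" "exp_decay g"
  shows "exp_decay (\<lambda>t. f t + g t)"
proof -
  obtain c a where f: "a > 0" "\<And>t. t \<ge> 0 \<Longrightarrow> norm (f t) \<le> c * exp (- a * t)"
    using assms(1) by (auto simp: exp_decay_def)
  obtain d b where g: "b > 0" "\<And>t. t \<ge> 0 \<Longrightarrow> norm (g t) \<le> d * exp (- b * t)"
    using assms(2) by (auto simp: exp_decay_def)
  have "norm (f t + g t) \<le> (\<bar>c\<bar> + \<bar>d\<bar>) * exp (- min a b * t)" if "t \<ge> 0" for t
  proof -
    have "norm (f t) \<le> \<bar>c\<bar> * exp (- min a b * t)"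
      using that by (intro order_trans[OF f(2)] mult_mono) (auto simp: mult_right_mono)
    moreover have "norm (g t) \<le> \<bar>d\<bar> * exp (- min a b * t)"
      using that by (intro order_trans[OF g(2)] mult_mono) (auto simp: mult_right_mono)
    ultimately show ?thesis
      by (intro order_trans[OF norm_triangle_ineq]) (simp add: distrib_right)
  qed
  then show ?thesis
    unfolding exp_decay_def using f(1) g(1) by (intro exI[of _ "\<bar>c\<bar> + \<bar>d\<bar>"] exI[of _ "min a b"]) auto
qed

lemma exp_decay_sum: "finite I \<Longrightarrow> (\<And>i. i \<in> I \<Longrightarrow> exp_decay (f i)) \<Longrightarrow> exp_decay (\<lambda>t. \<Sum>i\<in>I. f i t)"
  by (induction I rule: finite_induct) (auto intro: exp_decay_0 exp_decay_add)

lemma exp_decay_mono: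
  assumes "exp_decay g" "\<And>t. t \<ge> 0 \<Longrightarrow> norm (f t) \<le> norm (g t)"
  shows "exp_decay f"
  using assms unfolding exp_decay_def by (meson order_trans)

lemma exp_decay_vec:
  assumes "\<And>i. exp_decay (\<lambda>t. f t $ i)"
  shows "exp_decay f"
proof (rule exp_decay_mono)
  have "exp_decay (\<lambda>t. norm (f t $ i))" for i
    by (rule exp_decay_mono[OF assms[of i]]) simp
  then show "exp_decay (\<lambda>t. \<Sum>i\<in>UNIV. norm (f t $ i))"
    by (intro exp_decay_sum) auto
  show "norm (f t) \<le> norm (\<Sum>i\<in>UNIV. norm (f t $ i))" for t
    by (simp add: norm_vec_def order_trans[OF L2_set_le_sum] sum_nonneg)
qed

text \<open>With the integrating factor exp(- l t), the derivative of the product is exp(- l t)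
  y(t), whose growth is controlled; integrating this bound and multiplying back gives the decay of
  f.\<close>

lemma exp_decay_linear_ode:
  fixes f y :: "real \<Rightarrow> complex"
  assumes f: "\<And>t. (f has_vector_derivative l * f t + y t) (at t)"
    and y: "exp_decay y" and l: "Re l < 0"
  shows "exp_decay f"
proof -
  obtain c a where y: "a > 0" "\<And>t. t \<ge> 0 \<Longrightarrow> norm (y t) \<le> c * exp (- a * t)"
    using y by (auto simp: exp_decay_def)
  have c: "c \<ge> 0"
    using y(2)[of 0] by (auto intro: order_trans[OF norm_ge_zero])
  \<comment> \<open>The new rate is strictly below both a and - Re l. This also covers the resonant
    case a = - Re l, where the solution may carry an extra factor t.\<close>
  define b where "b = min a (- Re l) / 2"
  have b: "b > 0" "b < a" "b < - Re l"
    using y(1) l by (auto simp: b_def min_def)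
  \<comment> \<open>k is the growth rate allowed for \<open>?u\<close>; it is positive, so that c
    exp(k x) has the antiderivative (c / k) exp(k x).\<close>
  define k where "k = - Re l - b"
  have k: "k > 0" using b by (simp add: k_def)
  let ?u = "\<lambda>t. exp (- (l * of_real t)) * f t"
  have u: "(?u has_vector_derivative exp (- (l * of_real t)) * y t) (at t)" for t
  proof -
    have "((\<lambda>t. exp (- (l * of_real t))) has_vector_derivative - l * exp (- (l * of_real t))) (at t)"
      by (rule has_vector_derivative_real_field) (auto intro!: derivative_eq_intros)
    from has_vector_derivative_mult[OF this f[of t]] show ?thesis
      by (simp add: algebra_simps)
  qed
  have bound: "norm (?u t) \<le> norm (f 0) + c / k * exp (k * t)" if "t > 0" for t
  proof -
    have "norm (?u t - ?u 0) \<le> c / k * exp (k * t) - c / k * exp (k * 0)"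
    proof (rule differentiable_bound_general[OF that])
      show "continuous_on {0..t} ?u"
        by (intro continuous_at_imp_continuous_on ballI has_vector_derivative_continuous[OF u])
      show "((\<lambda>t. c / k * exp (k * t)) has_vector_derivative c * exp (k * x)) (at x)" for x
        using k by (auto intro!: derivative_eq_intros simp flip: has_real_derivative_iff_has_vector_derivative)
      show "norm (exp (- (l * of_real x)) * y x) \<le> c * exp (k * x)" if x: "0 < x" for x
      proof -
        have "norm (exp (- (l * of_real x)) * y x) \<le> exp (- Re l * x) * (c * exp (- a * x))"
          using y(2)[of x] x by (auto simp: norm_mult intro!: mult_left_mono)
        also have "\<dots> = c * exp ((- Re l - a) * x)"
          by (simp add: exp_add[symmetric] algebra_simps)
        also have "\<dots> \<le> c * exp (k * x)"
          using x c b by (intro mult_left_mono) (auto simp: k_def mult_right_mono)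
        finally show ?thesis .
      qed
    qed (use k u in \<open>auto intro!: continuous_intros\<close>)
    then have "norm (?u t) \<le> norm (f 0) + (c / k * exp (k * t) - c / k)"
      using norm_triangle_ineq2[of "?u t" "?u 0"] by simp
    also have "\<dots> \<le> norm (f 0) + c / k * exp (k * t)"
      using c k by simp
    finally show ?thesis .
  qed
  have "norm (f t) \<le> (norm (f 0) + c / k) * exp (- b * t)" if "t \<ge> 0" for t
  proof (cases "t = 0")
    case False
    with that have t: "t > 0" by simp
    have "norm (f t) = exp (Re l * t) * norm (?u t)"
      by (simp add: norm_mult mult.assoc[symmetric] flip: exp_add)
    also have "\<dots> \<le> exp (Re l * t) * (norm (f 0) + c / k * exp (k * t))"
      by (intro mult_left_mono bound t) simp
    also have "\<dots> = norm (f 0) * exp (Re l * t) + c / k * exp (- b * t)"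
      by (simp add: algebra_simps k_def flip: exp_add)
    also have "\<dots> \<le> norm (f 0) * exp (- b * t) + c / k * exp (- b * t)"
      using t b mult_right_mono[of "Re l" "-b" t] by (intro add_right_mono mult_left_mono) auto
    finally show ?thesis by (simp add: algebra_simps)
  qed (use c k in auto)
  with b show ?thesis
    unfolding exp_decay_def by blast
qed

text \<open>This is p(A) x, formed from the iterates of A on the vector x.\<close>

definition poly_mat_vec :: "complex^'n^'n \<Rightarrow> complex poly \<Rightarrow> complex^'n \<Rightarrow> complex^'n" where
  "poly_mat_vec A p x = (\<Sum>i\<le>degree p. coeff p i *s ((*v) A ^^ i) x)"

lemma poly_mat_vec_altdef:
  "degree p \<le> n \<Longrightarrow> poly_mat_vec A p x = (\<Sum>i\<le>n. coeff p i *s ((*v) A ^^ i) x)"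
  unfolding poly_mat_vec_def by (rule sum.mono_neutral_left) (auto simp: coeff_eq_0)

lemma matrix_vector_mult_sum_smult:
  "A *v (\<Sum>i\<in>I. c i *s x i) = (\<Sum>i\<in>I. c i *s (A *v x i))" for A :: "complex^'n^'n"
  by (induction I rule: infinite_finite_induct) (auto simp: matrix_vector_right_distrib vector_scalar_commute)

text \<open>Multiplying q by the linear factor gives \<open>pCons 0 q - smult l q\<close>, and the
  shift of coefficients by \<open>pCons 0\<close> amounts to one more application of A.\<close>

lemma poly_mat_vec_linear_factor:
  "poly_mat_vec A ([:- l, 1:] * q) x = A *v poly_mat_vec A q x - l *s poly_mat_vec A q x"
proof -
  let ?n = "Suc (degree q)"
  have deg: "degree ([:- l, 1:] * q) \<le> ?n"
    by (rule order_trans[OF degree_mult_le]) simp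
  have eq: "[:- l, 1:] * q = pCons 0 q - smult l q" by simp
  have "poly_mat_vec A ([:- l, 1:] * q) x =
      (\<Sum>i\<le>?n. coeff (pCons 0 q) i *s ((*v) A ^^ i) x - l *s (coeff q i *s ((*v) A ^^ i) x))"
    unfolding poly_mat_vec_altdef[OF deg] by (simp only: eq coeff_diff coeff_smult vector_sub_rdistrib vector_smult_assoc)
  also have "\<dots> = (\<Sum>i\<le>?n. coeff (pCons 0 q) i *s ((*v) A ^^ i) x) - l *s (\<Sum>i\<le>?n. coeff q i *s ((*v) A ^^ i) x)"
    by (simp add: sum_subtractf vec.scale_sum_right del: sum.atMost_Suc)
  also have "(\<Sum>i\<le>?n. coeff (pCons 0 q) i *s ((*v) A ^^ i) x) = A *v poly_mat_vec A q x"
    by (simp add: sum.atMost_Suc_shift poly_mat_vec_def matrix_vector_mult_sum_smult del: sum.atMost_Suc)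
  also have "(\<Sum>i\<le>?n. coeff q i *s ((*v) A ^^ i) x) = poly_mat_vec A q x"
    by (rule poly_mat_vec_altdef[symmetric]) simp
  finally show ?thesis .
qed

lemma poly_mat_vec_commute:
  "poly_mat_vec A q (A *v x - l *s x) = A *v poly_mat_vec A q x - l *s poly_mat_vec A q x"
proof -
  have "((*v) A ^^ i) (A *v x - l *s x) = A *v ((*v) A ^^ i) x - l *s ((*v) A ^^ i) x" for i
    by (induction i) (auto simp: matrix_vector_mult_diff_distrib vector_scalar_commute)
  then show ?thesis
    by (simp add: poly_mat_vec_def vector_ssub_ldistrib sum_subtractf matrix_vector_mult_sum_smult
        vec.scale_sum_right mult_ac)
qed

lemma bounded_linear_complex_matrix_shift: "bounded_linear (\<lambda>x. A *v x - l *s x)" for A :: "complex^'n^'n"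
  unfolding linear_conv_bounded_linear[symmetric]
  by (rule linearI) (auto simp: vec_eq_iff matrix_vector_mult_def algebra_simps sum.distrib scaleR_sum_right)

text \<open>A root of the annihilating polynomial that is not an eigenvalue is cancelled; at an eigenvalue,
  the function solves a first-order equation whose inhomogeneity is annihilated by the quotient.\<close>

lemma exp_decay_annihilated:
  fixes A :: "complex^'n^'n"
  assumes eig: "\<And>l x. x \<noteq> 0 \<Longrightarrow> A *v x = l *s x \<Longrightarrow> Re l < 0"
    and "p \<noteq> 0"
    and g: "\<And>t. (g has_vector_derivative A *v g t) (at t)"
    and "\<And>t. poly_mat_vec A p (g t) = 0"
  shows "exp_decay g"
  using assms(2-)
proof (induction "degree p" arbitrary: p g rule: less_induct)
  case less
  show ?case
  proof (cases "degree p = 0")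
    case True
    then obtain a where "p = [:a:]" "a \<noteq> 0"
      using less.prems(1) by (metis degree_eq_zeroE pCons_eq_0_iff)
    then have "g = (\<lambda>_. 0)"
      using less.prems(3) by (simp add: poly_mat_vec_def fun_eq_iff)
    then show ?thesis by (simp add: exp_decay_0)
  next
    case False
    then obtain l where "poly p l = 0"
      using fundamental_theorem_of_algebra[of p] by (auto simp: constant_degree)
    then obtain q where p: "p = [:- l, 1:] * q"
      by (auto simp: poly_eq_0_iff_dvd)
    with less.prems(1) have q: "q \<noteq> 0" by auto
    then have deg: "degree q < degree p"
      unfolding p by (subst degree_mult_eq) auto
    \<comment> \<open>A - l commutes with A, so \<open>?y\<close> solves the same equation as g,
      with an annihilating polynomial of smaller degree.\<close>
    let ?y = "\<lambda>t. A *v g t - l *s g t"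
    have "(?y has_vector_derivative A *v ?y t) (at t)" for t
      using bounded_linear.has_vector_derivative[OF bounded_linear_complex_matrix_shift less.prems(2)]
      by (simp add: matrix_vector_mult_diff_distrib vector_scalar_commute)
    moreover have "poly_mat_vec A q (?y t) = 0" for t
      using less.prems(3)[of t] by (simp only: p poly_mat_vec_linear_factor poly_mat_vec_commute)
    ultimately have y: "exp_decay ?y"
      by (rule less.hyps[OF deg q])
    show ?thesis
    proof (cases "\<exists>x. x \<noteq> 0 \<and> A *v x = l *s x")
      case True
      then have l: "Re l < 0" using eig by blast
      show ?thesis
      proof (rule exp_decay_vec, rule exp_decay_linear_ode[OF _ _ l])
        fix i
        show "((\<lambda>t. g t $ i) has_vector_derivative l * g t $ i + ?y t $ i) (at t)" for t
          using bounded_linear.has_vector_derivative[OF bounded_linear_vec_nth less.prems(2)] by simp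
        show "exp_decay (\<lambda>t. ?y t $ i)"
          by (rule exp_decay_mono[OF y]) (rule Finite_Cartesian_Product.norm_nth_le)
      qed
    next
      case False
      have "poly_mat_vec A q (g t) = 0" for t
      proof -
        have "A *v poly_mat_vec A q (g t) - l *s poly_mat_vec A q (g t) = 0"
          using less.prems(3)[of t] by (simp only: p poly_mat_vec_linear_factor)
        with False show ?thesis by (metis eq_iff_diff_eq_0)
      qed
      then show ?thesis
        by (intro less.hyps[OF deg q] less.prems)
    qed
  qed
qed

text \<open>The N + 1 powers of A from 0 to N lie in a real vector space of dimension N, so they
  satisfy a nontrivial linear relation, whose coefficients are those of p.\<close>

lemma annihilating_polynomial_exists:
  fixes A :: "complex^'n^'n"
  obtains p where "p \<noteq> 0" "\<And>x. poly_mat_vec A p x = 0"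
proof -
  define W where "W i = ((**) A ^^ i) (mat 1)" for i :: nat
  have W: "W i *v x = ((*v) A ^^ i) x" for i x
    by (induction i) (simp_all add: W_def flip: matrix_vector_mul_assoc)
  define N where "N = DIM(complex^'n^'n)"
  obtain u :: "nat \<Rightarrow> real" where u: "(\<Sum>i\<le>N. u i *\<^sub>R W i) = 0" and nz: "\<exists>i\<le>N. u i \<noteq> 0"
  \<comment> \<open>Linear dependence is a property of sets. If two powers coincide, the set is too
    small, but their difference is already a relation.\<close>
  proof (cases "inj_on W {..N}")
    case True
    then have "card (W ` {..N}) > N" by (simp add: card_image)
    then have "dependent (W ` {..N})"
      by (intro dependent_biggerset) (auto simp: N_def)
    then obtain v where v: "(\<Sum>w\<in>W ` {..N}. v w *\<^sub>R w) = 0" "\<exists>w\<in>W ` {..N}. v w \<noteq> 0"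
      by (auto simp: real_vector.dependent_finite)
    show ?thesis
      using v by (intro that[of "v \<circ> W"]) (auto simp: sum.reindex[OF True] o_def)
  next
    case False
    then obtain i j where ij: "i \<le> N" "j \<le> N" "i \<noteq> j" "W i = W j"
      by (auto simp: inj_on_def)
    let ?u = "\<lambda>k. if k = i then 1 else if k = j then - 1 else 0 :: real"
    have "(\<Sum>k\<le>N. ?u k *\<^sub>R W k) = (\<Sum>k\<in>{i, j}. ?u k *\<^sub>R W k)"
      using ij by (intro sum.mono_neutral_right) auto
    also have "\<dots> = 0" using ij by simp
    finally show ?thesis using ij by (intro that[of ?u]) (auto intro!: exI[of _ i])
  qed
  define p :: "complex poly" where "p = (\<Sum>i\<le>N. monom (of_real (u i)) i)"
  have coeff: "coeff p i = (if i \<le> N then of_real (u i) else 0)" for i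
    by (simp add: p_def coeff_sum coeff_monom)
  have "p \<noteq> 0" using nz coeff by (metis coeff_0 of_real_eq_0_iff)
  moreover have "poly_mat_vec A p x = 0" for x
  proof -
    have "degree p \<le> N" by (rule degree_le) (simp add: coeff)
    then have "poly_mat_vec A p x = (\<Sum>i\<le>N. of_real (u i) *s (W i *v x))"
      by (simp add: poly_mat_vec_altdef coeff W)
    also have "\<dots> = (\<Sum>i\<le>N. u i *\<^sub>R (W i *v x))"
      by (simp add: vec_eq_iff scaleR_conv_of_real[where 'a = complex])
    also have "\<dots> = (\<Sum>i\<le>N. u i *\<^sub>R W i) *v x"
      by (induction N) (simp_all add: vec_eq_iff matrix_vector_mult_def sum.distrib scaleR_sum_right algebra_simps)
    finally show ?thesis by (simp add: u)
  qed
  ultimately show ?thesis by (rule that)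
qed

definition cmat :: "real^'m^'n \<Rightarrow> complex^'m^'n" where
  "cmat A = (\<chi> i j. of_real (A $ i $ j))"

text \<open>Column j of the exponential, read as a complex vector, solves g' = A g, and its norm
  bounds each of its entries. Complex scalars are needed for the eigenvalues.\<close>

lemma mat_exp_decay:
  fixes A :: "real^'n^'n"
  assumes eig: "\<And>l x. x \<noteq> 0 \<Longrightarrow> cmat A *v x = l *s x \<Longrightarrow> Re l < 0"
  shows "exp_decay (\<lambda>t. mat_exp (t *\<^sub>R A))"
proof (rule exp_decay_vec, rule exp_decay_vec)
  fix i j
  let ?g = "\<lambda>t. \<chi> k. complex_of_real (mat_exp (t *\<^sub>R A) $ k $ j)"
  obtain p where p: "p \<noteq> 0" "\<And>x. poly_mat_vec (cmat A) p x = 0"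
    using annihilating_polynomial_exists by blast
  have deriv: "(?g has_vector_derivative cmat A *v ?g t) (at t)" for t
  proof (rule has_vector_derivative_vec_lambda)
    fix k
    have "bounded_linear (\<lambda>X :: real^'n^'n. complex_of_real (X $ k $ j))"
      by (intro bounded_linear_compose[OF bounded_linear_of_real]
          bounded_linear_compose[OF bounded_linear_vec_nth bounded_linear_vec_nth])
    from bounded_linear.has_vector_derivative[OF this mat_exp_has_vector_derivative]
    show "((\<lambda>t. ?g t $ k) has_vector_derivative (cmat A *v ?g t) $ k) (at t)"
      by (simp add: matrix_vector_mult_def cmat_def matrix_matrix_mult_def)
  qed
  have "exp_decay ?g"
    by (rule exp_decay_annihilated[OF _ p(1) deriv p(2)]) (rule eig)
  then show "exp_decay (\<lambda>t. mat_exp (t *\<^sub>R A) $ i $ j)"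
  proof (rule exp_decay_mono)
    show "norm (mat_exp (t *\<^sub>R A) $ i $ j) \<le> norm (?g t)" for t
      using Finite_Cartesian_Product.norm_nth_le[of "?g t" i] by simp
  qed
qed

section \<open>Block matrices\<close>

lemma block_pos_range: "1 \<le> block_pos i" "block_pos (i :: 'p::{finite,linorder}) \<le> CARD('p)"
  using bij_betw_imp_surj_on[OF bij_betw_block_pos[where 'p = 'p]] by (auto simp: set_eq_iff image_iff Suc_le_eq)

lemma sum_block_pos: "(\<Sum>i\<in>UNIV. f (block_pos (i :: 'p::{finite,linorder}))) = (\<Sum>n=1..CARD('p). f n)"
  by (rule sum.reindex_bij_betw[OF bij_betw_block_pos])

lemma sum_UNIV_prod: "(\<Sum>x\<in>UNIV. f x) = (\<Sum>i\<in>UNIV. \<Sum>a\<in>UNIV. f (i, a))"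
  for f :: "'p::finite \<times> 'k::finite \<Rightarrow> 'b::comm_monoid_add"
  by (simp add: UNIV_Times_UNIV[symmetric] sum.cartesian_product del: UNIV_Times_UNIV)

lemma matrix_inv_mult:
  fixes A :: "real^'n^'n"
  assumes "invertible A"
  shows "A ** matrix_inv A = mat 1" "matrix_inv A ** A = mat 1"
  using assms someI_ex[of "\<lambda>A'. A ** A' = mat 1 \<and> A' ** A = mat 1"]
  by (auto simp: invertible_def matrix_inv_def)

lemma mat_mult_vec: "mat c *v x = c *s x" for x :: "'c::semiring_1^'n"
  by (simp add: vec_eq_iff matrix_vector_mult_def mat_def if_distrib[of "\<lambda>z. z * _"] sum.delta cong: if_cong)

text \<open>Block functions are defined on all natural numbers, but only positions from 1 up to the
  number of blocks matter.\<close>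

lemma block_mat_cong:
  "(\<And>i j. 1 \<le> i \<Longrightarrow> i \<le> CARD('n) \<Longrightarrow> 1 \<le> j \<Longrightarrow> j \<le> CARD('m) \<Longrightarrow> F i j = G i j) \<Longrightarrow>
    (block_mat F :: real^('m::{finite,linorder} \<times> 'k::finite)^('n::{finite,linorder} \<times> 'k::finite)) = block_mat G"
  by (simp add: block_mat_def block_pos_range del: One_nat_def)

lemma block_row_cong:
  "(\<And>j. 1 \<le> j \<Longrightarrow> j \<le> CARD('m) \<Longrightarrow> F j = G j) \<Longrightarrow>
    (block_row F :: real^('m::{finite,linorder} \<times> 'k::finite)^'k) = block_row G"
  by (simp add: block_row_def block_pos_range del: One_nat_def)

lemma block_col_cong:
  "(\<And>i. 1 \<le> i \<Longrightarrow> i \<le> CARD('n) \<Longrightarrow> F i = G i) \<Longrightarrow>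
    (block_col F :: real^'k^('n::{finite,linorder} \<times> 'k::finite)) = block_col G"
  by (simp add: block_col_def block_pos_range del: One_nat_def)

lemma block_mat_mult_block_mat:
  "(block_mat F :: real^('m::{finite,linorder} \<times> 'k::finite)^('n::{finite,linorder} \<times> 'k::finite)) **
    (block_mat G :: real^('l::{finite,linorder} \<times> 'k::finite)^('m \<times> 'k)) =
   block_mat (\<lambda>i j. \<Sum>n=1..CARD('m). F i n ** G n j)"
  by (simp add: vec_eq_iff block_mat_def matrix_matrix_mult_def sum_UNIV_prod flip: sum_block_pos del: One_nat_def)

lemma block_row_mult_block_mat:
  "(block_row F :: real^('m::{finite,linorder} \<times> 'k::finite)^'k) **
    (block_mat G :: real^('l::{finite,linorder} \<times> 'k::finite)^('m \<times> 'k)) =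
   block_row (\<lambda>j. \<Sum>n=1..CARD('m). F n ** G n j)"
  by (simp add: vec_eq_iff block_mat_def block_row_def matrix_matrix_mult_def sum_UNIV_prod flip: sum_block_pos del: One_nat_def)

lemma block_mat_mult_block_col:
  "(block_mat F :: real^('m::{finite,linorder} \<times> 'k::finite)^('n::{finite,linorder} \<times> 'k::finite)) **
    (block_col G :: real^'k^('m \<times> 'k)) =
   block_col (\<lambda>i. \<Sum>n=1..CARD('m). F i n ** G n)"
  by (simp add: vec_eq_iff block_mat_def block_col_def matrix_matrix_mult_def sum_UNIV_prod flip: sum_block_pos del: One_nat_def)

lemma block_row_mult_block_col:
  "(block_row F :: real^('m::{finite,linorder} \<times> 'k::finite)^'k) ** (block_col G :: real^'k^('m \<times> 'k)) =
   (\<Sum>n=1..CARD('m). F n ** G n)"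
  by (simp add: vec_eq_iff block_row_def block_col_def matrix_matrix_mult_def sum_UNIV_prod flip: sum_block_pos del: One_nat_def)

lemma block_col_mult_block_row:
  "(block_col F :: real^'k^('n::{finite,linorder} \<times> 'k::finite)) **
    (block_row G :: real^('m::{finite,linorder} \<times> 'k::finite)^'k) = block_mat (\<lambda>i j. F i ** G j)"
  by (simp add: vec_eq_iff block_mat_def block_row_def block_col_def matrix_matrix_mult_def)

lemma block_mat_add: "block_mat F + block_mat G = block_mat (\<lambda>i j. F i j + G i j)"
  by (simp add: vec_eq_iff block_mat_def)

lemma block_mat_sum: "(\<Sum>n\<in>I. block_mat (F n)) = block_mat (\<lambda>i j. \<Sum>n\<in>I. F n i j)"
  by (simp add: vec_eq_iff block_mat_def)

lemma block_col_0: "block_col (\<lambda>_. 0) = 0"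
  by (simp add: vec_eq_iff block_col_def)

lemma block_pos_inject: "block_pos i = block_pos j \<longleftrightarrow> i = (j :: 'p::{finite,linorder})"
  using bij_betw_block_pos[where 'p = 'p] by (auto simp: bij_betw_def inj_on_def)

lemma mat_1_eq_block_mat: "mat 1 = block_mat (\<lambda>i j. if i = j then mat 1 else 0)"
  by (auto simp: vec_eq_iff block_mat_def mat_def block_pos_inject prod_eq_iff)

lemma transpose_E_top: "transpose E_top = block_mat (\<lambda>i j. if i = j then mat 1 else 0)"
  by (auto simp: vec_eq_iff block_mat_def mat_def transpose_def E_top_def)

section \<open>Matrix identities of the state space model\<close>

lemma if_matrix_mult:
  "(if b then X else 0) ** Y = (if b then X ** Y else 0)"
  "X' ** (if b then Y' else 0) = (if b then X' ** Y' else 0)"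
  for X :: "real^'m^'n" and Y :: "real^'k^'m" and X' :: "real^'m^'n" and Y' :: "real^'k^'m"
  by (simp_all add: mmult.zero_left mmult.zero_right)

text \<open>This is the transpose of \<open>E_block j\<close>: applied to a state, it reads off
  block j.\<close>

definition unit_row :: "nat \<Rightarrow> real^('m::{finite,linorder} \<times> 'k::finite)^'k" where
  "unit_row j = block_row (\<lambda>i. if i = j then mat 1 else 0)"

text \<open>Applied to the state, the coefficients of the moving average polynomial shifted by \<open>m\<close>
  blocks give the \<open>m\<close>-th derivative of the output.\<close>

definition shifted_row :: "nat \<Rightarrow> (nat \<Rightarrow> real^'k^'k) \<Rightarrow> nat \<Rightarrow> real^('p::{finite,linorder} \<times> 'k::finite)^'k" where
  "shifted_row q C m = block_row (\<lambda>j. if m + 1 \<le> j \<and> j \<le> m + q + 1 then C (j - 1 - m) else 0)"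

lemma state_C_eq_shifted_row: "state_C q C = shifted_row q C 0"
  unfolding state_C_def shifted_row_def by (rule block_row_cong) auto

text \<open>p - q - 1 is the largest shift for which all q + 1 coefficients still fit into p blocks.
  Hence \<open>state_C_shift\<close> belongs to the highest derivative.\<close>

lemma state_C_shift_eq_shifted_row:
  assumes "q < CARD('p)"
  shows "(state_C_shift q C :: real^('p::{finite,linorder} \<times> 'k::finite)^'k) = shifted_row q C (CARD('p) - q - 1)"
  unfolding state_C_shift_def shifted_row_def using assms
  by (intro block_row_cong) (auto intro!: arg_cong[of _ _ C])

context
  fixes A C :: "nat \<Rightarrow> real^'k^'k"
begin

text \<open>The last coefficient stands in block m + q + 1, before the last one, so the row meets
  only those block rows of \<open>state_A A\<close> that are shifts.\<close>

lemma shifted_row_mult_state_A: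
  assumes "m + q + 1 < CARD('p)"
  shows "(shifted_row q C m :: real^('p::{finite,linorder} \<times> 'k::finite)^'k) ** state_A A = shifted_row q C (Suc m)"
  unfolding shifted_row_def state_A_def block_row_mult_block_mat
proof (rule block_row_cong)
  fix j assume j: "1 \<le> j" "j \<le> CARD('p)"
  have "(\<Sum>n=1..CARD('p). (if m + 1 \<le> n \<and> n \<le> m + q + 1 then C (n - 1 - m) else 0) **
      (if n < CARD('p) then if j = n + 1 then mat 1 else 0 else - A (CARD('p) + 1 - j))) =
    (\<Sum>n=1..CARD('p). if n = j - 1 then if m + 1 \<le> n \<and> n \<le> m + q + 1 then C (n - 1 - m) else 0 else 0)"
    using assms j by (intro sum.cong) (auto simp: mmult.zero_left mmult.zero_right)
  also have "\<dots> = (if Suc m + 1 \<le> j \<and> j \<le> Suc m + q + 1 then C (j - 1 - Suc m) else 0)"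
    using assms j by (auto simp: sum.delta)
  finally show "(\<Sum>n=1..CARD('p). (if m + 1 \<le> n \<and> n \<le> m + q + 1 then C (n - 1 - m) else 0) **
      (if n < CARD('p) then if j = n + 1 then mat 1 else 0 else - A (CARD('p) + 1 - j))) =
      (if Suc m + 1 \<le> j \<and> j \<le> Suc m + q + 1 then C (j - 1 - Suc m) else 0)" .
qed

text \<open>The noise enters through the last block, which the row does not reach. For m + q + 1 = p
  the product would be \<open>C q\<close>.\<close>

lemma shifted_row_mult_state_B:
  assumes "m + q + 1 < CARD('p)"
  shows "(shifted_row q C m :: real^('p::{finite,linorder} \<times> 'k::finite)^'k) ** state_B = 0"
  unfolding shifted_row_def state_B_def block_row_mult_block_col if_matrix_mult
  using assms by (auto intro!: sum.neutral)

lemma unit_row_mult_state_A: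
  assumes "1 \<le> j" "j < CARD('p)"
  shows "(unit_row j :: real^('p::{finite,linorder} \<times> 'k::finite)^'k) ** state_A A = unit_row (Suc j)"
  unfolding unit_row_def state_A_def block_row_mult_block_mat if_matrix_mult
  using assms by (intro block_row_cong) (auto simp: sum.delta)

lemma E_last_mult_E_top:
  assumes "CARD('q) < CARD('p)"
  shows "(E_last :: real^('q::{finite,linorder} \<times> 'k::finite)^'k) ** (E_top :: real^('p::{finite,linorder} \<times> 'k::finite)^('q \<times> 'k))
    = unit_row CARD('q)"
  unfolding E_last_def E_top_def unit_row_def block_row_mult_block_mat if_matrix_mult
  by (intro block_row_cong) (auto simp: sum.delta)

text \<open>Above block row q both sides are shifts. In row q, the blocks of
  \<open>inv_Theta C\<close> times (C_0, ..., C_q) cancel the last row of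
  \<open>inv_Lambda C\<close> in the columns 1 to q and leave the unit matrix in column q + 1, as
  the shift demands.\<close>

lemma E_top_mult_state_A:
  assumes "CARD('q) < CARD('p)" "invertible (C CARD('q))"
  shows "(E_top :: real^('p::{finite,linorder} \<times> 'k::finite)^('q::{finite,linorder} \<times> 'k::finite)) ** state_A A =
    inv_Lambda C ** E_top + inv_Theta C ** shifted_row CARD('q) C 0"
  unfolding E_top_def state_A_def inv_Lambda_def inv_Theta_def shifted_row_def
    block_mat_mult_block_mat block_col_mult_block_row block_mat_add if_matrix_mult
proof (rule block_mat_cong)
  fix i j assume ij: "1 \<le> i" "i \<le> CARD('q)" "1 \<le> j" "j \<le> CARD('p)"
  have inv: "matrix_inv (C CARD('q)) ** C CARD('q) = mat 1"
    by (rule matrix_inv_mult(2)[OF assms(2)])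
  show "(\<Sum>n = 1..CARD('p). if i = n then mat 1 ** (if n < CARD('p) then if j = n + 1 then mat 1 else 0 else - A (CARD('p) + 1 - j)) else 0) =
    (\<Sum>n = 1..CARD('q). if n = j then (if i < CARD('q) then if n = i + 1 then mat 1 else 0 else - (matrix_inv (C CARD('q)) ** C (n - 1))) ** mat 1 else 0) +
    (if 0 + 1 \<le> j \<and> j \<le> 0 + CARD('q) + 1 then if i = CARD('q) then matrix_inv (C CARD('q)) ** C (j - 1 - 0) else 0 else 0)"
    using ij assms(1) inv by (auto simp: sum.delta sum.delta' not_less)
qed

lemma E_top_mult_state_B:
  assumes "CARD('q) < CARD('p)"
  shows "(E_top :: real^('p::{finite,linorder} \<times> 'k::finite)^('q::{finite,linorder} \<times> 'k::finite)) ** state_B = 0"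
proof -
  have "(E_top :: real^('p \<times> 'k)^('q \<times> 'k)) ** state_B = block_col (\<lambda>_. 0)"
    unfolding E_top_def state_B_def block_mat_mult_block_col if_matrix_mult
    using assms by (intro block_col_cong) (auto intro!: sum.neutral)
  then show ?thesis by (simp add: block_col_0)
qed

text \<open>It splits a state into the q blocks recovered by inversion and the p - q blocks
  expressed by derivatives.\<close>

lemma block_partition_of_unity:
  assumes "CARD('q) < CARD('p)"
  shows "(mat 1 :: real^('p::{finite,linorder} \<times> 'k::finite)^('p \<times> 'k)) =
    transpose (E_top :: real^('p \<times> 'k)^('q::{finite,linorder} \<times> 'k::finite)) ** E_top +
    (\<Sum>j=1..CARD('p) - CARD('q). E_block (CARD('q) + j) ** unit_row (CARD('q) + j))"
  unfolding transpose_E_top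
  unfolding E_top_def E_block_def unit_row_def mat_1_eq_block_mat
    block_mat_mult_block_mat block_col_mult_block_row block_mat_add block_mat_sum if_matrix_mult
proof (rule block_mat_cong)
  fix i j assume ij: "1 \<le> i" "i \<le> CARD('p)" "1 \<le> j" "j \<le> CARD('p)"
  have 2: "(\<Sum>n=1..CARD('p) - CARD('q). if j = CARD('q) + n then if i = CARD('q) + n then mat 1 ** mat 1 else 0 else 0) =
     (\<Sum>n=1..CARD('p) - CARD('q). if n = j - CARD('q) then (if i = j \<and> CARD('q) < j then mat 1 :: real^'k^'k else 0) else 0)"
    by (intro sum.cong) auto
  show "(if i = j then mat 1 :: real^'k^'k else 0) =
    (\<Sum>n=1..CARD('q). if n = j then if i = n then mat 1 ** mat 1 else 0 else 0) +
    (\<Sum>n=1..CARD('p) - CARD('q). if j = CARD('q) + n then if i = CARD('q) + n then mat 1 ** mat 1 else 0 else 0)"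
    unfolding 2 using ij by (auto simp: sum.delta sum.delta')
qed

text \<open>The blocks of the state below the first \<open>q\<close> ones: the block \<open>q + j\<close> is the \<open>j\<close>-th derivative
  of the block \<open>q\<close>, and the first \<open>q\<close> blocks solve the linear equation driven by the output.\<close>

lemma unit_row_expansion:
  assumes "CARD('q) < CARD('p)" "invertible (C CARD('q))" "j \<le> CARD('p) - CARD('q)"
  shows "(unit_row (CARD('q) + j) :: real^('p::{finite,linorder} \<times> 'k::finite)^'k) =
    E_last ** (mat_power (inv_Lambda C) j ** (E_top :: real^('p \<times> 'k)^('q::{finite,linorder} \<times> 'k::finite)) +
      (\<Sum>m<j. mat_power (inv_Lambda C) (j - 1 - m) ** inv_Theta C ** shifted_row CARD('q) C m))"
  using assms(3)
proof (induction j)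
  case 0
  show ?case by (simp add: E_last_mult_E_top[OF assms(1)])
next
  case (Suc j)
  let ?L = "inv_Lambda C :: real^('q \<times> 'k)^('q \<times> 'k)" and ?T = "inv_Theta C :: real^'k^('q \<times> 'k)"
  let ?R = "shifted_row CARD('q) C :: nat \<Rightarrow> real^('p \<times> 'k)^'k"
  let ?E = "E_top :: real^('p \<times> 'k)^('q \<times> 'k)"
  have "(unit_row (CARD('q) + Suc j) :: real^('p \<times> 'k)^'k) = unit_row (CARD('q) + j) ** state_A A"
    using Suc.prems by (simp add: unit_row_mult_state_A Suc_le_eq)
  also have "\<dots> = E_last ** ((mat_power ?L j ** ?E + (\<Sum>m<j. mat_power ?L (j - 1 - m) ** ?T ** ?R m)) ** state_A A)"
    using Suc by (simp add: matrix_mul_assoc)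
  also have "(mat_power ?L j ** ?E + (\<Sum>m<j. mat_power ?L (j - 1 - m) ** ?T ** ?R m)) ** state_A A =
      mat_power ?L j ** (?E ** state_A A) + (\<Sum>m<j. mat_power ?L (j - 1 - m) ** ?T ** (?R m ** state_A A))"
    by (simp add: mmult.add_left mmult.sum_left matrix_mul_assoc)
  \<comment> \<open>This substitution creates the summand m = 0 of the next sum; the old summands
    move from m to m + 1 because \<open>state_A A\<close> shifts their rows.\<close>
  also have "?E ** state_A A = ?L ** ?E + ?T ** ?R 0"
    by (rule E_top_mult_state_A[OF assms(1,2)])
  also have "(\<Sum>m<j. mat_power ?L (j - 1 - m) ** ?T ** (?R m ** state_A A)) =
      (\<Sum>m<j. mat_power ?L (j - 1 - m) ** ?T ** ?R (Suc m))"
    using Suc.prems by (intro sum.cong refl) (simp add: shifted_row_mult_state_A)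
  also have "mat_power ?L j ** (?L ** ?E + ?T ** ?R 0) + (\<Sum>m<j. mat_power ?L (j - 1 - m) ** ?T ** ?R (Suc m)) =
      mat_power ?L (Suc j) ** ?E + (\<Sum>m<Suc j. mat_power ?L (Suc j - 1 - m) ** ?T ** ?R m)"
    by (simp add: sum.lessThan_Suc_shift mat_power_Suc2 mmult.add_right matrix_mul_assoc add.assoc del: sum.lessThan_Suc)
  finally show ?case .
qed

text \<open>Insert the partition of the unit matrix to the right of the exponential and expand each
  lower block. Collecting the terms that end in \<open>E_top\<close> and those that end in the row
  of shift m gives the coefficient matrices of the theorem.\<close>

lemma state_expansion:
  assumes "CARD('q) < CARD('p)" "invertible (C CARD('q))"
  shows "K ** mat_exp (h *\<^sub>R state_A A :: real^('p::{finite,linorder} \<times> 'k::finite)^('p \<times> 'k)) =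
    coeff_int K (state_A A) (inv_Lambda C :: real^('q::{finite,linorder} \<times> 'k::finite)^('q \<times> 'k)) h ** E_top +
    (\<Sum>m=0..CARD('p) - CARD('q) - 1.
      coeff_deriv K (state_A A) (inv_Lambda C :: real^('q \<times> 'k)^('q \<times> 'k)) m h ** inv_Theta C ** shifted_row CARD('q) C m)"
proof -
  let ?L = "inv_Lambda C :: real^('q \<times> 'k)^('q \<times> 'k)" and ?T = "inv_Theta C :: real^'k^('q \<times> 'k)"
  let ?R = "shifted_row CARD('q) C :: nat \<Rightarrow> real^('p \<times> 'k)^'k"
  let ?E = "E_top :: real^('p \<times> 'k)^('q \<times> 'k)" and ?l = "E_last :: real^('q \<times> 'k)^'k"
  let ?B = "\<lambda>j. E_block (CARD('q) + j) :: real^'k^('p \<times> 'k)"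
  let ?d = "CARD('p) - CARD('q)"
  have "(mat 1 :: real^('p \<times> 'k)^('p \<times> 'k)) = transpose ?E ** ?E + (\<Sum>j=1..?d. ?B j ** unit_row (CARD('q) + j))"
    by (rule block_partition_of_unity[OF assms(1)])
  also have "(\<Sum>j=1..?d. ?B j ** unit_row (CARD('q) + j)) =
      (\<Sum>j=1..?d. ?B j ** ?l ** mat_power ?L j ** ?E) +
      (\<Sum>j=1..?d. \<Sum>m<j. ?B j ** ?l ** mat_power ?L (j - 1 - m) ** ?T ** ?R m)"
    unfolding sum.distrib[symmetric]
    by (intro sum.cong refl) (simp add: unit_row_expansion[OF assms] mmult.add_right mmult.sum_right matrix_mul_assoc)
  \<comment> \<open>The sum over the triangle m < j is reordered, so that each derivative of the
    output collects its coefficient.\<close>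
  also have "(\<Sum>j=1..?d. \<Sum>m<j. ?B j ** ?l ** mat_power ?L (j - 1 - m) ** ?T ** ?R m) =
      (\<Sum>m=0..?d - 1. \<Sum>j=m+1..?d. ?B j ** ?l ** mat_power ?L (j - 1 - m) ** ?T ** ?R m)"
    by (subst sum.Sigma, simp, simp, subst sum.Sigma, simp, simp,
        rule sum.reindex_bij_witness[of _ "\<lambda>(m, j). (j, m)" "\<lambda>(j, m). (m, j)"]) auto
  finally have "K ** mat_exp (h *\<^sub>R state_A A) ** mat 1 = K ** mat_exp (h *\<^sub>R state_A A) ** (transpose ?E ** ?E +
     ((\<Sum>j=1..?d. ?B j ** ?l ** mat_power ?L j ** ?E) +
      (\<Sum>m=0..?d - 1. \<Sum>j=m+1..?d. ?B j ** ?l ** mat_power ?L (j - 1 - m) ** ?T ** ?R m)))"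
    by simp
  then show ?thesis
    by (simp add: coeff_int_def coeff_deriv_def mmult.add_right mmult.add_left mmult.sum_right mmult.sum_left matrix_mul_assoc add.assoc)
qed

end

section \<open>Eigenvectors of block companion matrices and stability\<close>

lemma cmat_matrix_mult: "cmat (A ** B) = cmat A ** cmat B"
  by (simp add: cmat_def matrix_matrix_mult_def vec_eq_iff)

lemma cmat_mat_1: "cmat (mat 1) = mat 1"
  by (simp add: cmat_def mat_def vec_eq_iff)

lemma cmat_0: "cmat 0 *v x = 0"
  by (simp add: cmat_def matrix_vector_mult_def vec_eq_iff)

lemma cmat_uminus: "cmat (- A) *v x = - (cmat A *v x)"
  by (simp add: cmat_def matrix_vector_mult_def vec_eq_iff sum_negf)

definition vec_block :: "'c^('p::{finite,linorder} \<times> 'k::finite) \<Rightarrow> nat \<Rightarrow> 'c^'k" where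
  "vec_block x n = (\<chi> a. x $ (inv_into UNIV block_pos n, a))"

lemma vec_block_block_pos: "vec_block x (block_pos i) $ a = x $ (i, a)"
proof -
  have "inv_into UNIV block_pos (block_pos i) = i"
    using bij_betw_block_pos by (intro inv_into_f_f) (auto simp: bij_betw_def)
  then show ?thesis by (simp add: vec_block_def)
qed

lemma vec_block_cmat_block_mat:
  fixes x :: "complex^('m::{finite,linorder} \<times> 'k::finite)"
  assumes "1 \<le> i" "i \<le> CARD('n)"
  shows "vec_block (cmat (block_mat F :: real^('m \<times> 'k)^('n::{finite,linorder} \<times> 'k::finite)) *v x) i =
    (\<Sum>j=1..CARD('m). cmat (F i j) *v vec_block x j)"
proof -
  obtain r :: 'n where i: "i = block_pos r"
    using bij_betw_imp_surj_on[OF bij_betw_block_pos[where 'p = 'n]] assms by fastforce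
  show ?thesis
    unfolding i vec_eq_iff
    by (simp add: vec_block_block_pos cmat_def block_mat_def matrix_vector_mult_def sum_UNIV_prod flip: sum_block_pos del: One_nat_def)
qed

lemma vec_block_eq_0_iff:
  "x = 0 \<longleftrightarrow> (\<forall>n. 1 \<le> n \<and> n \<le> CARD('p) \<longrightarrow> vec_block x n = 0)"
  for x :: "'c::zero^('p::{finite,linorder} \<times> 'k::finite)"
proof
  assume *: "\<forall>n. 1 \<le> n \<and> n \<le> CARD('p) \<longrightarrow> vec_block x n = 0"
  have "x $ (i, a) = 0" for i a
    using *[rule_format, of "block_pos i"] by (simp add: block_pos_range flip: vec_block_block_pos del: One_nat_def)
  then show "x = 0" by (simp add: vec_eq_iff)
qed (simp add: vec_block_def vec_eq_iff)

text \<open>All block rows but the last force each block to be l times its predecessor, so the first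
  block v determines x and cannot vanish; the last row is the stated equation. W is arbitrary
  because both \<open>state_A\<close> and \<open>inv_Lambda\<close> have this form.\<close>

lemma companion_eigenvector:
  fixes x :: "complex^('n::{finite,linorder} \<times> 'k::finite)" and W :: "nat \<Rightarrow> real^'k^'k"
  assumes x: "x \<noteq> 0"
    and eig: "cmat (block_mat (\<lambda>i j. if i < CARD('n) then (if j = i + 1 then mat 1 else 0) else W j)
      :: real^('n \<times> 'k)^('n \<times> 'k)) *v x = l *s x"
  obtains v where "v \<noteq> 0" "(\<Sum>j=1..CARD('n). l ^ (j - 1) *s (cmat (W j) *v v)) = l ^ CARD('n) *s v"
proof -
  let ?F = "\<lambda>i j. if i < CARD('n) then (if j = i + 1 then mat 1 else 0) else W j"
  have row: "(\<Sum>j=1..CARD('n). cmat (?F i j) *v vec_block x j) = l *s vec_block x i"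
    if "1 \<le> i" "i \<le> CARD('n)" for i
  proof -
    have "(\<Sum>j=1..CARD('n). cmat (?F i j) *v vec_block x j) = vec_block (l *s x) i"
      using vec_block_cmat_block_mat[OF that, of ?F x] eig by simp
    also have "\<dots> = l *s vec_block x i" by (simp add: vec_block_def vec_eq_iff)
    finally show ?thesis .
  qed
  have step: "vec_block x (Suc i) = l *s vec_block x i" if "1 \<le> i" "i < CARD('n)" for i
  proof -
    have "(\<Sum>j=1..CARD('n). cmat (?F i j) *v vec_block x j) = (\<Sum>j=1..CARD('n). if j = Suc i then vec_block x j else 0)"
      using that by (intro sum.cong) (auto simp: cmat_mat_1 cmat_0)
    then show ?thesis using row[of i] that by simp
  qed
  define v where "v = vec_block x 1"
  have block: "vec_block x (Suc i) = l ^ i *s v" if "i < CARD('n)" for i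
    using that by (induction i) (auto simp: v_def step)
  show ?thesis
  proof (rule that)
    show "v \<noteq> 0"
    proof
      assume "v = 0"
      then have "vec_block x n = 0" if "1 \<le> n" "n \<le> CARD('n)" for n
        using block[of "n - 1"] that by simp
      with x show False by (simp add: vec_block_eq_0_iff)
    qed
    have n: "CARD('n) = Suc (CARD('n) - 1)" by simp
    have "(\<Sum>j=1..CARD('n). l ^ (j - 1) *s (cmat (W j) *v v)) = (\<Sum>j=1..CARD('n). cmat (?F CARD('n) j) *v vec_block x j)"
    proof (intro sum.cong refl)
      fix j assume "j \<in> {1..CARD('n)}"
      then show "l ^ (j - 1) *s (cmat (W j) *v v) = cmat (?F CARD('n) j) *v vec_block x j"
        using block[of "j - 1"] by (cases j) (auto simp: vector_scalar_commute)
    qed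
    also have "\<dots> = l *s vec_block x CARD('n)" by (intro row) (auto simp: Suc_le_eq)
    also have "\<dots> = l *s (l ^ (CARD('n) - 1) *s v)"
      using block[of "CARD('n) - 1"] n by simp
    also have "\<dots> = l ^ CARD('n) *s v"
      using n by (metis power_Suc vector_smult_assoc)
    finally show "(\<Sum>j=1..CARD('n). l ^ (j - 1) *s (cmat (W j) *v v)) = l ^ CARD('n) *s v" .
  qed
qed

lemma det_eq_0_if_kernel: "v \<noteq> 0 \<Longrightarrow> A *v v = 0 \<Longrightarrow> det A = 0" for A :: "complex^'k^'k"
  by (metis invertible_det_nz invertible_left_inverse matrix_left_invertible_ker)

lemma matrix_eq_sum_mult_vec: 
  "(\<chi> i j. \<Sum>n\<in>I. c n * (B n $ i $ j)) *v v = (\<Sum>n\<in>I. c n *s (B n *v v))" for B :: "nat \<Rightarrow> complex^'k^'k"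
  by (simp add: vec_eq_iff matrix_vector_mult_def sum_distrib_left sum_distrib_right mult_ac)
     (intro allI sum.swap)

lemma mat_exp_state_A_decay:
  fixes A :: "nat \<Rightarrow> real^'k^'k"
  assumes "\<And>z. det (poly_P CARD('p) A z) = 0 \<Longrightarrow> Re z < 0"
  shows "exp_decay (\<lambda>t. mat_exp (t *\<^sub>R state_A A :: real^('p::{finite,linorder} \<times> 'k::finite)^('p \<times> 'k)))"
proof (rule mat_exp_decay)
  fix l and x :: "complex^('p \<times> 'k)"
  assume x: "x \<noteq> 0" "cmat (state_A A :: real^('p \<times> 'k)^('p \<times> 'k)) *v x = l *s x"
  obtain v where v: "v \<noteq> 0"
    "(\<Sum>j=1..CARD('p). l ^ (j - 1) *s (cmat (- A (CARD('p) + 1 - j)) *v v)) = l ^ CARD('p) *s v"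
    using companion_eigenvector[OF x(1), of "\<lambda>j. - A (CARD('p) + 1 - j)" l] x(2) unfolding state_A_def by blast
  \<comment> \<open>In the polynomial \<open>A n\<close> comes with the power p - n, in the
    companion matrix it stands in block column p + 1 - n; reversing the summation matches the
    two.\<close>
  have "(\<Sum>n=1..CARD('p). l ^ (CARD('p) - n) *s (cmat (A n) *v v)) =
      (\<Sum>j=1..CARD('p). l ^ (j - 1) *s (cmat (A (CARD('p) + 1 - j)) *v v))"
    by (rule sum.reindex_bij_witness[of _ "\<lambda>j. CARD('p) + 1 - j" "\<lambda>j. CARD('p) + 1 - j"]) auto
  also have "\<dots> = - (l ^ CARD('p) *s v)"
    using v(2) by (simp add: cmat_uminus sum_negf vec.scale_minus_right eq_commute[of _ "l ^ CARD('p) *s v"])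
  finally have "poly_P CARD('p) A l *v v = 0"
  proof -
    assume *: "(\<Sum>n=1..CARD('p). l ^ (CARD('p) - n) *s (cmat (A n) *v v)) = - (l ^ CARD('p) *s v)"
    have "poly_P CARD('p) A l = mat (l ^ CARD('p)) + (\<chi> i j. \<Sum>n=1..CARD('p). l ^ (CARD('p) - n) * (cmat (A n) $ i $ j))"
      by (simp add: poly_P_def vec_eq_iff mat_def cmat_def)
    then have "poly_P CARD('p) A l *v v = mat (l ^ CARD('p)) *v v + (\<Sum>n=1..CARD('p). l ^ (CARD('p) - n) *s (cmat (A n) *v v))"
      by (simp only: matrix_vector_mult_add_rdistrib matrix_eq_sum_mult_vec)
    then show ?thesis by (simp add: * mat_mult_vec del: One_nat_def)
  qed
  with v(1) show "Re l < 0" using assms det_eq_0_if_kernel by blast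
qed

text \<open>Multiplying the last block row of the eigenvector equation by \<open>C q\<close> clears
  the inverse and shows that v lies in the kernel of \<open>poly_Q\<close> at l.\<close>

lemma mat_exp_inv_Lambda_decay:
  fixes C :: "nat \<Rightarrow> real^'k^'k"
  assumes "\<And>z. det (poly_Q CARD('q) C z) = 0 \<Longrightarrow> Re z < 0" and inv: "invertible (C CARD('q))"
  shows "exp_decay (\<lambda>t. mat_exp (t *\<^sub>R inv_Lambda C :: real^('q::{finite,linorder} \<times> 'k::finite)^('q \<times> 'k)))"
proof (rule mat_exp_decay)
  fix l and x :: "complex^('q \<times> 'k)"
  let ?I = "matrix_inv (C CARD('q))"
  assume x: "x \<noteq> 0" "cmat (inv_Lambda C :: real^('q \<times> 'k)^('q \<times> 'k)) *v x = l *s x"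
  obtain v where v: "v \<noteq> 0"
    "(\<Sum>j=1..CARD('q). l ^ (j - 1) *s (cmat (- (?I ** C (j - 1))) *v v)) = l ^ CARD('q) *s v"
    using companion_eigenvector[OF x(1), of "\<lambda>j. - (?I ** C (j - 1))" l] x(2) unfolding inv_Lambda_def by blast
  have C: "cmat (C CARD('q)) *v (cmat (?I ** C j) *v v) = cmat (C j) *v v" for j
    by (simp add: matrix_vector_mul_assoc matrix_mul_assoc matrix_inv_mult(1)[OF inv] flip: cmat_matrix_mult)
  have "l ^ CARD('q) *s (cmat (C CARD('q)) *v v) = cmat (C CARD('q)) *v (l ^ CARD('q) *s v)"
    by (simp add: vector_scalar_commute)
  also have "\<dots> = - (\<Sum>j=1..CARD('q). l ^ (j - 1) *s (cmat (C (j - 1)) *v v))"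
    unfolding v(2)[symmetric] by (simp add: matrix_vector_mult_sum_smult cmat_uminus vec.neg C sum_negf vec.scale_minus_right)
  also have "(\<Sum>j=1..CARD('q). l ^ (j - 1) *s (cmat (C (j - 1)) *v v)) = (\<Sum>n<CARD('q). l ^ n *s (cmat (C n) *v v))"
    by (rule sum.reindex_bij_witness[of _ Suc "\<lambda>j. j - 1"]) auto
  finally have "(\<Sum>n=0..CARD('q). l ^ n *s (cmat (C n) *v v)) = 0"
    by (simp add: atLeast0AtMost lessThan_Suc_atMost[symmetric])
  moreover have "poly_Q CARD('q) C l *v v = (\<Sum>n=0..CARD('q). l ^ n *s (cmat (C n) *v v))"
    unfolding matrix_eq_sum_mult_vec[symmetric] by (simp add: poly_Q_def cmat_def)
  ultimately show "Re l < 0" using v(1) assms(1) det_eq_0_if_kernel by metis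
qed

section \<open>Mean-square convergence\<close>

lemma measurable_vec_nth [measurable]: "(\<lambda>x :: real^'n. x $ j) \<in> borel_measurable borel"
  by (intro borel_measurable_continuous_onI continuous_intros)

lemma measurable_matrix_vector_mult [measurable]: "(\<lambda>x. (G :: real^'n^'m) *v x) \<in> borel_measurable borel"
  by (intro borel_measurable_continuous_onI mvmult.continuous_on continuous_intros)

text \<open>The value is extended real, so estimates can be chained before finiteness is known. It
  is used for random variables on M and for integrands on \<open>lborel\<close> alike.\<close>

definition sq_norm :: "'a measure \<Rightarrow> ('a \<Rightarrow> 'b::real_normed_vector) \<Rightarrow> ennreal" where
  "sq_norm M f = (\<integral>\<^sup>+w. ennreal ((norm (f w))\<^sup>2) \<partial>M)"

lemma ms_tendsto_iff_sq_norm: "ms_tendsto M Z W F \<longleftrightarrow> ((\<lambda>i. sq_norm M (\<lambda>w. Z i w - W w)) \<longlongrightarrow> 0) F"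
  by (simp add: ms_tendsto_def sq_norm_def)

lemma sq_norm_cong_AE: "AE w in M. f w = g w \<Longrightarrow> sq_norm M f = sq_norm M g"
  unfolding sq_norm_def by (rule nn_integral_cong_AE) auto

lemma sq_norm_le:
  assumes "c \<ge> 0" "\<And>w. norm (f w) \<le> c * norm (g w)" "g \<in> borel_measurable M"
  shows "sq_norm M f \<le> ennreal (c\<^sup>2) * sq_norm M g"
proof -
  have "(norm (f w))\<^sup>2 \<le> c\<^sup>2 * (norm (g w))\<^sup>2" for w
    unfolding power_mult_distrib[symmetric] by (intro power_mono assms) simp
  then have "sq_norm M f \<le> (\<integral>\<^sup>+w. ennreal (c\<^sup>2) * ennreal ((norm (g w))\<^sup>2) \<partial>M)"
    unfolding sq_norm_def by (intro nn_integral_mono) (simp flip: ennreal_mult)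
  also have "\<dots> = ennreal (c\<^sup>2) * sq_norm M g"
    unfolding sq_norm_def using assms(3) by (intro nn_integral_cmult) measurable
  finally show ?thesis .
qed

text \<open>The elementary bound (x + y)^2 \<le> 2 x^2 + 2 y^2 is the triangle inequality for
  squared norms up to a constant; this is the origin of the factors 2 and 4 in later
  estimates.\<close>

lemma sq_norm_add:
  fixes f g :: "'a \<Rightarrow> 'b::{real_normed_vector, second_countable_topology}"
  assumes [measurable]: "f \<in> borel_measurable M" "g \<in> borel_measurable M"
  shows "sq_norm M (\<lambda>w. f w + g w) \<le> 2 * sq_norm M f + 2 * sq_norm M g"
proof -
  have "(norm (f w + g w))\<^sup>2 \<le> 2 * (norm (f w))\<^sup>2 + 2 * (norm (g w))\<^sup>2" for w
  proof -
    have "(norm (f w + g w))\<^sup>2 \<le> (norm (f w) + norm (g w))\<^sup>2"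
      by (intro power_mono norm_triangle_ineq) simp
    also have "\<dots> \<le> 2 * (norm (f w))\<^sup>2 + 2 * (norm (g w))\<^sup>2"
      using sum_squares_bound[of "norm (f w)" "norm (g w)"] by (simp add: power2_sum)
    finally show ?thesis .
  qed
  then have "sq_norm M (\<lambda>w. f w + g w) \<le>
      (\<integral>\<^sup>+w. 2 * ennreal ((norm (f w))\<^sup>2) + 2 * ennreal ((norm (g w))\<^sup>2) \<partial>M)"
    unfolding sq_norm_def
    by (intro nn_integral_mono) (simp add: ennreal_mult[symmetric] ennreal_plus[symmetric] flip: ennreal_numeral del: ennreal_plus)
  also have "\<dots> = 2 * sq_norm M f + 2 * sq_norm M g"
    unfolding sq_norm_def by (simp add: nn_integral_add nn_integral_cmult)
  finally show ?thesis .
qed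

lemma sq_norm_minus: "sq_norm M (\<lambda>w. - f w) = sq_norm M f"
  by (simp add: sq_norm_def)

lemma sq_norm_diff:
  fixes f g :: "'a \<Rightarrow> 'b::{real_normed_vector, second_countable_topology}"
  assumes [measurable]: "f \<in> borel_measurable M" "g \<in> borel_measurable M"
  shows "sq_norm M (\<lambda>w. f w - g w) \<le> 2 * sq_norm M f + 2 * sq_norm M g"
  using sq_norm_add[of f M "\<lambda>w. - g w"] by (simp add: sq_norm_minus)

lemma sq_norm_eq_0_iff:
  fixes f :: "'a \<Rightarrow> 'b::{real_normed_vector, second_countable_topology}"
  assumes [measurable]: "f \<in> borel_measurable M"
  shows "sq_norm M f = 0 \<longleftrightarrow> (AE w in M. f w = 0)"
  by (simp add: sq_norm_def nn_integral_0_iff_AE ennreal_eq_0_iff)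

lemma tendsto_0_le_ennreal:
  fixes X Y :: "'i \<Rightarrow> ennreal"
  assumes "\<And>i. X i \<le> Y i" "(Y \<longlongrightarrow> 0) F"
  shows "(X \<longlongrightarrow> 0) F"
  using tendsto_sandwich[of "\<lambda>_. 0" X F Y 0] assms by simp

lemma tendsto_0_ennreal_iff:
  fixes X :: "'i \<Rightarrow> ennreal"
  shows "(X \<longlongrightarrow> 0) F \<longleftrightarrow> (\<forall>e>0. \<forall>\<^sub>F i in F. X i \<le> ennreal e)"
proof safe
  fix e :: real assume "(X \<longlongrightarrow> 0) F" "e > 0"
  then have "\<forall>\<^sub>F i in F. X i < ennreal e" by (intro order_tendstoD(2)) auto
  then show "\<forall>\<^sub>F i in F. X i \<le> ennreal e" by eventually_elim simp
next
  assume *: "\<forall>e>0. \<forall>\<^sub>F i in F. X i \<le> ennreal e"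
  show "(X \<longlongrightarrow> 0) F"
  proof (rule order_tendstoI)
    fix a :: ennreal assume "0 < a"
    then obtain b where b: "0 < b" "b < a" using dense by blast
    then obtain e where e: "b = ennreal e" "e > 0"
      by (cases b) (auto simp: ennreal_less_zero_iff top.not_eq_extremum)
    from *[rule_format, OF e(2)] show "\<forall>\<^sub>F i in F. X i < a"
      by eventually_elim (use b e in auto)
  qed simp
qed

lemma tendsto_add_cmult_ennreal:
  fixes X Y :: "'i \<Rightarrow> ennreal"
  assumes "(X \<longlongrightarrow> 0) F" "(Y \<longlongrightarrow> 0) F" "c < top" "d < top"
  shows "((\<lambda>i. c * X i + d * Y i) \<longlongrightarrow> 0) F"
  using tendsto_add[OF ennreal_tendsto_cmult[OF assms(3,1)] ennreal_tendsto_cmult[OF assms(4,2)]] by simp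

lemma ms_tendsto_add:
  fixes Z Z' :: "'i \<Rightarrow> 'a \<Rightarrow> 'b::{real_normed_vector, second_countable_topology}"
  assumes [measurable]: "\<And>i. Z i \<in> borel_measurable M" "\<And>i. Z' i \<in> borel_measurable M"
      "W \<in> borel_measurable M" "W' \<in> borel_measurable M"
    and "ms_tendsto M Z W F" "ms_tendsto M Z' W' F"
  shows "ms_tendsto M (\<lambda>i w. Z i w + Z' i w) (\<lambda>w. W w + W' w) F"
  unfolding ms_tendsto_iff_sq_norm
proof (rule tendsto_0_le_ennreal)
  show "sq_norm M (\<lambda>w. Z i w + Z' i w - (W w + W' w)) \<le>
      2 * sq_norm M (\<lambda>w. Z i w - W w) + 2 * sq_norm M (\<lambda>w. Z' i w - W' w)" for i
    using sq_norm_add[of "\<lambda>w. Z i w - W w" M "\<lambda>w. Z' i w - W' w"] by (simp add: algebra_simps)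
  show "((\<lambda>i. 2 * sq_norm M (\<lambda>w. Z i w - W w) + 2 * sq_norm M (\<lambda>w. Z' i w - W' w)) \<longlongrightarrow> 0) F"
    using assms by (intro tendsto_add_cmult_ennreal) (auto simp: ms_tendsto_iff_sq_norm)
qed

lemma ms_tendsto_bounded_linear:
  fixes T :: "'b::{real_normed_vector, second_countable_topology} \<Rightarrow> 'c::real_normed_vector"
  assumes T: "bounded_linear T" and [measurable]: "\<And>i. Z i \<in> borel_measurable M" "W \<in> borel_measurable M"
    and Z: "ms_tendsto M Z W F"
  shows "ms_tendsto M (\<lambda>i w. T (Z i w)) (\<lambda>w. T (W w)) F"
proof -
  obtain c where c: "c \<ge> 0" "\<And>x. norm (T x) \<le> c * norm x"
    using bounded_linear.nonneg_bounded[OF T] by (metis mult.commute)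
  show ?thesis
    unfolding ms_tendsto_iff_sq_norm
  proof (rule tendsto_0_le_ennreal)
    show "sq_norm M (\<lambda>w. T (Z i w) - T (W w)) \<le> ennreal (c\<^sup>2) * sq_norm M (\<lambda>w. Z i w - W w)" for i
      using c by (intro sq_norm_le) (auto simp flip: linear_diff[OF bounded_linear.linear[OF T]])
    show "((\<lambda>i. ennreal (c\<^sup>2) * sq_norm M (\<lambda>w. Z i w - W w)) \<longlongrightarrow> 0) F"
      using ennreal_tendsto_cmult[of "ennreal (c\<^sup>2)", OF _ Z[unfolded ms_tendsto_iff_sq_norm]] by simp
  qed
qed

lemma ms_tendsto_unique:
  fixes Z :: "'i \<Rightarrow> 'a \<Rightarrow> 'b::{real_normed_vector, second_countable_topology}"
  assumes [measurable]: "\<And>i. Z i \<in> borel_measurable M" "W \<in> borel_measurable M" "W' \<in> borel_measurable M"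
    and Z: "ms_tendsto M Z W F" "ms_tendsto M Z W' F" and F: "F \<noteq> bot"
  shows "AE w in M. W w = W' w"
proof -
  have "((\<lambda>_. sq_norm M (\<lambda>w. W w - W' w)) \<longlongrightarrow> 0) F"
  proof (rule tendsto_0_le_ennreal)
    show "sq_norm M (\<lambda>w. W w - W' w) \<le> 2 * sq_norm M (\<lambda>w. Z i w - W' w) + 2 * sq_norm M (\<lambda>w. Z i w - W w)" for i
      using sq_norm_diff[of "\<lambda>w. Z i w - W' w" M "\<lambda>w. Z i w - W w"] by simp
    show "((\<lambda>i. 2 * sq_norm M (\<lambda>w. Z i w - W' w) + 2 * sq_norm M (\<lambda>w. Z i w - W w)) \<longlongrightarrow> 0) F"
      using Z by (intro tendsto_add_cmult_ennreal) (auto simp: ms_tendsto_iff_sq_norm)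
  qed
  then have "sq_norm M (\<lambda>w. W w - W' w) = 0"
    using F tendsto_const tendsto_unique by blast
  then show ?thesis by (subst (asm) sq_norm_eq_0_iff) auto
qed

text \<open>The inequality is Jensen's for the square, obtained from the nonnegativity of the
  variance of \<open>norm (f w)\<close>.\<close>

lemma (in prob_space) norm_expectation_le:
  fixes f :: "'a \<Rightarrow> 'b::{banach, second_countable_topology}"
  assumes [measurable]: "f \<in> borel_measurable M" and fin: "sq_norm M f < top"
  shows "integrable M f" "ennreal ((norm (expectation f))\<^sup>2) \<le> sq_norm M f"
proof -
  have sq: "integrable M (\<lambda>w. (norm (f w))\<^sup>2)"
    using fin unfolding sq_norm_def by (intro integrableI_bounded) auto
  then have int: "integrable M (\<lambda>w. norm (f w))"
    by (rule square_integrable_imp_integrable[rotated]) (auto simp: power2_eq_square)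
  then show "integrable M f" by (rule integrable_norm_cancel) simp
  have "(norm (expectation f))\<^sup>2 \<le> (expectation (\<lambda>w. norm (f w)))\<^sup>2"
    by (intro power_mono integral_norm_bound) simp
  also have "\<dots> \<le> expectation (\<lambda>w. (norm (f w))\<^sup>2)"
    using variance_positive[of "\<lambda>w. norm (f w)"] variance_eq[OF int sq] by simp
  finally show "ennreal ((norm (expectation f))\<^sup>2) \<le> sq_norm M f"
    unfolding sq_norm_def nn_integral_eq_integral[OF sq AE_I2[OF zero_le_power2]] by (rule ennreal_leI)
qed

lemma (in prob_space) expectation_norm_square_le:
  fixes f :: "'a \<Rightarrow> 'b::{banach, second_countable_topology}"
  assumes [measurable]: "f \<in> borel_measurable M" and fin: "sq_norm M f < top"
  shows "ennreal ((expectation (\<lambda>w. norm (f w)))\<^sup>2) \<le> sq_norm M f"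
  using norm_expectation_le(2)[of "\<lambda>w. norm (f w)"] fin by (simp add: sq_norm_def)

text \<open>Riesz-Fischer: an almost surely convergent subsequence exists by the corresponding fact
  for \<open>L\<^sup>1\<close>, and Fatou's lemma gives convergence in mean square.\<close>

lemma (in prob_space) ms_complete:
  fixes Z :: "nat \<Rightarrow> 'a \<Rightarrow> 'b::{banach, second_countable_topology}"
  assumes [measurable]: "\<And>n. Z n \<in> borel_measurable M"
    and fin: "\<And>n. sq_norm M (Z n) < top"
    and cauchy: "\<And>e. e > 0 \<Longrightarrow> \<exists>N. \<forall>i\<ge>N. \<forall>j\<ge>N. sq_norm M (\<lambda>w. Z i w - Z j w) \<le> ennreal e"
  obtains W where "W \<in> borel_measurable M" "ms_tendsto M Z W sequentially"
proof -
  have int: "integrable M (Z n)" for n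
    by (rule norm_expectation_le(1)[OF _ fin]) measurable
  have step: "\<exists>N. \<forall>i\<ge>N. \<forall>j\<ge>N. expectation (\<lambda>w. norm (Z i w - Z j w)) < e" if e: "e > 0" for e
  proof -
    \<comment> \<open>The L1 distance is at most the square root of the squared distance. Halving e
      provides the strict inequality that the subsequence criterion asks for.\<close>
    obtain N where N: "\<And>i j. i \<ge> N \<Longrightarrow> j \<ge> N \<Longrightarrow> sq_norm M (\<lambda>w. Z i w - Z j w) \<le> ennreal ((e / 2)\<^sup>2)"
      using cauchy[of "(e / 2)\<^sup>2"] e by auto
    have "expectation (\<lambda>w. norm (Z i w - Z j w)) < e" if "i \<ge> N" "j \<ge> N" for i j
    proof -
      have "ennreal ((expectation (\<lambda>w. norm (Z i w - Z j w)))\<^sup>2) \<le> ennreal ((e / 2)\<^sup>2)"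
      proof (rule order_trans[OF expectation_norm_square_le N[OF that]])
        show "sq_norm M (\<lambda>w. Z i w - Z j w) < top"
          by (rule le_less_trans[OF N[OF that]]) simp
      qed measurable
      then have "(expectation (\<lambda>w. norm (Z i w - Z j w)))\<^sup>2 \<le> (e / 2)\<^sup>2"
        by (subst (asm) ennreal_le_iff) auto
      then have "expectation (\<lambda>w. norm (Z i w - Z j w)) \<le> e / 2"
        by (rule power2_le_imp_le) (use e in simp)
      then show ?thesis using e by simp
    qed
    then show ?thesis by blast
  qed
  from cauchy_L1_AE_cauchy_subseq[OF int step]
  obtain r where r: "strict_mono r" "AE w in M. Cauchy (\<lambda>i. Z (r i) w)" by blast
  define W where "W w = lim (\<lambda>i. Z (r i) w)" for w
  have [measurable]: "W \<in> borel_measurable M" unfolding W_def by measurable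
  have lim: "AE w in M. (\<lambda>i. Z (r i) w) \<longlonglongrightarrow> W w"
    using r(2) by eventually_elim (simp add: W_def Cauchy_convergent_iff convergent_LIMSEQ_iff)
  have "(\<lambda>i. sq_norm M (\<lambda>w. Z i w - W w)) \<longlonglongrightarrow> 0"
    unfolding tendsto_0_ennreal_iff
  proof safe
    fix e :: real assume "e > 0"
    then obtain N where N: "\<And>i j. i \<ge> N \<Longrightarrow> j \<ge> N \<Longrightarrow> sq_norm M (\<lambda>w. Z i w - Z j w) \<le> ennreal e"
      using cauchy by blast
    have "sq_norm M (\<lambda>w. Z i w - W w) \<le> ennreal e" if i: "i \<ge> N" for i
    proof -
      have "AE w in M. liminf (\<lambda>k. ennreal ((norm (Z i w - Z (r k) w))\<^sup>2)) = ennreal ((norm (Z i w - W w))\<^sup>2)"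
        using lim
      proof eventually_elim
        case (elim w)
        then have "(\<lambda>k. ennreal ((norm (Z i w - Z (r k) w))\<^sup>2)) \<longlonglongrightarrow> ennreal ((norm (Z i w - W w))\<^sup>2)"
          by (intro tendsto_intros)
        then show ?case by (rule lim_imp_Liminf[OF sequentially_bot])
      qed
      then have "sq_norm M (\<lambda>w. Z i w - W w) = (\<integral>\<^sup>+w. liminf (\<lambda>k. ennreal ((norm (Z i w - Z (r k) w))\<^sup>2)) \<partial>M)"
        unfolding sq_norm_def by (intro nn_integral_cong_AE) auto
      also have "\<dots> \<le> liminf (\<lambda>k. sq_norm M (\<lambda>w. Z i w - Z (r k) w))"
        unfolding sq_norm_def by (intro nn_integral_liminf) measurable
      also have "\<dots> \<le> liminf (\<lambda>k. ennreal e)"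
      proof (rule Liminf_mono, rule eventually_sequentiallyI)
        fix k assume "N \<le> k"
        also have "k \<le> r k" using r(1) by (rule seq_suble)
        finally show "sq_norm M (\<lambda>w. Z i w - Z (r k) w) \<le> ennreal e" by (rule N[OF i])
      qed
      finally show ?thesis by (simp add: Liminf_const)
    qed
    then show "\<forall>\<^sub>F i in sequentially. sq_norm M (\<lambda>w. Z i w - W w) \<le> ennreal e"
      by (auto simp: eventually_sequentially)
  qed
  then show ?thesis
    by (intro that[of W]) (auto simp: ms_tendsto_iff_sq_norm)
qed

text \<open>Nonnegativity makes f monotone, so f t lies between its values at neighbouring multiples
  of 1 / n. There f is linear, and the error is at most f 1 / n.\<close>

lemma additive_nonneg_linear:
  fixes f :: "real \<Rightarrow> real"
  assumes add: "\<And>s t. s \<ge> 0 \<Longrightarrow> t \<ge> 0 \<Longrightarrow> f (s + t) = f s + f t"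
    and nonneg: "\<And>t. t \<ge> 0 \<Longrightarrow> f t \<ge> 0" and t: "t \<ge> 0"
  shows "f t = t * f 1"
proof -
  have mono: "f s \<le> f u" if "0 \<le> s" "s \<le> u" for s u
    using add[of s "u - s"] nonneg[of "u - s"] that by simp
  have mult: "f (real n * s) = real n * f s" if "s \<ge> 0" for n s
  proof (induction n)
    case 0
    then show ?case using add[of 0 0] by simp
  next
    case (Suc n)
    then show ?case using add[of "real n * s" s] that by (simp add: algebra_simps)
  qed
  have bound: "\<bar>f t - t * f 1\<bar> \<le> f 1 / real n" if n: "n > 0" for n
  proof -
    define k where "k = nat \<lfloor>real n * t\<rfloor>"
    have "real k = real_of_int \<lfloor>real n * t\<rfloor>"
      using t by (simp add: k_def)
    then have k: "real k \<le> real n * t" "real n * t \<le> real (Suc k)"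
      by linarith+
    have "real k * f 1 \<le> real n * f t" "real n * f t \<le> real (Suc k) * f 1"
      using mono[OF _ k(1)] mono[OF _ k(2)] mult[of 1 k] mult[of 1 "Suc k"] mult[OF t, of n] t by auto
    moreover have "real k * f 1 \<le> real n * t * f 1" "real n * t * f 1 \<le> real (Suc k) * f 1"
      using k nonneg[of 1] by (auto intro!: mult_right_mono simp del: of_nat_Suc)
    ultimately have "\<bar>real n * f t - real n * t * f 1\<bar> \<le> f 1"
      unfolding abs_le_iff of_nat_Suc distrib_right by linarith
    moreover have "real n * f t - real n * t * f 1 = real n * (f t - t * f 1)"
      by (simp add: right_diff_distrib)
    ultimately have "real n * \<bar>f t - t * f 1\<bar> \<le> f 1"
      by (simp add: abs_mult)
    then show ?thesis using n by (simp add: pos_le_divide_eq mult.commute)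
  qed
  have "\<bar>f t - t * f 1\<bar> \<le> 0"
  proof (rule tendsto_lowerbound[OF lim_const_over_n[of "f 1"]])
    show "\<forall>\<^sub>F n in sequentially. \<bar>f t - t * f 1\<bar> \<le> f 1 / real n"
      using bound by (intro eventually_sequentiallyI[of 1]) auto
  qed simp
  then show ?thesis by simp
qed

text \<open>By Fubini for the product law, (u + V)^2 is integrable for almost every constant u. One
  such u suffices, as v^2 \<le> 2 (u + v)^2 + 2 u^2.\<close>

lemma (in prob_space) indep_sum_square_integrable:
  fixes U V :: "'a \<Rightarrow> real"
  assumes indep: "indep_var borel U borel V" and sq: "integrable M (\<lambda>w. (U w + V w)\<^sup>2)"
  shows "integrable M (\<lambda>w. (V w)\<^sup>2)"
proof -
  have [measurable]: "U \<in> borel_measurable M" "V \<in> borel_measurable M"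
    and dist: "distr M borel U \<Otimes>\<^sub>M distr M borel V = distr M (borel \<Otimes>\<^sub>M borel) (\<lambda>w. (U w, V w))"
    using indep by (auto simp: indep_var_distribution_eq)
  interpret U: prob_space "distr M borel U" by (rule prob_space_distr) simp
  interpret V: prob_space "distr M borel V" by (rule prob_space_distr) simp
  interpret UV: pair_sigma_finite "distr M borel U" "distr M borel V" ..
  have "integrable (distr M borel U \<Otimes>\<^sub>M distr M borel V) (\<lambda>(u, v). (u + v)\<^sup>2)"
    unfolding dist by (subst integrable_distr_eq) (use sq in \<open>auto simp: split_beta'\<close>)
  from UV.AE_integrable_fst'[OF this]
  have "AE u in distr M borel U. integrable (distr M borel V) (\<lambda>v. (u + v)\<^sup>2)" by simp
  then obtain u where u: "integrable (distr M borel V) (\<lambda>v. (u + v)\<^sup>2)"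
    using eventually_happens'[OF U.ae_filter_bot] by blast
  have "integrable (distr M borel V) (\<lambda>v. v\<^sup>2)"
  proof (rule Bochner_Integration.integrable_bound)
    show "integrable (distr M borel V) (\<lambda>v. 2 * (u + v)\<^sup>2 + 2 * u\<^sup>2)" using u by simp
    have "v\<^sup>2 \<le> 2 * (u + v)\<^sup>2 + 2 * u\<^sup>2" for v :: real
      using zero_le_power2[of "2 * u + v"] by (simp add: power2_sum algebra_simps)
    then show "AE v in distr M borel V. norm (v\<^sup>2) \<le> norm (2 * (u + v)\<^sup>2 + 2 * u\<^sup>2)" by simp
  qed simp
  then show ?thesis by (subst (asm) integrable_distr_eq) auto
qed

section \<open>Centred Levy processes with finite variance\<close>

locale centered_levy = prob_space M for M :: "'a measure" +
  fixes L :: "real \<Rightarrow> 'a \<Rightarrow> real^'k"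
  assumes levy: "levy_process M L"
    and mean: "(\<integral>w. L 1 w \<partial>M) = 0"
    and square: "integrable M (\<lambda>w. (norm (L 1 w))\<^sup>2)"
begin

lemma L_measurable [measurable]: "L t \<in> borel_measurable M"
  using levy by (simp add: levy_process_def)

lemma L_0: "AE w in M. L 0 w = 0"
  using levy by (simp add: levy_process_def)

lemma increments_indep:
  assumes "r \<le> s" "s \<le> t"
  shows "indep_var borel (\<lambda>w. L s w $ j - L r w $ j) borel (\<lambda>w. L t w $ j - L s w $ j)"
proof -
  let ?s = "\<lambda>i::nat. if i = 0 then r else if i = 1 then s else t"
  have *: "\<forall>i<2. ?s i \<le> ?s (Suc i)" using assms by (auto simp: less_2_cases_iff)
  have "indep_vars (\<lambda>_. borel) (\<lambda>i w. L (?s (Suc i)) w - L (?s i) w) {..<2}"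
  proof -
    have "\<forall>(n::nat) s. (\<forall>i<n. s i \<le> s (Suc i)) \<longrightarrow> indep_vars (\<lambda>_. borel) (\<lambda>i w. L (s (Suc i)) w - L (s i) w) {..<n}"
      using levy by (simp add: levy_process_def)
    from this[rule_format, of 2 ?s] * show ?thesis by blast
  qed
  \<comment> \<open>Restricting to the index sets {0} and {1} turns independence of a family into
    independence of a pair, on which component j can be read off.\<close>
  then have "indep_var (PiM {0} (\<lambda>_. borel)) (\<lambda>w. restrict (\<lambda>i. L (?s (Suc i)) w - L (?s i) w) {0})
     (PiM {1} (\<lambda>_. borel)) (\<lambda>w. restrict (\<lambda>i. L (?s (Suc i)) w - L (?s i) w) {1})"
    by (rule indep_var_restrict) simp_all
  then have "indep_var borel ((\<lambda>f. f 0 $ j) \<circ> (\<lambda>w. restrict (\<lambda>i. L (?s (Suc i)) w - L (?s i) w) {0}))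
     borel ((\<lambda>f. f 1 $ j) \<circ> (\<lambda>w. restrict (\<lambda>i. L (?s (Suc i)) w - L (?s i) w) {1}))"
    by (rule indep_var_compose) measurable
  then show ?thesis by (simp add: o_def)
qed

lemma increment_law:
  fixes g :: "real \<Rightarrow> real"
  assumes "s \<le> t" and [measurable]: "g \<in> borel_measurable borel"
  shows "integrable M (\<lambda>w. g (L t w $ j - L s w $ j)) \<longleftrightarrow> integrable M (\<lambda>w. g (L (t - s) w $ j))"
    and "(\<integral>w. g (L t w $ j - L s w $ j) \<partial>M) = (\<integral>w. g (L (t - s) w $ j) \<partial>M)"
proof -
  have d: "distr M borel (\<lambda>w. L t w - L s w) = distr M borel (L (t - s))"
    using levy assms(1) by (simp add: levy_process_def)
  have "integrable (distr M borel (\<lambda>w. L t w - L s w)) (\<lambda>x. g (x $ j)) \<longleftrightarrow>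
      integrable (distr M borel (L (t - s))) (\<lambda>x. g (x $ j))"
    by (simp only: d)
  then show "integrable M (\<lambda>w. g (L t w $ j - L s w $ j)) \<longleftrightarrow> integrable M (\<lambda>w. g (L (t - s) w $ j))"
    by (simp add: integrable_distr_eq)
  have "(\<integral>x. g (x $ j) \<partial>distr M borel (\<lambda>w. L t w - L s w)) = (\<integral>x. g (x $ j) \<partial>distr M borel (L (t - s)))"
    by (simp only: d)
  then show "(\<integral>w. g (L t w $ j - L s w $ j) \<partial>M) = (\<integral>w. g (L (t - s) w $ j) \<partial>M)"
    by (simp add: integral_distr)
qed

text \<open>L 1 is almost surely the sum of the independent increments over [0, 1 - t] and
  [1 - t, 1], so square integrability passes to the second one, which has the law of L t.\<close>

lemma integrable_increment_square_0_1:
  assumes "0 \<le> t" "t \<le> 1"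
  shows "integrable M (\<lambda>w. (L t w $ j)\<^sup>2)"
proof -
  have "integrable M (\<lambda>w. (L 1 w $ j)\<^sup>2)"
    by (rule Bochner_Integration.integrable_bound[OF square])
      (auto simp: abs_le_square_iff[symmetric] component_le_norm_cart)
  then have "integrable M (\<lambda>w. ((L (1 - t) w $ j - L 0 w $ j) + (L 1 w $ j - L (1 - t) w $ j))\<^sup>2)"
    by (rule integrable_cong_AE_imp) (use L_0 in \<open>auto elim!: eventually_mono\<close>)
  then have "integrable M (\<lambda>w. (L 1 w $ j - L (1 - t) w $ j)\<^sup>2)"
    by (intro indep_sum_square_integrable[OF increments_indep]) (use assms in auto)
  then show ?thesis
    using increment_law(1)[of "1 - t" 1 "\<lambda>x. x\<^sup>2" j] assms by simp
qed

text \<open>Induction over an integer bound for t, splitting off the increment over the last unit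
  interval.\<close>

lemma integrable_L_square:
  assumes "t \<ge> 0"
  shows "integrable M (\<lambda>w. (L t w $ j)\<^sup>2)"
proof -
  have "\<forall>t. 0 \<le> t \<and> t \<le> real n \<longrightarrow> integrable M (\<lambda>w. (L t w $ j)\<^sup>2)" for n
  proof (induction n)
    case 0
    then show ?case using integrable_increment_square_0_1[of _ j] by simp
  next
    case (Suc n)
    show ?case
    proof safe
      fix t :: real assume t: "0 \<le> t" "t \<le> real (Suc n)"
      show "integrable M (\<lambda>w. (L t w $ j)\<^sup>2)"
      proof (cases "t \<le> 1")
        case False
        have 1: "integrable M (\<lambda>w. (L (t - 1) w $ j)\<^sup>2)"
          by (rule Suc.IH[rule_format]) (use t False in auto)
        have 2: "integrable M (\<lambda>w. (L t w $ j - L (t - 1) w $ j)\<^sup>2)"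
          using increment_law(1)[of "t - 1" t "\<lambda>x. x\<^sup>2" j] integrable_increment_square_0_1[of 1 j] by simp
        show ?thesis
        proof (rule Bochner_Integration.integrable_bound)
          show "integrable M (\<lambda>w. 2 * (L (t - 1) w $ j)\<^sup>2 + 2 * (L t w $ j - L (t - 1) w $ j)\<^sup>2)"
            using 1 2 by simp
          have "x\<^sup>2 \<le> 2 * y\<^sup>2 + 2 * (x - y)\<^sup>2" for x y :: real
            using zero_le_power2[of "x - 2 * y"] by (simp add: power2_diff algebra_simps)
          then show "AE w in M. norm ((L t w $ j)\<^sup>2) \<le> norm (2 * (L (t - 1) w $ j)\<^sup>2 + 2 * (L t w $ j - L (t - 1) w $ j)\<^sup>2)"
            by simp
        qed simp
      qed (use integrable_increment_square_0_1 t in auto)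
    qed
  qed
  then show ?thesis using assms real_arch_simple by blast
qed

end

section \<open>Second moments of the increments\<close>

context centered_levy
begin

lemma integrable_L: "t \<ge> 0 \<Longrightarrow> integrable M (\<lambda>w. L t w $ j)"
  by (rule square_integrable_imp_integrable[OF _ integrable_L_square]) simp

lemma integrable_increment:
  assumes "s \<le> t"
  shows "integrable M (\<lambda>w. (L t w $ j - L s w $ j)\<^sup>2)" "integrable M (\<lambda>w. L t w $ j - L s w $ j)"
  using increment_law(1)[OF assms, of "\<lambda>x. x\<^sup>2" j] increment_law(1)[OF assms, of "\<lambda>x. x" j]
    integrable_L_square[of "t - s" j] integrable_L[of "t - s" j] assms by auto

text \<open>Independence of consecutive increments factorizes the mixed moment. Variances are added
  rather than second moments because the means are not yet known to vanish.\<close>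

lemma mean_variance_add:
  assumes "s \<ge> 0" "t \<ge> 0"
  shows mean_add: "expectation (\<lambda>w. L (s + t) w $ j) = expectation (\<lambda>w. L s w $ j) + expectation (\<lambda>w. L t w $ j)"
    and variance_add: "variance (\<lambda>w. L (s + t) w $ j) = variance (\<lambda>w. L s w $ j) + variance (\<lambda>w. L t w $ j)"
proof -
  let ?U = "\<lambda>w. L s w $ j - L 0 w $ j" and ?V = "\<lambda>w. L (s + t) w $ j - L s w $ j"
  let ?m = "\<lambda>t. expectation (\<lambda>w. L t w $ j)"
  have ind: "indep_var borel ?U borel ?V"
    by (rule increments_indep) (use assms in auto)
  have U: "integrable M ?U" "integrable M (\<lambda>w. (?U w)\<^sup>2)" and V: "integrable M ?V" "integrable M (\<lambda>w. (?V w)\<^sup>2)"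
    by (intro integrable_increment; use assms in simp)+
  have mU: "expectation ?U = ?m s" "expectation (\<lambda>w. (?U w)\<^sup>2) = expectation (\<lambda>w. (L s w $ j)\<^sup>2)"
    using increment_law(2)[of 0 s "\<lambda>x. x" j] increment_law(2)[of 0 s "\<lambda>x. x\<^sup>2" j] assms by auto
  have mV: "expectation ?V = ?m t" "expectation (\<lambda>w. (?V w)\<^sup>2) = expectation (\<lambda>w. (L t w $ j)\<^sup>2)"
    using increment_law(2)[of s "s + t" "\<lambda>x. x" j] increment_law(2)[of s "s + t" "\<lambda>x. x\<^sup>2" j] assms by auto
  have UV: "integrable M (\<lambda>w. ?U w * ?V w)" "expectation (\<lambda>w. ?U w * ?V w) = ?m s * ?m t"
    using indep_var_integrable[OF ind U(1) V(1)] indep_var_lebesgue_integral[OF ind U(1) V(1)]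
    unfolding mU mV by auto
  have "?m (s + t) = expectation (\<lambda>w. ?U w + ?V w)"
    by (rule integral_cong_AE) (use L_0 in \<open>auto elim!: eventually_mono\<close>)
  also have "\<dots> = ?m s + ?m t"
    by (simp only: Bochner_Integration.integral_add[OF U(1) V(1)] mU mV)
  finally show m: "?m (s + t) = ?m s + ?m t" .
  have "expectation (\<lambda>w. (L (s + t) w $ j)\<^sup>2) = expectation (\<lambda>w. (?U w)\<^sup>2 + (?V w)\<^sup>2 + 2 * (?U w * ?V w))"
    by (rule integral_cong_AE) (use L_0 in \<open>auto elim!: eventually_mono simp: power2_eq_square algebra_simps\<close>)
  also have "\<dots> = expectation (\<lambda>w. (L s w $ j)\<^sup>2) + expectation (\<lambda>w. (L t w $ j)\<^sup>2) + 2 * (?m s * ?m t)"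
    by (simp only: Bochner_Integration.integral_add[OF U(2) V(2)] integral_mult_right_zero
        Bochner_Integration.integral_add[OF Bochner_Integration.integrable_add[OF U(2) V(2)] integrable_mult_right[OF UV(1)]] mU mV UV(2))
  finally show "variance (\<lambda>w. L (s + t) w $ j) = variance (\<lambda>w. L s w $ j) + variance (\<lambda>w. L t w $ j)"
    using assms by (simp add: variance_eq integrable_L integrable_L_square, simp add: m power2_sum)
qed

definition \<sigma>2 :: "'k \<Rightarrow> real" where
  "\<sigma>2 j = variance (\<lambda>w. L 1 w $ j)"

lemma \<sigma>2_nonneg: "\<sigma>2 j \<ge> 0"
  unfolding \<sigma>2_def by (rule variance_positive)

lemma variance_L: "t \<ge> 0 \<Longrightarrow> variance (\<lambda>w. L t w $ j) = t * \<sigma>2 j"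
  unfolding \<sigma>2_def by (rule additive_nonneg_linear) (auto intro: variance_add variance_positive)

text \<open>Additivity alone does not make the mean linear: the right-continuity of the paths is needed.\<close>

lemma mean_L:
  assumes "t \<ge> 0"
  shows "expectation (\<lambda>w. L t w $ j) = 0"
proof -
  define m where "m t = expectation (\<lambda>w. L t w $ j)" for t
  have m_add: "m (s + t) = m s + m t" if "s \<ge> 0" "t \<ge> 0" for s t
    using that unfolding m_def by (rule mean_add)
  have int1: "integrable M (L 1)"
  proof (rule Bochner_Integration.integrable_bound)
    show "integrable M (\<lambda>w. 1 + (norm (L 1 w))\<^sup>2)" using square by simp
    have "x \<le> 1 + x\<^sup>2" for x :: real
      using sum_squares_bound[of x 1] zero_le_power2[of x] by (simp add: power2_eq_square) (smt (verit) zero_le_square)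
    then show "AE w in M. norm (L 1 w) \<le> norm (1 + (norm (L 1 w))\<^sup>2)" by simp
  qed simp
  have m1: "m 1 = 0"
    unfolding m_def using integral_bounded_linear[OF bounded_linear_vec_nth int1, of j] mean by simp
  have m_mult: "m (real n * s) = real n * m s" if "s \<ge> 0" for n s
  proof (induction n)
    case 0
    then show ?case using m_add[of 0 0] by simp
  next
    case (Suc n)
    then show ?case using m_add[of "real n * s" s] that by (simp add: algebra_simps)
  qed
  \<comment> \<open>r n is the distance from t down to the nearest multiple of 1 / (n + 1). The mean
    vanishes at these multiples because it does at 1, so it has the same value at r n as at t while
    r n tends to 0.\<close>
  define r where "r n = t - real (nat \<lfloor>real (Suc n) * t\<rfloor>) / real (Suc n)" for n
  have r: "r n \<ge> 0" "r n \<le> 1 / real (Suc n)" "m (r n) = m t" for n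
  proof -
    define k where "k = nat \<lfloor>real (Suc n) * t\<rfloor>"
    have "real k = real_of_int \<lfloor>real (Suc n) * t\<rfloor>" using assms by (simp add: k_def)
    then have k: "real k \<le> real (Suc n) * t" "real (Suc n) * t \<le> real k + 1" by linarith+
    have r: "r n = t - real k / real (Suc n)" by (simp only: r_def k_def)
    show rn: "r n \<ge> 0" "r n \<le> 1 / real (Suc n)"
      using k pos_divide_le_eq[of "real (Suc n)" "real k" t] pos_le_divide_eq[of "real (Suc n)" t "real k + 1"]
      by (simp_all add: r mult.commute add_divide_distrib del: of_nat_Suc)
    have "real (Suc n) * m (1 / real (Suc n)) = 0"
      using m_mult[of "1 / real (Suc n)" "Suc n"] m1 by simp
    then have "m (real k / real (Suc n)) = 0"
      using m_mult[of "1 / real (Suc n)" k] by simp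
    then show "m (r n) = m t"
      using m_add[of "r n" "real k / real (Suc n)"] rn by (simp add: r)
  qed
  have r_lim: "r \<longlonglongrightarrow> 0"
  proof (rule tendsto_sandwich[OF _ _ tendsto_const])
    show "(\<lambda>n. 1 / real (Suc n)) \<longlonglongrightarrow> 0" using LIMSEQ_inverse_real_of_nat by (simp add: inverse_eq_divide)
  qed (use r in \<open>auto simp del: of_nat_Suc\<close>)
  have path: "AE w in M. (\<lambda>n. L (r n) w $ j) \<longlonglongrightarrow> 0"
  proof -
    have "AE w in M. cadlag (\<lambda>t. L t w)" using levy by (simp add: levy_process_def)
    then show ?thesis using L_0
    proof eventually_elim
      case (elim w)
      have "((\<lambda>t. L t w) \<longlongrightarrow> L 0 w) (at_right 0)"
        using elim(1)[unfolded cadlag_def, THEN spec[of _ 0]] by blast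
      moreover have "at (0 :: real) within {0..} = at_right 0"
        unfolding at_within_def by (intro arg_cong[where f = "\<lambda>S. inf _ (principal S)"]) auto
      ultimately have "continuous (at 0 within {0..}) (\<lambda>t. L t w)"
        by (simp add: continuous_within)
      then have "(\<lambda>n. L (r n) w) \<longlonglongrightarrow> L 0 w"
        unfolding continuous_within_sequentially using r_lim r(1) by (force simp: o_def)
      then show ?case
        using elim(2) tendsto_vec_nth[of "\<lambda>n. L (r n) w" "L 0 w" sequentially j] by simp
    qed
  qed
  \<comment> \<open>The truncation at 1 gives a constant majorant for dominated convergence, which
    transfers the almost sure limit to expectations.\<close>
  let ?g = "\<lambda>n w. min 1 (2 * (L (r n) w $ j)\<^sup>2)"
  have "(\<lambda>n. expectation (?g n)) \<longlonglongrightarrow> expectation (\<lambda>_. 0)"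
  proof (rule integral_dominated_convergence)
    show "AE w in M. (\<lambda>n. ?g n w) \<longlonglongrightarrow> 0"
      using path
    proof eventually_elim
      case (elim w)
      have "(\<lambda>n. ?g n w) \<longlonglongrightarrow> min 1 (2 * 0\<^sup>2)"
        by (intro tendsto_intros elim)
      then show ?case by simp
    qed
    show "AE w in M. norm (?g n w) \<le> 1" for n by simp
  qed auto
  moreover have "(\<lambda>n. 2 * (r n * \<sigma>2 j)) \<longlonglongrightarrow> 2 * (0 * \<sigma>2 j)"
    by (intro tendsto_intros r_lim)
  ultimately have "(\<lambda>n. expectation (?g n) + 2 * (r n * \<sigma>2 j)) \<longlonglongrightarrow> 0"
    using tendsto_add by fastforce
  \<comment> \<open>Splitting m t into L (r n) and its deviation from the mean bounds it by a
    truncated second moment and a variance r n times \<open>\<sigma>2 j\<close>; both tend to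
    0.\<close>
  moreover have "min 1 ((m t)\<^sup>2) \<le> expectation (?g n) + 2 * (r n * \<sigma>2 j)" for n
  proof -
    have sq: "integrable M (\<lambda>w. (L (r n) w $ j - m t)\<^sup>2)"
      using integrable_L_square[OF r(1), of n j] integrable_L[OF r(1), of n j] by (simp add: power2_diff)
    have g: "integrable M (?g n)" by (rule integrable_const_bound[of _ 1]) auto
    have "min 1 ((m t)\<^sup>2) = expectation (\<lambda>w. min 1 ((m t)\<^sup>2))" by (simp add: prob_space)
    also have "\<dots> \<le> expectation (\<lambda>w. ?g n w + 2 * (L (r n) w $ j - m t)\<^sup>2)"
    proof (rule integral_mono)
      fix w
      have "b\<^sup>2 \<le> 2 * a\<^sup>2 + 2 * (a - b)\<^sup>2" for a b :: real
        using zero_le_power2[of "2 * a - b"] by (simp add: power2_eq_square algebra_simps)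
      from this[of "m t" "L (r n) w $ j"]
      show "min 1 ((m t)\<^sup>2) \<le> ?g n w + 2 * (L (r n) w $ j - m t)\<^sup>2"
        using zero_le_power2[of "L (r n) w $ j - m t"] by linarith
    qed (use sq g in auto)
    also have "\<dots> = expectation (?g n) + 2 * variance (\<lambda>w. L (r n) w $ j)"
      using sq g by (simp add: r(3)[of n, unfolded m_def] m_def)
    finally show ?thesis using variance_L[OF r(1)[of n], of j] by simp
  qed
  ultimately have "min 1 ((m t)\<^sup>2) \<le> 0"
    by (intro tendsto_lowerbound) (auto intro: always_eventually)
  then have "m t = 0" by (simp add: min_le_iff_disj)
  then show ?thesis by (simp add: m_def)
qed

lemma expectation_increment_square:
  "expectation (\<lambda>w. (L t w $ j - L s w $ j)\<^sup>2) = \<bar>t - s\<bar> * \<sigma>2 j"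
  and integrable_increment_square: "integrable M (\<lambda>w. (L t w $ j - L s w $ j)\<^sup>2)"
proof -
  have *: "expectation (\<lambda>w. (L t w $ j - L s w $ j)\<^sup>2) = (t - s) * \<sigma>2 j" if "s \<le> t" for s t
    using increment_law(2)[OF that, of "\<lambda>x. x\<^sup>2" j] variance_L[of "t - s" j] mean_L[of "t - s" j] that by simp
  show "expectation (\<lambda>w. (L t w $ j - L s w $ j)\<^sup>2) = \<bar>t - s\<bar> * \<sigma>2 j"
    using *[of s t] *[of t s] by (cases "s \<le> t") (auto simp: power2_commute)
  show "integrable M (\<lambda>w. (L t w $ j - L s w $ j)\<^sup>2)"
    using integrable_increment(1)[of s t j] integrable_increment(1)[of t s j]
    by (cases "s \<le> t") (auto simp: power2_commute)
qed

text \<open>Polarization writes the product as half a signed sum of four squared increments, each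
  with a known expectation. The same combination of absolute values is the length of the overlap, so
  disjoint, nested and overlapping intervals are treated at once.\<close>

lemma increment_covariance:
  assumes "a \<le> b" "c \<le> d"
  shows "has_bochner_integral M (\<lambda>w. (L b w $ j - L a w $ j) * (L d w $ j - L c w $ j))
    (\<sigma>2 j * (\<integral>u. indicator {a<..b} u * indicator {c<..d} u \<partial>lborel))"
proof -
  let ?Z = "\<lambda>s t w. (L t w $ j - L s w $ j)\<^sup>2"
  have Z: "has_bochner_integral M (?Z s t) (\<bar>t - s\<bar> * \<sigma>2 j)" for s t
    by (simp add: has_bochner_integral_iff expectation_increment_square integrable_increment_square)
  have "has_bochner_integral M (\<lambda>w. (?Z c b w + ?Z d a w - ?Z d b w - ?Z c a w) / 2)
    ((\<bar>b - c\<bar> * \<sigma>2 j + \<bar>a - d\<bar> * \<sigma>2 j - \<bar>b - d\<bar> * \<sigma>2 j - \<bar>a - c\<bar> * \<sigma>2 j) / 2)"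
    by (intro has_bochner_integral_divide_zero has_bochner_integral_add has_bochner_integral_diff Z)
  also have "(\<lambda>w. (?Z c b w + ?Z d a w - ?Z d b w - ?Z c a w) / 2) =
      (\<lambda>w. (L b w $ j - L a w $ j) * (L d w $ j - L c w $ j))"
    by (simp add: fun_eq_iff power2_eq_square field_simps)
  finally have cov: "has_bochner_integral M (\<lambda>w. (L b w $ j - L a w $ j) * (L d w $ j - L c w $ j))
    ((\<bar>b - c\<bar> * \<sigma>2 j + \<bar>a - d\<bar> * \<sigma>2 j - \<bar>b - d\<bar> * \<sigma>2 j - \<bar>a - c\<bar> * \<sigma>2 j) / 2)" .
  have "(\<integral>u. indicator {a<..b} u * indicator {c<..d} u \<partial>lborel) = (\<integral>u. indicator {max a c<..min b d} u \<partial>lborel :: real)"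
    by (intro Bochner_Integration.integral_cong) (auto simp: indicator_def)
  also have "\<dots> = (\<bar>b - c\<bar> + \<bar>a - d\<bar> - \<bar>b - d\<bar> - \<bar>a - c\<bar>) / 2"
    using assms by (cases "max a c \<le> min b d") (auto simp: measure_def max_def min_def abs_if split: if_splits)
  finally have I: "(\<integral>u. indicator {a<..b} u * indicator {c<..d} u \<partial>lborel) = (\<bar>b - c\<bar> + \<bar>a - d\<bar> - \<bar>b - d\<bar> - \<bar>a - c\<bar>) / 2" .
  have "(\<bar>b - c\<bar> * \<sigma>2 j + \<bar>a - d\<bar> * \<sigma>2 j - \<bar>b - d\<bar> * \<sigma>2 j - \<bar>a - c\<bar> * \<sigma>2 j) / 2 =
      \<sigma>2 j * (\<integral>u. indicator {a<..b} u * indicator {c<..d} u \<partial>lborel)"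
    unfolding I by (simp add: field_simps)
  with cov show ?thesis by simp
qed

text \<open>Expanding both squares reduces the claim to the covariances of pairs of increments; the
  intervals may overlap arbitrarily.\<close>

lemma component_isometry:
  fixes g a b :: "'i \<Rightarrow> real"
  assumes "finite I" "\<And>i. i \<in> I \<Longrightarrow> a i \<le> b i"
  shows "has_bochner_integral M (\<lambda>w. (\<Sum>i\<in>I. g i * (L (b i) w $ j - L (a i) w $ j))\<^sup>2)
      (\<sigma>2 j * (\<integral>u. (\<Sum>i\<in>I. g i * indicator {a i<..b i} u)\<^sup>2 \<partial>lborel))"
    and "integrable lborel (\<lambda>u. (\<Sum>i\<in>I. g i * indicator {a i<..b i} u)\<^sup>2)"
proof -
  have sq: "(\<Sum>i\<in>I. g i * x i)\<^sup>2 = (\<Sum>i\<in>I. \<Sum>l\<in>I. g i * g l * (x i * x l))" for x :: "'i \<Rightarrow> real"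
    by (simp add: power2_eq_square sum_product mult_ac)
  have int: "integrable lborel (\<lambda>u. indicator {a i<..b i} u * indicator {a l<..b l} u :: real)" if "i \<in> I" for i l
  proof (rule Bochner_Integration.integrable_bound)
    show "integrable lborel (indicator {a i<..b i} :: real \<Rightarrow> real)"
      using assms(2)[OF that] by (intro integrable_real_indicator) auto
  qed (auto simp: indicator_def)
  show "integrable lborel (\<lambda>u. (\<Sum>i\<in>I. g i * indicator {a i<..b i} u)\<^sup>2)"
    unfolding sq using int by (intro Bochner_Integration.integrable_sum integrable_mult_right)
  have "has_bochner_integral M (\<lambda>w. \<Sum>i\<in>I. \<Sum>l\<in>I. g i * g l * ((L (b i) w $ j - L (a i) w $ j) * (L (b l) w $ j - L (a l) w $ j)))
      (\<Sum>i\<in>I. \<Sum>l\<in>I. g i * g l * (\<sigma>2 j * (\<integral>u. indicator {a i<..b i} u * indicator {a l<..b l} u \<partial>lborel)))"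
    by (intro has_bochner_integral_sum has_bochner_integral_mult_right increment_covariance assms)
  also have "(\<Sum>i\<in>I. \<Sum>l\<in>I. g i * g l * (\<sigma>2 j * (\<integral>u. indicator {a i<..b i} u * indicator {a l<..b l} u \<partial>lborel))) =
      \<sigma>2 j * (\<integral>u. (\<Sum>i\<in>I. g i * indicator {a i<..b i} u)\<^sup>2 \<partial>lborel)"
    unfolding sq using int
    by (subst Bochner_Integration.integral_sum, force)+
      (simp add: sum_distrib_left mult_ac)
  finally show "has_bochner_integral M (\<lambda>w. (\<Sum>i\<in>I. g i * (L (b i) w $ j - L (a i) w $ j))\<^sup>2)
      (\<sigma>2 j * (\<integral>u. (\<Sum>i\<in>I. g i * indicator {a i<..b i} u)\<^sup>2 \<partial>lborel))"
    unfolding sq .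
qed

end

section \<open>The integral of deterministic functions\<close>

definition valid_steps :: "(real \<times> real \<times> (real^'k^'n)) list \<Rightarrow> bool" where
  "valid_steps D \<longleftrightarrow> (\<forall>(a, b, G)\<in>set D. a \<le> b)"

definition map_steps :: "(real^'k^'n \<Rightarrow> real^'k^'m) \<Rightarrow> (real \<times> real \<times> (real^'k^'n)) list \<Rightarrow> (real \<times> real \<times> (real^'k^'m)) list" where
  "map_steps T D = map (\<lambda>(a, b, G). (a, b, T G)) D"

lemma step_fun_Nil [simp]: "step_fun [] u = 0"
  and step_fun_Cons [simp]: "step_fun ((a, b, G) # D) u = indicator {a<..b} u *\<^sub>R G + step_fun D u"
  and step_integral_Nil [simp]: "step_integral L [] w = 0"
  and step_integral_Cons [simp]: "step_integral L ((a, b, G) # D) w = G *v (L b w - L a w) + step_integral L D w"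
  by (simp_all add: step_fun_def step_integral_def)

text \<open>Since the intervals in a list may overlap, appending lists is addition, for the step
  functions and for their integrals.\<close>

lemma step_append:
  "step_fun (D @ D') = (\<lambda>u. step_fun D u + step_fun D' u)"
  "step_integral L (D @ D') = (\<lambda>w. step_integral L D w + step_integral L D' w)"
  by (simp_all add: step_fun_def step_integral_def fun_eq_iff)

lemma valid_steps_append: "valid_steps (D @ D') \<longleftrightarrow> valid_steps D \<and> valid_steps D'"
  by (simp add: valid_steps_def ball_Un)

lemma valid_map_steps: "valid_steps (map_steps T D) \<longleftrightarrow> valid_steps D"
  by (auto simp: valid_steps_def map_steps_def)

lemma map_steps_mult:
  fixes H :: "real^'n^'m" and D :: "(real \<times> real \<times> (real^'k^'n)) list"
  shows "step_fun (map_steps ((**) H) D) = (\<lambda>u. H ** step_fun D u)"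
    and "step_integral L (map_steps ((**) H) D) = (\<lambda>w. H *v step_integral L D w)"
  by (induction D) (auto simp: map_steps_def mmult.zero_right mmult.add_right scaleR_matrix_mult_right
      matrix_vector_right_distrib matrix_vector_mul_assoc fun_eq_iff)

lemma map_steps_uminus:
  "step_fun (map_steps uminus D) = (\<lambda>u. - step_fun D u)"
  "step_integral L (map_steps uminus D) = (\<lambda>w. - step_integral L D w)"
  by (induction D) (auto simp: map_steps_def mvmult.minus_left fun_eq_iff)

lemma step_fun_nth: "step_fun D u $ r $ j = (\<Sum>l<length D. snd (snd (D ! l)) $ r $ j * indicator {fst (D ! l)<..fst (snd (D ! l))} u)"
  by (simp add: step_fun_def sum_list_sum_nth split_beta' atLeast0LessThan mult.commute)

lemma step_integral_nth: "step_integral L D w $ r =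
    (\<Sum>j\<in>UNIV. \<Sum>l<length D. snd (snd (D ! l)) $ r $ j * (L (fst (snd (D ! l))) w $ j - L (fst (D ! l)) w $ j))"
proof -
  have "step_integral L D w $ r = (\<Sum>l<length D. \<Sum>j\<in>UNIV. snd (snd (D ! l)) $ r $ j * (L (fst (snd (D ! l))) w $ j - L (fst (D ! l)) w $ j))"
    by (simp add: step_integral_def sum_list_sum_nth split_beta' atLeast0LessThan matrix_vector_mult_def)
  then show ?thesis by (simp add: sum.swap[of _ UNIV])
qed

lemma step_fun_measurable [measurable]: "step_fun D \<in> borel_measurable borel"
  for D :: "(real \<times> real \<times> (real^'k^'n)) list"
proof (induction D)
  case Nil
  have "step_fun [] = (\<lambda>_. 0 :: real^'k^'n)" by (rule ext) simp
  then show ?case by simp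
next
  case (Cons d D)
  obtain a b G where d: "d = (a, b, G)" by (cases d)
  note Cons[measurable]
  have "step_fun (d # D) = (\<lambda>u. indicator {a<..b} u *\<^sub>R G + step_fun D u)"
    by (rule ext) (simp add: d)
  then show ?case by simp
qed

lemma norm_matrix_square: "(norm A)\<^sup>2 = (\<Sum>r\<in>UNIV. \<Sum>j\<in>UNIV. (A $ r $ j)\<^sup>2)" for A :: "real^'k^'n"
  by (simp add: norm_vec_def L2_set_def sum_nonneg)

lemma norm_vector_square: "(norm x)\<^sup>2 = (\<Sum>r\<in>UNIV. (x $ r)\<^sup>2)" for x :: "real^'n"
  by (simp add: norm_vec_def L2_set_def sum_nonneg)

context centered_levy
begin

text \<open>The number of components comes from the Cauchy-Schwarz inequality for the sum over the
  components of L, and the sum of the variances bounds each one of them.\<close>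

definition \<kappa> :: real where
  "\<kappa> = real CARD('k) * (\<Sum>j\<in>UNIV. \<sigma>2 j)"

lemma \<kappa>_nonneg: "\<kappa> \<ge> 0"
  by (simp add: \<kappa>_def sum_nonneg \<sigma>2_nonneg)

lemma step_integral_measurable [measurable]: "step_integral L D \<in> borel_measurable M"
  for D :: "(real \<times> real \<times> (real^'k^'n)) list"
proof (induction D)
  case (Cons d D)
  obtain a b G where d: "d = (a, b, G)" by (cases d)
  note Cons[measurable]
  have [measurable]: "(\<lambda>x. G *v x) \<in> borel_measurable borel"
    by (intro borel_measurable_continuous_onI mvmult.continuous_on continuous_intros)
  have "step_integral L (d # D) = (\<lambda>w. G *v (L b w - L a w) + step_integral L D w)"
    by (rule ext) (simp add: d)
  then show ?case by simp
next
  case Nil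
  have "step_integral L [] = (\<lambda>_. 0 :: real^'n)" by (rule ext) simp
  then show ?case by simp
qed

text \<open>The components of L may be correlated, so the isometry is available for each component
  only. Cauchy-Schwarz separates the components at the price of the constant
  \<open>\<kappa>\<close>.\<close>

lemma sq_norm_step_integral_le:
  fixes D :: "(real \<times> real \<times> (real^'k^'n)) list"
  assumes "valid_steps D"
  shows "sq_norm M (step_integral L D) \<le> ennreal \<kappa> * sq_norm lborel (step_fun D)"
    and "sq_norm lborel (step_fun D) < top"
proof -
  define g where "g r j l = snd (snd (D ! l)) $ r $ j" for r j l
  define a where "a l = fst (D ! l)" for l
  define b where "b l = fst (snd (D ! l))" for l
  have ab: "a l \<le> b l" if "l \<in> {..<length D}" for l
    using assms nth_mem[of l D] that unfolding valid_steps_def a_def b_def by fastforce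
  let ?S = "\<lambda>r j w. \<Sum>l<length D. g r j l * (L (b l) w $ j - L (a l) w $ j)"
  let ?F = "\<lambda>r j u. \<Sum>l<length D. g r j l * indicator {a l<..b l} u :: real"
  have S: "has_bochner_integral M (\<lambda>w. (?S r j w)\<^sup>2) (\<sigma>2 j * (\<integral>u. (?F r j u)\<^sup>2 \<partial>lborel))"
    and F: "integrable lborel (\<lambda>u. (?F r j u)\<^sup>2)" for r j
    by (rule component_isometry[OF _ ab]; simp)+
  have Fnn: "(\<integral>u. (?F r j u)\<^sup>2 \<partial>lborel) \<ge> 0" for r j by simp
  have norm_F: "(norm (step_fun D u))\<^sup>2 = (\<Sum>r\<in>UNIV. \<Sum>j\<in>UNIV. (?F r j u)\<^sup>2)" for u
    by (simp add: norm_matrix_square step_fun_nth g_def a_def b_def)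
  have "sq_norm lborel (step_fun D) = ennreal (\<integral>u. (norm (step_fun D u))\<^sup>2 \<partial>lborel)"
    unfolding sq_norm_def
  proof (rule nn_integral_eq_integral)
    show "integrable lborel (\<lambda>u. (norm (step_fun D u))\<^sup>2)"
      unfolding norm_F by (intro Bochner_Integration.integrable_sum F)
  qed simp
  also have "(\<integral>u. (norm (step_fun D u))\<^sup>2 \<partial>lborel) = (\<Sum>r\<in>UNIV. \<Sum>j\<in>UNIV. \<integral>u. (?F r j u)\<^sup>2 \<partial>lborel)"
    unfolding norm_F using F by (simp add: Bochner_Integration.integral_sum)
  finally have step: "sq_norm lborel (step_fun D) = ennreal (\<Sum>r\<in>UNIV. \<Sum>j\<in>UNIV. \<integral>u. (?F r j u)\<^sup>2 \<partial>lborel)" .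
  then show "sq_norm lborel (step_fun D) < top" by simp
  have norm_S: "(norm (step_integral L D w))\<^sup>2 \<le> (\<Sum>r\<in>UNIV. real CARD('k) * (\<Sum>j\<in>UNIV. (?S r j w)\<^sup>2))" for w
    unfolding norm_vector_square step_integral_nth g_def[symmetric] a_def[symmetric] b_def[symmetric]
  proof (rule sum_mono)
    fix r
    show "(\<Sum>j\<in>UNIV. ?S r j w)\<^sup>2 \<le> real CARD('k) * (\<Sum>j\<in>UNIV. (?S r j w)\<^sup>2)"
      using sum_squared_le_sum_of_squares[of "\<lambda>j. ?S r j w" UNIV] by (simp add: mult.commute)
  qed
  have "has_bochner_integral M (\<lambda>w. \<Sum>r\<in>UNIV. real CARD('k) * (\<Sum>j\<in>UNIV. (?S r j w)\<^sup>2))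
    (\<Sum>r\<in>UNIV. real CARD('k) * (\<Sum>j\<in>UNIV. \<sigma>2 j * (\<integral>u. (?F r j u)\<^sup>2 \<partial>lborel)))"
    by (intro has_bochner_integral_sum has_bochner_integral_mult_right S)
  then have SI: "(\<integral>\<^sup>+w. ennreal (\<Sum>r\<in>UNIV. real CARD('k) * (\<Sum>j\<in>UNIV. (?S r j w)\<^sup>2)) \<partial>M) =
    ennreal (\<Sum>r\<in>UNIV. real CARD('k) * (\<Sum>j\<in>UNIV. \<sigma>2 j * (\<integral>u. (?F r j u)\<^sup>2 \<partial>lborel)))"
    by (subst nn_integral_eq_integral) (simp_all add: has_bochner_integral_iff sum_nonneg)
  have FI: "(\<Sum>r\<in>UNIV. real CARD('k) * (\<Sum>j\<in>UNIV. \<sigma>2 j * (\<integral>u. (?F r j u)\<^sup>2 \<partial>lborel))) \<le>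
      \<kappa> * (\<Sum>r\<in>UNIV. \<Sum>j\<in>UNIV. \<integral>u. (?F r j u)\<^sup>2 \<partial>lborel)"
    unfolding sum_distrib_left \<kappa>_def
  proof (intro sum_mono)
    fix r j
    have "\<sigma>2 j \<le> (\<Sum>j\<in>UNIV. \<sigma>2 j)" by (rule member_le_sum) (auto simp: \<sigma>2_nonneg)
    then show "real CARD('k) * (\<sigma>2 j * (\<integral>u. (?F r j u)\<^sup>2 \<partial>lborel)) \<le>
        (\<Sum>j\<in>UNIV. real CARD('k) * \<sigma>2 j) * (\<integral>u. (?F r j u)\<^sup>2 \<partial>lborel)"
      using mult_left_mono[OF mult_right_mono[OF _ Fnn], of "\<sigma>2 j" "\<Sum>j\<in>UNIV. \<sigma>2 j" "real CARD('k)" r j]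
      by (simp only: sum_distrib_left[symmetric] mult.assoc of_nat_0_le_iff)
  qed
  have "sq_norm M (step_integral L D) \<le> (\<integral>\<^sup>+w. ennreal (\<Sum>r\<in>UNIV. real CARD('k) * (\<Sum>j\<in>UNIV. (?S r j w)\<^sup>2)) \<partial>M)"
    unfolding sq_norm_def by (intro nn_integral_mono ennreal_leI norm_S)
  also have "\<dots> \<le> ennreal (\<kappa> * (\<Sum>r\<in>UNIV. \<Sum>j\<in>UNIV. \<integral>u. (?F r j u)\<^sup>2 \<partial>lborel))"
    unfolding SI by (rule ennreal_leI[OF FI])
  also have "\<dots> = ennreal \<kappa> * sq_norm lborel (step_fun D)"
    unfolding step by (simp add: ennreal_mult \<kappa>_nonneg sum_nonneg)
  finally show "sq_norm M (step_integral L D) \<le> ennreal \<kappa> * sq_norm lborel (step_fun D)" .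
qed

lemma has_levy_integral_iff: "has_levy_integral M L S f I \<longleftrightarrow>
   I \<in> borel_measurable M \<and> (\<exists>D. (\<forall>n. valid_steps (D n)) \<and>
     ms_tendsto lborel (\<lambda>n. step_fun (D n)) (\<lambda>u. indicator S u *\<^sub>R f u) sequentially \<and>
     ms_tendsto M (\<lambda>n. step_integral L (D n)) I sequentially)"
  by (simp add: has_levy_integral_def valid_steps_def)

lemma has_levy_integral_measurable: "has_levy_integral M L S f I \<Longrightarrow> I \<in> borel_measurable M"
  by (simp add: has_levy_integral_iff)

text \<open>Only the integrands extended by zero enter, so three different domains are allowed; this
  covers the splitting of a half-line as well as sums of integrands.\<close>

lemma has_levy_integral_add:
  fixes f f' f'' :: "real \<Rightarrow> real^'k^'n"
  assumes I: "has_levy_integral M L S f I" and I': "has_levy_integral M L S' f' I'"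
    and [measurable]: "(\<lambda>u. indicator S u *\<^sub>R f u) \<in> borel_measurable borel"
      "(\<lambda>u. indicator S' u *\<^sub>R f' u) \<in> borel_measurable borel"
    and eq: "\<And>u. indicator S'' u *\<^sub>R f'' u = indicator S u *\<^sub>R f u + indicator S' u *\<^sub>R f' u"
  shows "has_levy_integral M L S'' f'' (\<lambda>w. I w + I' w)"
proof -
  obtain D where D: "\<And>n. valid_steps (D n)"
    "ms_tendsto lborel (\<lambda>n. step_fun (D n)) (\<lambda>u. indicator S u *\<^sub>R f u) sequentially"
    "ms_tendsto M (\<lambda>n. step_integral L (D n)) I sequentially" and [measurable]: "I \<in> borel_measurable M"
    using I by (auto simp: has_levy_integral_iff)
  obtain D' where D': "\<And>n. valid_steps (D' n)"
    "ms_tendsto lborel (\<lambda>n. step_fun (D' n)) (\<lambda>u. indicator S' u *\<^sub>R f' u) sequentially"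
    "ms_tendsto M (\<lambda>n. step_integral L (D' n)) I' sequentially" and [measurable]: "I' \<in> borel_measurable M"
    using I' by (auto simp: has_levy_integral_iff)
  have "ms_tendsto lborel (\<lambda>n. step_fun (D n @ D' n)) (\<lambda>u. indicator S'' u *\<^sub>R f'' u) sequentially"
    using ms_tendsto_add[OF _ _ _ _ D(2) D'(2)] by (simp add: eq step_append)
  moreover have "ms_tendsto M (\<lambda>n. step_integral L (D n @ D' n)) (\<lambda>w. I w + I' w) sequentially"
    using ms_tendsto_add[OF _ _ _ _ D(3) D'(3)] by (simp add: step_append)
  ultimately show ?thesis
    unfolding has_levy_integral_iff using D(1) D'(1)
    by (intro conjI exI[of _ "\<lambda>n. D n @ D' n"]) (auto simp: valid_steps_append)
qed

lemma has_levy_integral_mult: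
  fixes f :: "real \<Rightarrow> real^'k^'n" and H :: "real^'n^'m"
  assumes I: "has_levy_integral M L S f I"
    and [measurable]: "(\<lambda>u. indicator S u *\<^sub>R f u) \<in> borel_measurable borel"
  shows "has_levy_integral M L S (\<lambda>u. H ** f u) (\<lambda>w. H *v I w)"
proof -
  obtain D where D: "\<And>n. valid_steps (D n)"
    "ms_tendsto lborel (\<lambda>n. step_fun (D n)) (\<lambda>u. indicator S u *\<^sub>R f u) sequentially"
    "ms_tendsto M (\<lambda>n. step_integral L (D n)) I sequentially" and [measurable]: "I \<in> borel_measurable M"
    using I by (auto simp: has_levy_integral_iff)
  have "ms_tendsto lborel (\<lambda>n. step_fun (map_steps ((**) H) (D n))) (\<lambda>u. indicator S u *\<^sub>R (H ** f u)) sequentially"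
    using ms_tendsto_bounded_linear[OF mmult.bounded_linear_right[of H] _ _ D(2)]
    by (simp add: map_steps_mult scaleR_matrix_mult_right)
  moreover have "ms_tendsto M (\<lambda>n. step_integral L (map_steps ((**) H) (D n))) (\<lambda>w. H *v I w) sequentially"
    using ms_tendsto_bounded_linear[OF mvmult.bounded_linear_right[of H] _ _ D(3)]
    by (simp add: map_steps_mult)
  ultimately show ?thesis
    unfolding has_levy_integral_iff using D(1)
    by (intro conjI exI[of _ "\<lambda>n. map_steps ((**) H) (D n)"]) (auto simp: valid_map_steps)
qed

text \<open>The bound for step functions passes to the limit. Comparing the integral with its
  approximation and the step function with f costs a factor 2 each, hence 4; the terms in
  \<open>?e n\<close> vanish.\<close>

lemma sq_norm_levy_integral_le:
  fixes f :: "real \<Rightarrow> real^'k^'n"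
  assumes I: "has_levy_integral M L S f I"
    and [measurable]: "(\<lambda>u. indicator S u *\<^sub>R f u) \<in> borel_measurable borel"
  shows "sq_norm M I \<le> ennreal (4 * \<kappa>) * sq_norm lborel (\<lambda>u. indicator S u *\<^sub>R f u)"
proof -
  let ?f = "\<lambda>u. indicator S u *\<^sub>R f u"
  obtain D where D: "\<And>n. valid_steps (D n)"
    "ms_tendsto lborel (\<lambda>n. step_fun (D n)) ?f sequentially"
    "ms_tendsto M (\<lambda>n. step_integral L (D n)) I sequentially" and [measurable]: "I \<in> borel_measurable M"
    using I by (auto simp: has_levy_integral_iff)
  let ?e = "\<lambda>n. 2 * sq_norm M (\<lambda>w. step_integral L (D n) w - I w) + ennreal (4 * \<kappa>) * sq_norm lborel (\<lambda>u. step_fun (D n) u - ?f u)"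
  have bound: "sq_norm M I \<le> ?e n + ennreal (4 * \<kappa>) * sq_norm lborel ?f" for n
  proof -
    have "sq_norm M I = sq_norm M (\<lambda>w. step_integral L (D n) w - (step_integral L (D n) w - I w))" by simp
    also have "\<dots> \<le> 2 * sq_norm M (step_integral L (D n)) + 2 * sq_norm M (\<lambda>w. step_integral L (D n) w - I w)"
      by (rule sq_norm_diff) auto
    also have "sq_norm M (step_integral L (D n)) \<le> ennreal \<kappa> * sq_norm lborel (step_fun (D n))"
      by (rule sq_norm_step_integral_le[OF D(1)])
    also have "sq_norm lborel (step_fun (D n)) = sq_norm lborel (\<lambda>u. (step_fun (D n) u - ?f u) + ?f u)" by simp
    also have "\<dots> \<le> 2 * sq_norm lborel (\<lambda>u. step_fun (D n) u - ?f u) + 2 * sq_norm lborel ?f"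
      by (rule sq_norm_add) auto
    finally have "sq_norm M I \<le> 2 * (ennreal \<kappa> * (2 * sq_norm lborel (\<lambda>u. step_fun (D n) u - ?f u) + 2 * sq_norm lborel ?f)) +
        2 * sq_norm M (\<lambda>w. step_integral L (D n) w - I w)"
      by (simp add: add_right_mono mult_left_mono)
    also have "ennreal (4 * \<kappa>) = 2 * (ennreal \<kappa> * 2)"
    proof -
      have "ennreal (4 * \<kappa>) = (2 * 2) * ennreal \<kappa>" using \<kappa>_nonneg by (simp add: ennreal_mult)
      then show ?thesis by (simp only: mult_ac)
    qed
    then have "2 * (ennreal \<kappa> * (2 * sq_norm lborel (\<lambda>u. step_fun (D n) u - ?f u) + 2 * sq_norm lborel ?f)) +
        2 * sq_norm M (\<lambda>w. step_integral L (D n) w - I w) = ?e n + ennreal (4 * \<kappa>) * sq_norm lborel ?f"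
      by (simp add: distrib_left mult.assoc add_ac)
    finally show ?thesis .
  qed
  have "?e \<longlonglongrightarrow> 0"
    using D(2,3) by (intro tendsto_add_cmult_ennreal) (auto simp: ms_tendsto_iff_sq_norm)
  then have "(\<lambda>n. ?e n + ennreal (4 * \<kappa>) * sq_norm lborel ?f) \<longlonglongrightarrow> 0 + ennreal (4 * \<kappa>) * sq_norm lborel ?f"
    by (intro tendsto_add tendsto_const)
  then show ?thesis
    using tendsto_lowerbound[OF _ always_eventually[OF allI[OF bound]]] by fastforce
qed

text \<open>The difference of the two variables is an integral of the zero function, so the second
  moment bound makes it vanish almost surely.\<close>

lemma has_levy_integral_unique:
  fixes f f' :: "real \<Rightarrow> real^'k^'n"
  assumes I: "has_levy_integral M L S f I" and I': "has_levy_integral M L S' f' I'"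
    and f [measurable]: "(\<lambda>u. indicator S u *\<^sub>R f u) \<in> borel_measurable borel"
    and eq: "\<And>u. indicator S u *\<^sub>R f u = indicator S' u *\<^sub>R f' u"
  shows "AE w in M. I w = I' w"
proof -
  have eq': "(\<lambda>u. indicator S u *\<^sub>R f u) = (\<lambda>u. indicator S' u *\<^sub>R f' u)" using eq by auto
  have m': "(\<lambda>u. indicator S' u *\<^sub>R f' u) \<in> borel_measurable borel"
    using f unfolding eq' .
  have [measurable]: "I \<in> borel_measurable M" "I' \<in> borel_measurable M"
    using I I' by (auto simp: has_levy_integral_iff)
  have "has_levy_integral M L S' (\<lambda>u. - mat 1 ** f' u) (\<lambda>w. - mat 1 *v I' w)"
    by (rule has_levy_integral_mult[OF I' m'])
  then have 1: "has_levy_integral M L S' (\<lambda>u. - f' u) (\<lambda>w. - I' w)"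
    by (simp add: mmult.minus_left mvmult.minus_left)
  have "has_levy_integral M L {} (\<lambda>u. 0 :: real^'k^'n) (\<lambda>w. I w + - I' w)"
  proof (rule has_levy_integral_add[OF I 1])
    show "(\<lambda>u. indicator S' u *\<^sub>R - f' u) \<in> borel_measurable borel"
      using borel_measurable_uminus[OF m'] by simp
    show "(\<lambda>u. indicator S u *\<^sub>R f u) \<in> borel_measurable borel" by (rule f)
  qed (simp add: eq)
  from sq_norm_levy_integral_le[OF this] have "sq_norm M (\<lambda>w. I w - I' w) = 0"
    by (simp add: sq_norm_def)
  then show ?thesis by (subst (asm) sq_norm_eq_0_iff) auto
qed

text \<open>Step functions that approximate f are close to each other, hence so are their integrals
  by the second moment bound, and completeness provides a limit. The choice in
  \<open>levy_integral\<close> is then legitimate.\<close>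

lemma has_levy_integral_exists:
  fixes f :: "real \<Rightarrow> real^'k^'n"
  assumes [measurable]: "(\<lambda>u. indicator S u *\<^sub>R f u) \<in> borel_measurable borel"
    and approx: "\<And>e. e > 0 \<Longrightarrow> \<exists>D. valid_steps D \<and> sq_norm lborel (\<lambda>u. step_fun D u - indicator S u *\<^sub>R f u) \<le> ennreal e"
  shows "has_levy_integral M L S f (levy_integral M L S f)"
proof -
  let ?f = "\<lambda>u. indicator S u *\<^sub>R f u"
  have "\<exists>D. valid_steps D \<and> sq_norm lborel (\<lambda>u. step_fun D u - ?f u) \<le> ennreal (inverse (real (Suc n)))" for n
    by (rule approx) simp
  then have "\<exists>D. \<forall>n. valid_steps (D n) \<and> sq_norm lborel (\<lambda>u. step_fun (D n) u - ?f u) \<le> ennreal (inverse (real (Suc n)))"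
    by (intro choice allI)
  then obtain D where D: "\<And>n. valid_steps (D n)" "\<And>n. sq_norm lborel (\<lambda>u. step_fun (D n) u - ?f u) \<le> ennreal (inverse (real (Suc n)))"
    by blast
  have lim: "(\<lambda>n. sq_norm lborel (\<lambda>u. step_fun (D n) u - ?f u)) \<longlonglongrightarrow> 0"
  proof (rule tendsto_0_le_ennreal[OF D(2)])
    show "(\<lambda>n. ennreal (inverse (real (Suc n)))) \<longlonglongrightarrow> 0"
      using tendsto_ennrealI[OF LIMSEQ_inverse_real_of_nat] by simp
  qed
  have cauchy: "\<exists>N. \<forall>i\<ge>N. \<forall>j\<ge>N. sq_norm M (\<lambda>w. step_integral L (D i) w - step_integral L (D j) w) \<le> ennreal e" if "e > 0" for e
  proof -
    have "(\<lambda>n. ennreal (4 * \<kappa>) * sq_norm lborel (\<lambda>u. step_fun (D n) u - ?f u)) \<longlonglongrightarrow> 0"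
      using ennreal_tendsto_cmult[OF _ lim, of "ennreal (4 * \<kappa>)"] by simp
    then have "\<forall>\<^sub>F n in sequentially. ennreal (4 * \<kappa>) * sq_norm lborel (\<lambda>u. step_fun (D n) u - ?f u) \<le> ennreal (e / 2)"
      using \<open>e > 0\<close> by (simp add: tendsto_0_ennreal_iff)
    then obtain N where N: "\<And>n. n \<ge> N \<Longrightarrow> ennreal (4 * \<kappa>) * sq_norm lborel (\<lambda>u. step_fun (D n) u - ?f u) \<le> ennreal (e / 2)"
      by (auto simp: eventually_sequentially)
    have "sq_norm M (\<lambda>w. step_integral L (D i) w - step_integral L (D j) w) \<le> ennreal e" if ij: "i \<ge> N" "j \<ge> N" for i j
    proof -
      \<comment> \<open>The difference of two step integrals is again a step integral, to which the
        bound applies.\<close>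
      let ?D = "D i @ map_steps uminus (D j)"
      have "sq_norm M (\<lambda>w. step_integral L (D i) w - step_integral L (D j) w) = sq_norm M (step_integral L ?D)"
        by (simp add: sq_norm_def step_append map_steps_uminus)
      also have "\<dots> \<le> ennreal \<kappa> * sq_norm lborel (step_fun ?D)"
        by (rule sq_norm_step_integral_le) (simp add: valid_steps_append valid_map_steps D)
      also have "sq_norm lborel (step_fun ?D) = sq_norm lborel (\<lambda>u. (step_fun (D i) u - ?f u) - (step_fun (D j) u - ?f u))"
        by (simp add: sq_norm_def step_append map_steps_uminus)
      also have "ennreal \<kappa> * \<dots> \<le> ennreal \<kappa> * (2 * sq_norm lborel (\<lambda>u. step_fun (D i) u - ?f u) + 2 * sq_norm lborel (\<lambda>u. step_fun (D j) u - ?f u))"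
        by (intro mult_left_mono sq_norm_diff) auto
      also have "\<dots> \<le> ennreal (4 * \<kappa>) * sq_norm lborel (\<lambda>u. step_fun (D i) u - ?f u) +
          ennreal (4 * \<kappa>) * sq_norm lborel (\<lambda>u. step_fun (D j) u - ?f u)"
      proof -
        have "ennreal \<kappa> * 2 \<le> ennreal (4 * \<kappa>)"
        proof -
          have "ennreal \<kappa> * 2 = ennreal (\<kappa> * 2)" using \<kappa>_nonneg by (simp add: ennreal_mult)
          also have "\<dots> \<le> ennreal (4 * \<kappa>)" using \<kappa>_nonneg by (intro ennreal_leI) simp
          finally show ?thesis .
        qed
        then show ?thesis
          unfolding distrib_left mult.assoc[symmetric] by (intro add_mono mult_right_mono) auto
      qed
      also have "\<dots> \<le> ennreal (e / 2) + ennreal (e / 2)" by (intro add_mono N ij)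
      also have "\<dots> = ennreal e" using \<open>e > 0\<close> by (simp add: ennreal_plus[symmetric] del: ennreal_plus)
      finally show ?thesis .
    qed
    then show ?thesis by blast
  qed
  have fin: "sq_norm M (step_integral L (D n)) < top" for n
    by (rule le_less_trans[OF sq_norm_step_integral_le(1)[OF D(1)]])
      (simp add: ennreal_mult_less_top sq_norm_step_integral_le(2)[OF D(1)])
  obtain W where "W \<in> borel_measurable M" "ms_tendsto M (\<lambda>n. step_integral L (D n)) W sequentially"
    by (rule ms_complete[OF step_integral_measurable fin cauchy])
  then have "has_levy_integral M L S f W"
    unfolding has_levy_integral_iff using D(1) lim by (auto simp: ms_tendsto_iff_sq_norm)
  then show ?thesis unfolding levy_integral_def by (rule someI[of "has_levy_integral M L S f"])
qed

end

lemma sum_indicator_partition: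
  fixes x :: "nat \<Rightarrow> real"
  assumes "mono x"
  shows "(\<Sum>i<n. indicator {x i<..x (Suc i)} u) = (indicator {x 0<..x n} u :: real)"
proof (induction n)
  case (Suc n)
  have "x 0 \<le> x n" "x n \<le> x (Suc n)" using assms by (auto intro: monoD)
  then show ?case using Suc by (auto simp: indicator_def)
qed simp

text \<open>Uniform continuity on the closed interval: on a fine equidistant grid, f is replaced by
  its values at the left endpoints.\<close>

lemma step_approx_Ioc:
  fixes f :: "real \<Rightarrow> real^'k^'n"
  assumes f: "continuous_on {a..b} f" and e: "e > 0" and ab: "a \<le> b"
  shows "\<exists>D. valid_steps D \<and> sq_norm lborel (\<lambda>u. step_fun D u - indicator {a<..b} u *\<^sub>R f u) \<le> ennreal e"
proof -
  \<comment> \<open>The uniform error d contributes d^2 (b - a), which should not exceed e; the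
    summand 1 keeps the denominator positive when a = b.\<close>
  define d where "d = sqrt (e / (b - a + 1))"
  have d: "d > 0" "d\<^sup>2 * (b - a) \<le> e"
    using e ab by (auto simp: d_def field_simps)
  have "uniformly_continuous_on {a..b} f"
    by (rule compact_uniformly_continuous[OF f]) simp
  then obtain \<delta> where \<delta>: "\<delta> > 0" "\<And>u v. u \<in> {a..b} \<Longrightarrow> v \<in> {a..b} \<Longrightarrow> dist u v < \<delta> \<Longrightarrow> dist (f u) (f v) < d"
    using d(1) unfolding uniformly_continuous_on_def by metis
  obtain N :: nat where N: "(b - a) / \<delta> < real N" "N > 0"
    using reals_Archimedean2[of "max 1 ((b - a) / \<delta>)"] by (auto simp: max_less_iff_conj)
  define x where "x i = a + (b - a) * (real i / real N)" for i
  have mono: "mono x" using ab by (auto simp: x_def intro!: monoI mult_left_mono divide_right_mono)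
  have xN: "x 0 = a" "x N = b" using N by (auto simp: x_def)
  have gap: "x (Suc i) - x i < \<delta>" for i
  proof -
    have "x (Suc i) - x i = (b - a) / real N" using N by (simp add: x_def field_simps)
    also have "\<dots> < \<delta>" using N \<delta> by (simp add: field_simps)
    finally show ?thesis .
  qed
  define D where "D = map (\<lambda>i. (x i, x (Suc i), f (x i))) [0..<N]"
  have valid: "valid_steps D"
    using mono by (auto simp: D_def valid_steps_def intro: monoD)
  have step: "step_fun D u = (\<Sum>i<N. indicator {x i<..x (Suc i)} u *\<^sub>R f (x i))" for u
    by (simp add: step_fun_def D_def o_def interv_sum_list_conv_sum_set_nat atLeast0LessThan)
  have part: "indicator {a<..b} u = (\<Sum>i<N. indicator {x i<..x (Suc i)} u :: real)" for u
    using sum_indicator_partition[OF mono, where n = N and u = u] xN by simp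
  have bound: "norm (step_fun D u - indicator {a<..b} u *\<^sub>R f u) \<le> d * indicator {a<..b} u" for u
  proof -
    have "step_fun D u - indicator {a<..b} u *\<^sub>R f u = (\<Sum>i<N. indicator {x i<..x (Suc i)} u *\<^sub>R (f (x i) - f u))"
      unfolding step part by (simp add: scaleR_sum_left scaleR_diff_right sum_subtractf)
    also have "norm \<dots> \<le> (\<Sum>i<N. indicator {x i<..x (Suc i)} u * d)"
    proof (rule sum_norm_le)
      fix i assume i: "i \<in> {..<N}"
      have "norm (f (x i) - f u) \<le> d" if u: "x i < u" "u \<le> x (Suc i)"
      proof -
        have "a \<le> x i" "x (Suc i) \<le> b" using monoD[OF mono, of 0 i] monoD[OF mono, of "Suc i" N] i xN by auto
        then have "dist (f (x i)) (f u) < d"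
          using u gap[of i] by (intro \<delta>(2)) (auto simp: dist_real_def)
        then show ?thesis by (simp add: dist_norm)
      qed
      then show "norm (indicator {x i<..x (Suc i)} u *\<^sub>R (f (x i) - f u)) \<le> indicator {x i<..x (Suc i)} u * d"
        by (auto simp: indicator_def)
    qed
    also have "\<dots> = d * indicator {a<..b} u"
      unfolding part by (simp add: sum_distrib_left mult.commute)
    finally show ?thesis .
  qed
  have "sq_norm lborel (\<lambda>u. step_fun D u - indicator {a<..b} u *\<^sub>R f u) \<le>
      ennreal (d\<^sup>2) * sq_norm lborel (\<lambda>u. indicator {a<..b} u :: real)"
    using bound d(1) by (intro sq_norm_le) auto
  also have "sq_norm lborel (\<lambda>u. indicator {a<..b} u :: real) = (\<integral>\<^sup>+u. indicator {a<..b} u \<partial>lborel)"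
    unfolding sq_norm_def by (intro nn_integral_cong) (simp add: indicator_def)
  also have "\<dots> = ennreal (b - a)" using ab by simp
  finally have "sq_norm lborel (\<lambda>u. step_fun D u - indicator {a<..b} u *\<^sub>R f u) \<le> ennreal (d\<^sup>2 * (b - a))"
    using ab by (simp add: ennreal_mult)
  also have "\<dots> \<le> ennreal e" by (rule ennreal_leI[OF d(2)])
  finally show ?thesis using valid by blast
qed

section \<open>The input process\<close>

lemma norm_matrix_vector_mult_le: "norm (G *v x) \<le> norm G * norm x" for G :: "real^'n^'m"
proof -
  have "norm (G *v x) \<le> L2_set (\<lambda>i. norm (G $ i) * norm x) UNIV"
    unfolding norm_vec_def[of "G *v x"]
    by (rule L2_set_mono) (auto simp: matrix_vector_mul_component Cauchy_Schwarz_ineq2)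
  also have "\<dots> = norm G * norm x"
    by (simp add: norm_vec_def[of G] L2_set_left_distrib)
  finally show ?thesis .
qed

lemma nn_integral_exp_atMost:
  fixes b :: real
  assumes "b > 0"
  shows "(\<integral>\<^sup>+u. ennreal (exp (b * u)) * indicator {..a} u \<partial>lborel) = ennreal (exp (b * a) / b)"
proof -
  have "(\<integral>\<^sup>+u. ennreal (exp (b * u)) * indicator {..a} u \<partial>lborel) =
      (\<integral>\<^sup>+u. ennreal (exp (b * (0 + - 1 * u))) * indicator {..a} (0 + - 1 * u) \<partial>lborel)"
    by (subst nn_integral_real_affine[of _ "-1" 0]) auto
  also have "\<dots> = (\<integral>\<^sup>+u. ennreal (exp (- b * u)) * indicator {- a..} u \<partial>lborel)"
    by (intro nn_integral_cong) (auto simp: indicator_def)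
  also have "\<dots> = ennreal (0 - (- exp (- b * (- a)) / b))"
  proof (rule nn_integral_FTC_atLeast)
    show "((\<lambda>u. - exp (- b * u) / b) has_real_derivative exp (- b * u)) (at u)" for u
      using assms by (auto intro!: derivative_eq_intros)
    have "((\<lambda>u. - exp (- b * u) / b) \<longlongrightarrow> - 0 / b) at_top"
      using assms by (intro tendsto_intros filterlim_compose[OF exp_at_bot]
          filterlim_tendsto_neg_mult_at_bot[OF tendsto_const _ filterlim_ident]) auto
    then show "((\<lambda>u. - exp (- b * u) / b) \<longlongrightarrow> 0) at_top" by simp
  qed auto
  finally show ?thesis by simp
qed

lemma ms_tendsto_cong:
  assumes "\<forall>\<^sub>F i in F. AE w in M. Z i w = Z' i w" "AE w in M. W w = W' w"
  shows "ms_tendsto M Z W F \<longleftrightarrow> ms_tendsto M Z' W' F"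
  unfolding ms_tendsto_iff_sq_norm
proof (rule tendsto_cong)
  show "\<forall>\<^sub>F i in F. sq_norm M (\<lambda>w. Z i w - W w) = sq_norm M (\<lambda>w. Z' i w - W' w)"
    using assms(1)
  proof eventually_elim
    case (elim i)
    show ?case
    proof (rule sq_norm_cong_AE)
      show "AE w in M. Z i w - W w = Z' i w - W' w"
        using elim assms(2) by eventually_elim simp
    qed
  qed
qed

lemma ms_tendsto_0_bound:
  assumes "\<forall>\<^sub>F i in F. sq_norm M (Z i) \<le> ennreal (r i)" "(r \<longlongrightarrow> 0) F"
  shows "ms_tendsto M Z (\<lambda>_. 0) F"
proof -
  have "((\<lambda>i. ennreal (r i)) \<longlongrightarrow> 0) F" using tendsto_ennrealI[OF assms(2)] by simp
  then have "((\<lambda>i. sq_norm M (Z i)) \<longlongrightarrow> 0) F"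
    by (rule tendsto_sandwich[OF _ assms(1) tendsto_const, rotated]) simp
  then show ?thesis by (simp add: ms_tendsto_iff_sq_norm)
qed

lemma ms_tendsto_0_mult_vec:
  fixes G :: "'i \<Rightarrow> real^'n^'m" and Z :: "'i \<Rightarrow> 'a \<Rightarrow> real^'n"
  assumes G: "(G \<longlongrightarrow> 0) F" and Z: "\<And>i. Z i \<in> borel_measurable M" "\<And>i. sq_norm M (Z i) \<le> ennreal c" and c: "c \<ge> 0"
  shows "ms_tendsto M (\<lambda>i w. G i *v Z i w) (\<lambda>_. 0) F"
proof (rule ms_tendsto_0_bound)
  show "\<forall>\<^sub>F i in F. sq_norm M (\<lambda>w. G i *v Z i w) \<le> ennreal ((norm (G i))\<^sup>2 * c)"
  proof (rule always_eventually, rule allI)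
    fix i
    have "sq_norm M (\<lambda>w. G i *v Z i w) \<le> ennreal ((norm (G i))\<^sup>2) * sq_norm M (Z i)"
      by (rule sq_norm_le) (auto simp: norm_matrix_vector_mult_le Z)
    also have "\<dots> \<le> ennreal ((norm (G i))\<^sup>2) * ennreal c" by (intro mult_left_mono Z) simp
    finally show "sq_norm M (\<lambda>w. G i *v Z i w) \<le> ennreal ((norm (G i))\<^sup>2 * c)"
      using c by (simp add: ennreal_mult)
  qed
  have "((\<lambda>i. (norm (G i))\<^sup>2 * c) \<longlongrightarrow> (norm (0 :: real^'n^'m))\<^sup>2 * c) F"
    by (intro tendsto_intros G)
  then show "((\<lambda>i. (norm (G i))\<^sup>2 * c) \<longlongrightarrow> 0) F" by simp
qed

text \<open>The common shape of the limits below: a term with a vanishing matrix factor, a noise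
  term, and the main term. The identity is only almost sure, for each d separately.\<close>

lemma ms_tendsto_perturbed:
  fixes F N W Z :: "real \<Rightarrow> 'a \<Rightarrow> 'b::{real_normed_vector, second_countable_topology}"
  assumes [measurable]: "\<And>d. F d \<in> borel_measurable M" "\<And>d. N d \<in> borel_measurable M"
      "\<And>d. W d \<in> borel_measurable M" "V \<in> borel_measurable M"
    and "ms_tendsto M F (\<lambda>_. 0) (at_right 0)" "ms_tendsto M N (\<lambda>_. 0) (at_right 0)" "ms_tendsto M W V (at_right 0)"
    and Z: "\<And>d. d > 0 \<Longrightarrow> AE w in M. Z d w = F d w + N d w + W d w"
  shows "ms_tendsto M Z V (at_right 0)"
proof -
  have "ms_tendsto M (\<lambda>d w. (F d w + N d w) + W d w) (\<lambda>w. (0 + 0) + V w) (at_right 0)"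
    by (intro ms_tendsto_add assms) measurable
  moreover have "ms_tendsto M Z V (at_right 0) \<longleftrightarrow> ms_tendsto M (\<lambda>d w. (F d w + N d w) + W d w) V (at_right 0)"
    by (rule ms_tendsto_cong) (use Z in \<open>auto intro: eventually_mono[OF eventually_at_right_less[of 0]]\<close>)
  ultimately show ?thesis by simp
qed

lemma ms_tendsto_const: "ms_tendsto M (\<lambda>_. W) W F" for W :: "'a \<Rightarrow> 'b::real_normed_vector"
  by (simp add: ms_tendsto_def)

text \<open>The state can be advanced forwards in time only, so the two one-sided limits need
  separate arguments.\<close>

lemma ms_tendsto_at_0I:
  assumes "ms_tendsto M Z W (at_right (0 :: real))" "ms_tendsto M (\<lambda>d. Z (- d)) W (at_right 0)"
  shows "ms_tendsto M Z W (at 0)"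
  using assms unfolding ms_tendsto_def
  by (intro filterlim_split_at) (simp_all add: filterlim_at_left_to_right[of _ _ 0])

locale stable_system = centered_levy M L for M :: "'a measure" and L :: "real \<Rightarrow> 'a \<Rightarrow> real^'k" +
  fixes A :: "real^'n^'n" and B :: "real^'k^'n"
  assumes decay: "exp_decay (\<lambda>t. mat_exp (t *\<^sub>R A))"
begin

abbreviation E :: "real \<Rightarrow> real^'n^'n" where
  "E t \<equiv> mat_exp (t *\<^sub>R A)"

definition state :: "real \<Rightarrow> 'a \<Rightarrow> real^'n" where
  "state t = levy_integral M L {..t} (\<lambda>u. E (t - u) ** B)"

definition noise :: "real \<Rightarrow> real \<Rightarrow> 'a \<Rightarrow> real^'n" where
  "noise s t = levy_integral M L {s<..t} (\<lambda>u. E (t - u) ** B)"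

lemma continuous_on_kernel: "continuous_on S (\<lambda>u. E (t - u) ** G)"
  by (intro mmult.continuous_on continuous_intros)

lemma kernel_measurable [measurable]:
  assumes [measurable]: "S \<in> sets borel"
  shows "(\<lambda>u. indicator S u *\<^sub>R (E (t - u) ** G)) \<in> borel_measurable borel"
proof -
  have [measurable]: "(\<lambda>u. E (t - u) ** G) \<in> borel_measurable borel"
    by (intro borel_measurable_continuous_onI continuous_on_kernel)
  show ?thesis by measurable
qed

lemma kernel_bound:
  obtains c \<alpha> where "c \<ge> 0" "\<alpha> > 0" "\<And>v. v \<ge> 0 \<Longrightarrow> norm (H ** E v ** G) \<le> c * exp (- \<alpha> * v)"
proof -
  obtain c \<alpha> where c: "\<alpha> > 0" "\<And>v. v \<ge> 0 \<Longrightarrow> norm (E v) \<le> c * exp (- \<alpha> * v)"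
    using decay by (auto simp: exp_decay_def)
  obtain K where K: "K \<ge> 0" "\<And>X. norm (H ** X ** G) \<le> norm X * K"
    using bounded_linear.nonneg_bounded[OF bounded_linear_compose[OF mmult.bounded_linear_left[of G] mmult.bounded_linear_right[of H]]]
    by blast
  have "c \<ge> 0" using order_trans[OF norm_ge_zero c(2)[of 0]] by simp
  moreover have "norm (H ** E v ** G) \<le> (c * K) * exp (- \<alpha> * v)" if "v \<ge> 0" for v
    using order_trans[OF K(2) mult_right_mono[OF c(2)[OF that] K(1)]] by (simp add: mult_ac)
  ultimately show ?thesis using c(1) K(1) by (intro that[of "c * K" \<alpha>]) auto
qed

text \<open>It serves twice: with a far below t to cut off the unbounded range of integration, and
  with a = t to bound the second moment of the state. Squaring the kernel bound doubles the rate,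
  and integration divides by it.\<close>

lemma kernel_tail:
  obtains c \<alpha> where "c \<ge> 0" "\<alpha> > 0"
    "\<And>a t. a \<le> t \<Longrightarrow> sq_norm lborel (\<lambda>u. indicator {..a} u *\<^sub>R (E (t - u) ** B)) \<le> ennreal (c * exp (- \<alpha> * (t - a)))"
proof -
  obtain c \<alpha> where c: "c \<ge> 0" "\<alpha> > 0" "\<And>v. v \<ge> 0 \<Longrightarrow> norm (mat 1 ** E v ** B) \<le> c * exp (- \<alpha> * v)"
    using kernel_bound by blast
  show ?thesis
  proof (rule that)
    show "c\<^sup>2 / (2 * \<alpha>) \<ge> 0" "2 * \<alpha> > 0" using c by auto
    fix a t :: real assume at: "a \<le> t"
    have "sq_norm lborel (\<lambda>u. indicator {..a} u *\<^sub>R (E (t - u) ** B)) \<le>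
      (\<integral>\<^sup>+u. ennreal (c\<^sup>2 * exp (- 2 * \<alpha> * t)) * (ennreal (exp (2 * \<alpha> * u)) * indicator {..a} u) \<partial>lborel)"
      unfolding sq_norm_def
    proof (rule nn_integral_mono)
      fix u
      show "ennreal ((norm (indicator {..a} u *\<^sub>R (E (t - u) ** B)))\<^sup>2) \<le>
        ennreal (c\<^sup>2 * exp (- 2 * \<alpha> * t)) * (ennreal (exp (2 * \<alpha> * u)) * indicator {..a} u)"
      proof (cases "u \<le> a")
        case True
        have "(norm (E (t - u) ** B))\<^sup>2 \<le> (c * exp (- \<alpha> * (t - u)))\<^sup>2"
          using c(3)[of "t - u"] True at by (intro power_mono) auto
        also have "\<dots> = c\<^sup>2 * exp (- 2 * \<alpha> * t) * exp (2 * \<alpha> * u)"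
          by (simp add: power_mult_distrib algebra_simps flip: exp_of_nat_mult exp_add)
        finally show ?thesis using True by (simp add: ennreal_mult'[symmetric] ennreal_leI)
      qed simp
    qed
    also have "\<dots> = ennreal (c\<^sup>2 * exp (- 2 * \<alpha> * t)) * ennreal (exp (2 * \<alpha> * a) / (2 * \<alpha>))"
      using c(2) by (subst nn_integral_cmult) (simp_all add: nn_integral_exp_atMost)
    also have "\<dots> = ennreal (c\<^sup>2 / (2 * \<alpha>) * exp (- (2 * \<alpha>) * (t - a)))"
      using c by (simp add: ennreal_mult'[symmetric] algebra_simps flip: exp_add)
    finally show "sq_norm lborel (\<lambda>u. indicator {..a} u *\<^sub>R (E (t - u) ** B)) \<le>
      ennreal (c\<^sup>2 / (2 * \<alpha>) * exp (- (2 * \<alpha>) * (t - a)))" .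
  qed
qed

lemma has_levy_integral_noise: "has_levy_integral M L {s<..t} (\<lambda>u. E (t - u) ** B) (noise s t)"
  unfolding noise_def
proof (rule has_levy_integral_exists)
  fix e :: real assume e: "e > 0"
  show "\<exists>D. valid_steps D \<and> sq_norm lborel (\<lambda>u. step_fun D u - indicator {s<..t} u *\<^sub>R (E (t - u) ** B)) \<le> ennreal e"
  proof (cases "s \<le> t")
    case True
    then show ?thesis by (intro step_approx_Ioc continuous_on_kernel e)
  next
    case False
    then show ?thesis by (intro exI[of _ "[]"]) (simp add: valid_steps_def sq_norm_def)
  qed
qed measurable

text \<open>The kernel below a = t - n is dropped and the rest approximated on a bounded interval.
  Each error is at most e / 4, because \<open>sq_norm_diff\<close> doubles both.\<close>

lemma has_levy_integral_state: "has_levy_integral M L {..t} (\<lambda>u. E (t - u) ** B) (state t)"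
  unfolding state_def
proof (rule has_levy_integral_exists)
  let ?f = "\<lambda>u. E (t - u) ** B"
  fix e :: real assume e: "e > 0"
  obtain c \<alpha> where c: "c \<ge> 0" "\<alpha> > 0"
    "\<And>a t. a \<le> t \<Longrightarrow> sq_norm lborel (\<lambda>u. indicator {..a} u *\<^sub>R (E (t - u) ** B)) \<le> ennreal (c * exp (- \<alpha> * (t - a)))"
    using kernel_tail by blast
  have "((\<lambda>n. c * exp (- \<alpha> * real n)) \<longlongrightarrow> c * 0) sequentially"
    using c(2) by (intro tendsto_intros filterlim_compose[OF exp_at_bot]
          filterlim_tendsto_neg_mult_at_bot[OF tendsto_const _ filterlim_real_sequentially]) auto
  then have "\<forall>\<^sub>F n in sequentially. c * exp (- \<alpha> * real n) < e / 4"
    using e by (intro order_tendstoD(2)) auto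
  then obtain n where n: "c * exp (- \<alpha> * real n) < e / 4"
    by (auto simp: eventually_sequentially)
  define a where "a = t - real n"
  have a: "a \<le> t" by (simp add: a_def)
  have tail: "sq_norm lborel (\<lambda>u. indicator {..a} u *\<^sub>R ?f u) \<le> ennreal (e / 4)"
    using c(3)[OF a] n by (elim order_trans) (auto simp: a_def intro!: ennreal_leI)
  obtain D where D: "valid_steps D" "sq_norm lborel (\<lambda>u. step_fun D u - indicator {a<..t} u *\<^sub>R ?f u) \<le> ennreal (e / 4)"
    using step_approx_Ioc[OF continuous_on_kernel _ a, of "e / 4" t B] e by auto
  have "sq_norm lborel (\<lambda>u. step_fun D u - indicator {..t} u *\<^sub>R ?f u) =
      sq_norm lborel (\<lambda>u. (step_fun D u - indicator {a<..t} u *\<^sub>R ?f u) - indicator {..a} u *\<^sub>R ?f u)"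
    using a by (intro arg_cong[where f = "sq_norm lborel"]) (auto simp: fun_eq_iff indicator_def)
  also have "\<dots> \<le> 2 * sq_norm lborel (\<lambda>u. step_fun D u - indicator {a<..t} u *\<^sub>R ?f u) + 2 * sq_norm lborel (\<lambda>u. indicator {..a} u *\<^sub>R ?f u)"
    by (rule sq_norm_diff) measurable
  also have "\<dots> \<le> 2 * ennreal (e / 4) + 2 * ennreal (e / 4)"
    by (intro add_mono mult_left_mono D tail) auto
  also have "\<dots> = ennreal e"
    using e by (simp add: ennreal_mult'[symmetric] ennreal_plus[symmetric] flip: ennreal_numeral del: ennreal_plus)
  finally show "\<exists>D. valid_steps D \<and> sq_norm lborel (\<lambda>u. step_fun D u - indicator {..t} u *\<^sub>R ?f u) \<le> ennreal e"
    using D(1) by blast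
qed measurable

lemma state_measurable [measurable]: "state t \<in> borel_measurable M"
  by (rule has_levy_integral_measurable[OF has_levy_integral_state])

lemma noise_measurable [measurable]: "noise s t \<in> borel_measurable M"
  by (rule has_levy_integral_measurable[OF has_levy_integral_noise])

lemma noise_eq_0: "AE w in M. noise t t w = 0"
proof -
  have "sq_norm M (noise t t) \<le> ennreal (4 * \<kappa>) * sq_norm lborel (\<lambda>u. indicator {t<..t} u *\<^sub>R (E (t - u) ** B))"
    by (rule sq_norm_levy_integral_le[OF has_levy_integral_noise]) simp_all
  then have "sq_norm M (noise t t) = 0" by (simp add: sq_norm_def)
  then show ?thesis by (subst (asm) sq_norm_eq_0_iff) (simp_all add: noise_measurable)
qed

lemma state_second_moment: obtains c where "c \<ge> 0" "\<And>t. sq_norm M (state t) \<le> ennreal c"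
proof -
  obtain c \<alpha> where c: "c \<ge> 0" "\<alpha> > 0"
    "\<And>a t. a \<le> t \<Longrightarrow> sq_norm lborel (\<lambda>u. indicator {..a} u *\<^sub>R (E (t - u) ** B)) \<le> ennreal (c * exp (- \<alpha> * (t - a)))"
    using kernel_tail by blast
  have "sq_norm M (state t) \<le> ennreal (4 * \<kappa> * c)" for t
  proof -
    have "sq_norm M (state t) \<le> ennreal (4 * \<kappa>) * sq_norm lborel (\<lambda>u. indicator {..t} u *\<^sub>R (E (t - u) ** B))"
      by (rule sq_norm_levy_integral_le[OF has_levy_integral_state]) simp
    also have "\<dots> \<le> ennreal (4 * \<kappa>) * ennreal c"
      using c(3)[of t t] by (intro mult_left_mono) auto
    finally show ?thesis using c \<kappa>_nonneg by (simp add: ennreal_mult)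
  qed
  then show ?thesis using c(1) \<kappa>_nonneg by (intro that[of "4 * \<kappa> * c"]) auto
qed

text \<open>On the past of s the kernel factorizes as \<open>E (t - s)\<close> times the kernel at
  s. Additivity over the two ranges gives another integral of the kernel at t, which is almost
  surely the chosen one.\<close>

lemma state_step:
  assumes "s \<le> t"
  shows "AE w in M. state t w = E (t - s) *v state s w + noise s t w"
proof -
  have shift: "E (t - s) ** (E (s - u) ** B) = E (t - u) ** B" for u
    using mat_exp_add[of "t - s" "s - u" A] by (simp add: matrix_mul_assoc)
  have "has_levy_integral M L {..s} (\<lambda>u. E (t - s) ** (E (s - u) ** B)) (\<lambda>w. E (t - s) *v state s w)"
    by (rule has_levy_integral_mult[OF has_levy_integral_state]) simp
  then have 1: "has_levy_integral M L {..s} (\<lambda>u. E (t - u) ** B) (\<lambda>w. E (t - s) *v state s w)"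
    unfolding shift .
  have "has_levy_integral M L {..t} (\<lambda>u. E (t - u) ** B) (\<lambda>w. E (t - s) *v state s w + noise s t w)"
  proof (rule has_levy_integral_add[OF 1 has_levy_integral_noise])
    show "indicator {..t} u *\<^sub>R (E (t - u) ** B) =
      indicator {..s} u *\<^sub>R (E (t - u) ** B) + indicator {s<..t} u *\<^sub>R (E (t - u) ** B)" for u
      using assms by (simp add: indicator_def)
  qed measurable
  then show ?thesis
    by (rule has_levy_integral_unique[OF has_levy_integral_state]) simp_all
qed

text \<open>The kernel bound g is left open: a constant g gives the order d, while g proportional to
  d gives the order d^3.\<close>

lemma noise_second_moment:
  fixes K :: "real^'n^'m"
  assumes "d \<ge> 0" and bound: "\<And>v. 0 \<le> v \<Longrightarrow> v \<le> d \<Longrightarrow> norm (K ** E v ** B) \<le> g"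
  shows "sq_norm M (\<lambda>w. K *v noise s (s + d) w) \<le> ennreal (4 * \<kappa> * (g\<^sup>2 * d))"
proof -
  let ?f = "\<lambda>u. K ** (E (s + d - u) ** B)"
  have "continuous_on UNIV ?f" by (intro mmult.continuous_on continuous_on_const continuous_on_kernel)
  then have [measurable]: "?f \<in> borel_measurable borel" by (rule borel_measurable_continuous_onI)
  have "has_levy_integral M L {s<..s + d} ?f (\<lambda>w. K *v noise s (s + d) w)"
    using assms by (intro has_levy_integral_mult has_levy_integral_noise) auto
  then have "sq_norm M (\<lambda>w. K *v noise s (s + d) w) \<le>
      ennreal (4 * \<kappa>) * sq_norm lborel (\<lambda>u. indicator {s<..s + d} u *\<^sub>R ?f u)"
    by (rule sq_norm_levy_integral_le) measurable
  also have "sq_norm lborel (\<lambda>u. indicator {s<..s + d} u *\<^sub>R ?f u) \<le> (\<integral>\<^sup>+u. ennreal (g\<^sup>2) * indicator {s<..s + d} u \<partial>lborel)"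
    unfolding sq_norm_def using bound
    by (intro nn_integral_mono) (auto simp: indicator_def matrix_mul_assoc intro!: ennreal_leI power_mono)
  also have "\<dots> = ennreal (g\<^sup>2 * d)"
    using assms(1) by (simp add: nn_integral_cmult ennreal_mult)
  finally show ?thesis
    using assms(1) \<kappa>_nonneg by (simp add: ennreal_mult mult_left_mono)
qed

text \<open>The kernel vanishes at v = 0, and its derivative \<open>K ** A ** E v ** B\<close> is
  bounded by exponential decay, so the mean value inequality applies.\<close>

lemma kernel_bound_linear:
  fixes K :: "real^'n^'m"
  assumes KB: "K ** B = 0"
  obtains c where "c \<ge> 0" "\<And>v. v \<ge> 0 \<Longrightarrow> norm (K ** E v ** B) \<le> c * v"
proof -
  obtain c \<alpha> where c: "c \<ge> 0" "\<alpha> > 0" "\<And>v. v \<ge> 0 \<Longrightarrow> norm ((K ** A) ** E v ** B) \<le> c * exp (- \<alpha> * v)"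
    using kernel_bound by blast
  have deriv: "((\<lambda>v. K ** E v ** B) has_vector_derivative K ** A ** E v ** B) (at v)" for v
    using bounded_linear.has_vector_derivative[OF bounded_linear_compose[OF mmult.bounded_linear_left[of B]
        mmult.bounded_linear_right[of K]] mat_exp_has_vector_derivative[of A v]]
    by (simp add: matrix_mul_assoc)
  have "norm (K ** E v ** B) \<le> c * v" if "v \<ge> 0" for v
  proof (cases "v = 0")
    case False
    with that have v: "v > 0" by simp
    have "norm (K ** E v ** B - K ** E 0 ** B) \<le> c * v - c * 0"
    proof (rule differentiable_bound_general[OF v])
      show "continuous_on {0..v} (\<lambda>v. K ** E v ** B)"
        by (intro continuous_at_imp_continuous_on ballI has_vector_derivative_continuous[OF deriv])
      show "((\<lambda>v. c * v) has_vector_derivative c) (at x)" for x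
        by (auto intro!: derivative_eq_intros simp flip: has_real_derivative_iff_has_vector_derivative)
      show "norm (K ** A ** E x ** B) \<le> c" if "0 < x" for x
      proof -
        have "c * exp (- \<alpha> * x) \<le> c * 1" using c(1,2) that by (intro mult_left_mono) auto
        then show ?thesis using c(3)[of x] that by simp
      qed
    qed (auto intro!: continuous_intros deriv)
    then show ?thesis by (simp add: KB)
  qed (simp add: KB)
  with c(1) show ?thesis by (rule that)
qed

text \<open>The starting point may depend on d: it is t for limits from the right and t - d for
  limits from the left.\<close>

lemma noise_small:
  fixes s :: "real \<Rightarrow> real"
  shows "ms_tendsto M (\<lambda>d w. noise (s d) (s d + d) w) (\<lambda>_. 0) (at_right 0)"
proof -
  obtain c \<alpha> where c: "c \<ge> 0" "\<alpha> > 0" "\<And>v. v \<ge> 0 \<Longrightarrow> norm (mat 1 ** E v ** B) \<le> c * exp (- \<alpha> * v)"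
    using kernel_bound by blast
  have c': "norm (mat 1 ** E v ** B) \<le> c" if "v \<ge> 0" for v
  proof -
    have "c * exp (- \<alpha> * v) \<le> c * 1" using c(1,2) that by (intro mult_left_mono) auto
    then show ?thesis using c(3)[OF that] by simp
  qed
  show ?thesis
  proof (rule ms_tendsto_0_bound)
    show "\<forall>\<^sub>F d in at_right 0. sq_norm M (noise (s d) (s d + d)) \<le> ennreal (4 * \<kappa> * (c\<^sup>2 * d))"
      using eventually_at_right_less[of 0]
    proof eventually_elim
      case (elim d)
      then show ?case
        using noise_second_moment[of d "mat 1" c "s d"] c' by simp
    qed
    have "((\<lambda>d. 4 * \<kappa> * (c\<^sup>2 * d)) \<longlongrightarrow> 4 * \<kappa> * (c\<^sup>2 * 0)) (at_right 0)"
      by (intro tendsto_intros)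
    then show "((\<lambda>d. 4 * \<kappa> * (c\<^sup>2 * d)) \<longlongrightarrow> 0) (at_right 0)" by simp
  qed
qed

text \<open>The second moment of the noise seen through K is of order d^3, so division by d leaves a
  second moment of order d.\<close>

lemma noise_negligible:
  fixes K :: "real^'n^'m" and s :: "real \<Rightarrow> real"
  assumes "K ** B = 0"
  shows "ms_tendsto M (\<lambda>d w. (K *v noise (s d) (s d + d) w) /\<^sub>R d) (\<lambda>_. 0) (at_right 0)"
proof -
  obtain c where c: "c \<ge> 0" "\<And>v. v \<ge> 0 \<Longrightarrow> norm (K ** E v ** B) \<le> c * v"
    using kernel_bound_linear[OF assms] by blast
  show ?thesis
  proof (rule ms_tendsto_0_bound)
    show "\<forall>\<^sub>F d in at_right 0. sq_norm M (\<lambda>w. (K *v noise (s d) (s d + d) w) /\<^sub>R d) \<le> ennreal (4 * \<kappa> * (c\<^sup>2 * d))"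
      using eventually_at_right_less[of 0]
    proof eventually_elim
      case (elim d)
      have "sq_norm M (\<lambda>w. (K *v noise (s d) (s d + d) w) /\<^sub>R d) \<le> ennreal ((inverse d)\<^sup>2) * sq_norm M (\<lambda>w. K *v noise (s d) (s d + d) w)"
        using elim by (intro sq_norm_le) auto
      also have "\<dots> \<le> ennreal ((inverse d)\<^sup>2) * ennreal (4 * \<kappa> * ((c * d)\<^sup>2 * d))"
      proof (intro mult_left_mono noise_second_moment)
        fix v assume "0 \<le> v" "v \<le> d"
        then show "norm (K ** E v ** B) \<le> c * d"
          using c(2)[of v] mult_left_mono[of v d c] c(1) by linarith
      qed (use elim in auto)
      also have "\<dots> = ennreal (4 * \<kappa> * (c\<^sup>2 * d))"
        using elim by (simp add: ennreal_mult'[symmetric] power2_eq_square field_simps)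
      finally show ?case .
    qed
    have "((\<lambda>d. 4 * \<kappa> * (c\<^sup>2 * d)) \<longlongrightarrow> 4 * \<kappa> * (c\<^sup>2 * 0)) (at_right 0)"
      by (intro tendsto_intros)
    then show "((\<lambda>d. 4 * \<kappa> * (c\<^sup>2 * d)) \<longlongrightarrow> 0) (at_right 0)" by simp
  qed
qed

section \<open>Mean-square continuity and differentiability of the state\<close>

lemma mat_exp_difference_quotient: "((\<lambda>d. (E d - mat 1) /\<^sub>R d - A) \<longlongrightarrow> 0) (at_right 0)"
proof -
  have "((\<lambda>d. norm (E (0 + d) - E 0 - d *\<^sub>R (A ** E 0)) / norm d) \<longlongrightarrow> 0) (at 0)"
    using mat_exp_has_vector_derivative[of A 0] by (simp add: has_vector_derivative_def has_derivative_at)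
  then have "((\<lambda>d. norm (E d - mat 1 - d *\<^sub>R A) / norm d) \<longlongrightarrow> 0) (at_right 0)"
    using tendsto_mono[OF at_le[OF subset_UNIV]] by simp
  moreover have "\<forall>\<^sub>F d in at_right 0. norm (E d - mat 1 - d *\<^sub>R A) / norm d = norm ((E d - mat 1) /\<^sub>R d - A)"
    using eventually_at_right_less[of 0]
  proof eventually_elim
    case (elim d)
    have "(E d - mat 1) /\<^sub>R d - A = (E d - mat 1 - d *\<^sub>R A) /\<^sub>R d"
      using elim by (simp add: scaleR_diff_right)
    then show ?case using elim by (simp add: divide_inverse mult.commute)
  qed
  ultimately have "((\<lambda>d. norm ((E d - mat 1) /\<^sub>R d - A)) \<longlongrightarrow> 0) (at_right 0)"
    by (rule Lim_transform_eventually)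
  then show ?thesis by (rule tendsto_norm_zero_cancel)
qed

lemma mat_exp_tendsto_1: "((\<lambda>d. E d - mat 1) \<longlongrightarrow> 0) (at_right 0)"
proof -
  have "((\<lambda>d. E d) \<longlongrightarrow> E 0) (at 0)"
    using has_vector_derivative_continuous[OF mat_exp_has_vector_derivative[of A 0]] by (simp add: continuous_at)
  then have "((\<lambda>d. E d) \<longlongrightarrow> E 0) (at_right 0)"
    by (rule tendsto_mono[OF at_le[OF subset_UNIV]])
  then have "((\<lambda>d. E d - mat 1) \<longlongrightarrow> E 0 - mat 1) (at_right 0)"
    by (intro tendsto_diff tendsto_const)
  then show ?thesis by simp
qed

lemma state_step_add: "d > 0 \<Longrightarrow> AE w in M. state (s + d) w = E d *v state s w + noise s (s + d) w"
  using state_step[of s "s + d"] by simp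

text \<open>The step from t - d to t is solved for the earlier state, which then also appears on the
  right. Its factor tends to 0 and its second moment is bounded uniformly in time.\<close>

lemma state_continuous_left: "ms_tendsto M (\<lambda>d. state (t - d)) (state t) (at_right 0)"
proof -
  obtain c where c: "c \<ge> 0" "\<And>t. sq_norm M (state t) \<le> ennreal c" using state_second_moment by blast
  show ?thesis
  proof (rule ms_tendsto_perturbed)
    have "((\<lambda>d. - (E d - mat 1)) \<longlongrightarrow> 0) (at_right 0)" using tendsto_minus[OF mat_exp_tendsto_1] by simp
    then show "ms_tendsto M (\<lambda>d w. (- (E d - mat 1)) *v state (t - d) w) (\<lambda>_. 0) (at_right 0)"
      by (rule ms_tendsto_0_mult_vec[OF _ _ c(2) c(1)]) simp
    show "ms_tendsto M (\<lambda>d w. - noise (t - d) (t - d + d) w) (\<lambda>_. 0) (at_right 0)"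
      using ms_tendsto_bounded_linear[OF bounded_linear_minus[OF bounded_linear_ident] _ _ noise_small[of "\<lambda>d. t - d"]] by simp
    show "ms_tendsto M (\<lambda>_. state t) (state t) (at_right 0)" by (rule ms_tendsto_const)
    show "AE w in M. state (t - d) w = - (E d - mat 1) *v state (t - d) w + - noise (t - d) (t - d + d) w + state t w"
      if "d > 0" for d
      using state_step_add[OF that, of "t - d"] by eventually_elim (simp add: mvmult.diff_left mvmult.minus_left)
  qed measurable
qed

lemma state_continuous_right: "ms_tendsto M (\<lambda>d. state (t + d)) (state t) (at_right 0)"
proof -
  obtain c where c: "c \<ge> 0" "\<And>t. sq_norm M (state t) \<le> ennreal c" using state_second_moment by blast
  show ?thesis
  proof (rule ms_tendsto_perturbed)
    show "ms_tendsto M (\<lambda>d w. (E d - mat 1) *v state t w) (\<lambda>_. 0) (at_right 0)"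
      by (rule ms_tendsto_0_mult_vec[OF mat_exp_tendsto_1 _ c(2) c(1)]) simp
    show "ms_tendsto M (\<lambda>d w. noise t (t + d) w) (\<lambda>_. 0) (at_right 0)"
      by (rule noise_small)
    show "ms_tendsto M (\<lambda>_. state t) (state t) (at_right 0)" by (rule ms_tendsto_const)
    show "AE w in M. state (t + d) w = (E d - mat 1) *v state t w + noise t (t + d) w + state t w"
      if "d > 0" for d
      using state_step_add[OF that, of t] by eventually_elim (simp add: mvmult.diff_left)
  qed measurable
qed

lemma state_continuous: "ms_tendsto M (\<lambda>h. state (t + h)) (state t) (at 0)"
  using ms_tendsto_at_0I[OF state_continuous_right, of t] state_continuous_left[of t] by simp

text \<open>The condition \<open>K ** B = 0\<close> removes the noise of order \<open>sqrt h\<close> from the increment over \<open>h\<close>.\<close>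

lemma state_ms_derivative:
  fixes K :: "real^'n^'m"
  assumes KB: "K ** B = 0"
  shows "ms_tendsto M (\<lambda>h w. (K *v state (t + h) w - K *v state t w) /\<^sub>R h) (\<lambda>w. (K ** A) *v state t w) (at 0)"
proof (rule ms_tendsto_at_0I)
  obtain c where c: "c \<ge> 0" "\<And>t. sq_norm M (state t) \<le> ennreal c" using state_second_moment by blast
  \<comment> \<open>G d is the deviation of the difference quotient of the exponential from its
    limit A, seen through K.\<close>
  define G where "G d = K ** ((E d - mat 1) /\<^sub>R d - A)" for d
  have "(G \<longlongrightarrow> K ** 0) (at_right 0)"
    unfolding G_def by (intro mmult.tendsto tendsto_const mat_exp_difference_quotient)
  then have G: "(G \<longlongrightarrow> 0) (at_right 0)" by (simp add: mmult.zero_right)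
  have quotient: "(K *v (E d *v x + n) - K *v x) /\<^sub>R d = G d *v x + (K *v n) /\<^sub>R d + (K ** A) *v x" for d x n
    by (simp add: G_def mmult.diff_right mvmult.diff_left mvmult.add_right matrix_vector_mul_assoc[symmetric]
        scaleR_matrix_mult_right scaleR_matrix_vector_assoc[symmetric] scaleR_diff_right scaleR_add_right)
  show "ms_tendsto M (\<lambda>h w. (K *v state (t + h) w - K *v state t w) /\<^sub>R h) (\<lambda>w. (K ** A) *v state t w) (at_right 0)"
  proof (rule ms_tendsto_perturbed)
    show "ms_tendsto M (\<lambda>d w. G d *v state t w) (\<lambda>_. 0) (at_right 0)"
      by (rule ms_tendsto_0_mult_vec[OF G _ c(2) c(1)]) simp
    show "ms_tendsto M (\<lambda>d w. (K *v noise t (t + d) w) /\<^sub>R d) (\<lambda>_. 0) (at_right 0)"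
      by (rule noise_negligible[OF KB])
    show "ms_tendsto M (\<lambda>_ w. (K ** A) *v state t w) (\<lambda>w. (K ** A) *v state t w) (at_right 0)"
      by (rule ms_tendsto_const)
    show "AE w in M. (K *v state (t + d) w - K *v state t w) /\<^sub>R d =
        G d *v state t w + (K *v noise t (t + d) w) /\<^sub>R d + (K ** A) *v state t w" if "d > 0" for d
      using state_step_add[OF that, of t] by eventually_elim (simp add: quotient)
  qed measurable
  show "ms_tendsto M (\<lambda>d w. (K *v state (t + - d) w - K *v state t w) /\<^sub>R (- d)) (\<lambda>w. (K ** A) *v state t w) (at_right 0)"
  proof (rule ms_tendsto_perturbed)
    show "ms_tendsto M (\<lambda>d w. G d *v state (t - d) w) (\<lambda>_. 0) (at_right 0)"
      by (rule ms_tendsto_0_mult_vec[OF G _ c(2) c(1)]) simp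
    show "ms_tendsto M (\<lambda>d w. (K *v noise (t - d) (t - d + d) w) /\<^sub>R d) (\<lambda>_. 0) (at_right 0)"
      by (rule noise_negligible[OF KB])
    \<comment> \<open>In the quotient from the left the main term still varies with d; mean-square
      continuity from the left gives its limit.\<close>
    show "ms_tendsto M (\<lambda>d w. (K ** A) *v state (t - d) w) (\<lambda>w. (K ** A) *v state t w) (at_right 0)"
      by (rule ms_tendsto_bounded_linear[OF mvmult.bounded_linear_right _ _ state_continuous_left]) simp_all
    show "AE w in M. (K *v state (t + - d) w - K *v state t w) /\<^sub>R (- d) =
        G d *v state (t - d) w + (K *v noise (t - d) (t - d + d) w) /\<^sub>R d + (K ** A) *v state (t - d) w"
      if "d > 0" for d
      using state_step_add[OF that, of "t - d"]
    proof eventually_elim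
      case (elim w)
      have "(K *v state (t + - d) w - K *v state t w) /\<^sub>R (- d) =
          (K *v (E d *v state (t - d) w + noise (t - d) (t - d + d) w) - K *v state (t - d) w) /\<^sub>R d"
        using elim by (simp add: scaleR_diff_right)
      then show ?case by (simp only: quotient)
    qed
  qed measurable
qed

lemma state_second_moment_finite: "sq_norm M (\<lambda>w. K *v state t w) < top" for K :: "real^'n^'m"
proof -
  obtain c where c: "c \<ge> 0" "\<And>t. sq_norm M (state t) \<le> ennreal c" using state_second_moment by blast
  have "sq_norm M (\<lambda>w. K *v state t w) \<le> ennreal ((norm K)\<^sup>2) * sq_norm M (state t)"
    by (rule sq_norm_le) (auto simp: norm_matrix_vector_mult_le)
  also have "\<dots> \<le> ennreal ((norm K)\<^sup>2) * ennreal c" by (intro mult_left_mono c) simp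
  also have "\<dots> < top" by (simp add: ennreal_mult_less_top)
  finally show ?thesis .
qed

text \<open>The explicit limit shows that the choice in \<open>ms_deriv\<close> is a limit, and
  uniqueness identifies the two. Z is known only almost surely at each time, so that the lemma can
  be iterated on chosen derivatives.\<close>

lemma ms_deriv_state:
  fixes K :: "real^'n^'m" and Z :: "real \<Rightarrow> 'a \<Rightarrow> real^'m"
  assumes KB: "K ** B = 0" and Z: "\<And>t. AE w in M. Z t w = K *v state t w"
  shows "AE w in M. ms_deriv M Z t w = (K ** A) *v state t w"
proof -
  have iff: "ms_tendsto M (\<lambda>h w. (Z (t + h) w - Z t w) /\<^sub>R h) W (at 0) \<longleftrightarrow>
      ms_tendsto M (\<lambda>h w. (K *v state (t + h) w - K *v state t w) /\<^sub>R h) W (at 0)" for W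
  proof (rule ms_tendsto_cong)
    show "\<forall>\<^sub>F h in at 0. AE w in M. (Z (t + h) w - Z t w) /\<^sub>R h = (K *v state (t + h) w - K *v state t w) /\<^sub>R h"
    proof (rule always_eventually, rule allI)
      show "AE w in M. (Z (t + h) w - Z t w) /\<^sub>R h = (K *v state (t + h) w - K *v state t w) /\<^sub>R h" for h
        using Z[of "t + h"] Z[of t] by eventually_elim simp
    qed
  qed simp
  have "ms_deriv M Z t \<in> borel_measurable M \<and> ms_tendsto M (\<lambda>h w. (Z (t + h) w - Z t w) /\<^sub>R h) (ms_deriv M Z t) (at 0)"
    unfolding ms_deriv_def
    by (rule someI[where x = "\<lambda>w. (K ** A) *v state t w"]) (simp add: iff state_ms_derivative[OF KB])
  then show ?thesis
    unfolding iff using state_ms_derivative[OF KB, of t]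
    by (intro ms_tendsto_unique[where F = "at (0 :: real)"
          and Z = "\<lambda>h w. (K *v state (t + h) w - K *v state t w) /\<^sub>R h"]) auto
qed

end

section \<open>Recovering the state from the output\<close>

lemma has_vector_derivativeI_quotient:
  fixes f :: "real \<Rightarrow> 'b::real_normed_vector"
  assumes "((\<lambda>h. (f (t + h) - f t) /\<^sub>R h) \<longlongrightarrow> D) (at 0)"
  shows "(f has_vector_derivative D) (at t)"
proof -
  have "((\<lambda>h. norm ((f (t + h) - f t) /\<^sub>R h - D)) \<longlongrightarrow> 0) (at 0)"
    using assms by (simp add: tendsto_norm_zero LIM_zero)
  moreover have "\<forall>\<^sub>F h in at 0. norm ((f (t + h) - f t) /\<^sub>R h - D) = norm (f (t + h) - f t - h *\<^sub>R D) / norm h"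
    unfolding eventually_at_filter
  proof (rule always_eventually, intro allI impI)
    fix h :: real assume h: "h \<noteq> 0"
    have "(f (t + h) - f t) /\<^sub>R h - D = (f (t + h) - f t - h *\<^sub>R D) /\<^sub>R h"
      using h by (simp add: scaleR_diff_right)
    then show "norm ((f (t + h) - f t) /\<^sub>R h - D) = norm (f (t + h) - f t - h *\<^sub>R D) / norm h"
      by (simp add: divide_inverse mult.commute)
  qed
  ultimately have "((\<lambda>h. norm (f (t + h) - f t - h *\<^sub>R D) / norm h) \<longlongrightarrow> 0) (at 0)"
    by (rule Lim_transform_eventually)
  then show ?thesis
    by (simp add: has_vector_derivative_def has_derivative_at bounded_linear_scaleR_left)
qed

text \<open>Multiplication by an indicator does not increase the squared norm, and Jensen's
  inequality bounds the difference of the expectations by the mean-square distance.\<close>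

lemma (in prob_space) expectation_tendsto_ms:
  fixes Z :: "'i \<Rightarrow> 'a \<Rightarrow> 'b::{banach, second_countable_topology}"
  assumes [measurable]: "\<And>i. Z i \<in> borel_measurable M" "W \<in> borel_measurable M" and S [measurable]: "S \<in> sets M"
    and fin: "\<And>i. sq_norm M (Z i) < top" "sq_norm M W < top" and lim: "ms_tendsto M Z W F"
  shows "((\<lambda>i. \<integral>w. indicator S w *\<^sub>R Z i w \<partial>M) \<longlongrightarrow> (\<integral>w. indicator S w *\<^sub>R W w \<partial>M)) F"
proof -
  let ?d = "\<lambda>i. (\<integral>w. indicator S w *\<^sub>R Z i w \<partial>M) - (\<integral>w. indicator S w *\<^sub>R W w \<partial>M)"
  have int: "integrable M (\<lambda>w. indicator S w *\<^sub>R X w)" if "X \<in> borel_measurable M" "sq_norm M X < top" for X :: "'a \<Rightarrow> 'b"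
    using norm_expectation_le(1)[OF that] by (intro integrable_mult_indicator S)
  have "ennreal ((norm (?d i))\<^sup>2) \<le> sq_norm M (\<lambda>w. Z i w - W w)" for i
  proof -
    have d: "?d i = expectation (\<lambda>w. indicator S w *\<^sub>R (Z i w - W w))"
      unfolding scaleR_diff_right by (rule Bochner_Integration.integral_diff[symmetric]; intro int assms)
    have le: "sq_norm M (\<lambda>w. indicator S w *\<^sub>R (Z i w - W w)) \<le> ennreal (1\<^sup>2) * sq_norm M (\<lambda>w. Z i w - W w)"
      by (rule sq_norm_le) (auto simp: indicator_def)
    have "sq_norm M (\<lambda>w. Z i w - W w) \<le> 2 * sq_norm M (Z i) + 2 * sq_norm M W"
      by (rule sq_norm_diff) measurable
    also have "\<dots> < top" using fin by (simp add: ennreal_mult_less_top)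
    finally have "sq_norm M (\<lambda>w. indicator S w *\<^sub>R (Z i w - W w)) < top"
      using le by (simp add: le_less_trans)
    from norm_expectation_le(2)[OF _ this] le show ?thesis unfolding d by simp
  qed
  then have "((\<lambda>i. ennreal ((norm (?d i))\<^sup>2)) \<longlongrightarrow> ennreal 0) F"
    using lim unfolding ms_tendsto_iff_sq_norm ennreal_0 by (rule tendsto_0_le_ennreal)
  then have "((\<lambda>i. (norm (?d i))\<^sup>2) \<longlongrightarrow> 0) F"
    by (rule tendsto_ennrealD) auto
  then have "((\<lambda>i. sqrt ((norm (?d i))\<^sup>2)) \<longlongrightarrow> sqrt 0) F"
    by (rule tendsto_real_sqrt)
  then have "(?d \<longlongrightarrow> 0) F" by (simp add: tendsto_norm_zero_iff)
  then show ?thesis by (rule LIM_zero_cancel)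
qed

context stable_system
begin

text \<open>For a fixed event this is a deterministic function of time, to which calculus applies;
  all events together determine an integrable variable almost surely.\<close>

definition weak :: "real^'n^'m \<Rightarrow> 'a set \<Rightarrow> real \<Rightarrow> real^'m" where
  "weak K S t = (\<integral>w. indicator S w *\<^sub>R (K *v state t w) \<partial>M)"

lemma state_image_measurable: "(\<lambda>w. K *v state t w) \<in> borel_measurable M" for K :: "real^'n^'m"
  by measurable

lemma weak_integrable:
  "S \<in> sets M \<Longrightarrow> integrable M (\<lambda>w. indicator S w *\<^sub>R (K *v state t w))" for K :: "real^'n^'m"
  by (intro integrable_mult_indicator norm_expectation_le(1) state_second_moment_finite state_image_measurable)

lemma weak_mult: "S \<in> sets M \<Longrightarrow> weak (H ** K) S t = H *v weak K S t" for K :: "real^'n^'m" and H :: "real^'m^'l"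
  using integral_bounded_linear[OF mvmult.bounded_linear_right[of H] weak_integrable[of S K t]]
  by (simp add: weak_def mvmult.scaleR_right matrix_vector_mul_assoc)

lemma weak_add: "S \<in> sets M \<Longrightarrow> weak (H + K) S t = weak H S t + weak K S t" for K :: "real^'n^'m"
  by (simp add: weak_def mvmult.add_left scaleR_add_right Bochner_Integration.integral_add weak_integrable)

text \<open>The bound is uniform in time, which removes the boundary term at minus infinity later
  on.\<close>

lemma weak_bounded:
  fixes K :: "real^'n^'m"
  obtains c where "\<And>t. S \<in> sets M \<Longrightarrow> norm (weak K S t) \<le> c"
proof -
  obtain c where c: "c \<ge> 0" "\<And>t. sq_norm M (state t) \<le> ennreal c" using state_second_moment by blast
  have "norm (weak K S t) \<le> sqrt ((norm K)\<^sup>2 * c)" if [measurable]: "S \<in> sets M" for t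
  proof -
    have "sq_norm M (\<lambda>w. indicator S w *\<^sub>R (K *v state t w)) \<le> ennreal ((norm K)\<^sup>2) * sq_norm M (state t)"
      by (rule sq_norm_le) (auto simp: norm_matrix_vector_mult_le indicator_def)
    also have "\<dots> \<le> ennreal ((norm K)\<^sup>2) * ennreal c" by (intro mult_left_mono c) simp
    also have "\<dots> = ennreal ((norm K)\<^sup>2 * c)" using c by (simp add: ennreal_mult)
    finally have le: "sq_norm M (\<lambda>w. indicator S w *\<^sub>R (K *v state t w)) \<le> ennreal ((norm K)\<^sup>2 * c)" .
    then have "ennreal ((norm (weak K S t))\<^sup>2) \<le> ennreal ((norm K)\<^sup>2 * c)"
      unfolding weak_def by (intro order_trans[OF norm_expectation_le(2) le] le_less_trans[OF le]) auto
    then have "(norm (weak K S t))\<^sup>2 \<le> (norm K)\<^sup>2 * c"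
      using c(1) by (subst (asm) ennreal_le_iff) auto
    then show ?thesis by (rule real_le_rsqrt)
  qed
  then show ?thesis by (rule that)
qed

lemma weak_continuous:
  fixes K :: "real^'n^'m"
  assumes "S \<in> sets M"
  shows "continuous_on UNIV (weak K S)"
proof (intro continuous_at_imp_continuous_on ballI)
  fix t
  have "((\<lambda>h. weak K S (t + h)) \<longlongrightarrow> weak K S t) (at 0)"
    unfolding weak_def
    by (rule expectation_tendsto_ms[OF _ _ assms state_second_moment_finite state_second_moment_finite
          ms_tendsto_bounded_linear[OF mvmult.bounded_linear_right _ _ state_continuous]]) measurable
  then show "isCont (weak K S) t" by (simp add: isCont_iff)
qed

lemma weak_derivative:
  fixes K :: "real^'n^'m"
  assumes KB: "K ** B = 0" and S: "S \<in> sets M"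
  shows "(weak K S has_vector_derivative weak (K ** A) S t) (at t)"
proof (rule has_vector_derivativeI_quotient)
  have fin: "sq_norm M (\<lambda>w. (K *v state (t + h) w - K *v state t w) /\<^sub>R h) < top" for h
  proof -
    have "sq_norm M (\<lambda>w. (K *v state (t + h) w - K *v state t w) /\<^sub>R h) \<le>
        ennreal ((inverse \<bar>h\<bar>)\<^sup>2) * sq_norm M (\<lambda>w. K *v state (t + h) w - K *v state t w)"
      by (rule sq_norm_le) (simp_all only: norm_scaleR abs_inverse order_refl abs_ge_zero inverse_nonnegative_iff_nonnegative, measurable)
    also have "\<dots> \<le> ennreal ((inverse \<bar>h\<bar>)\<^sup>2) * (2 * sq_norm M (\<lambda>w. K *v state (t + h) w) + 2 * sq_norm M (\<lambda>w. K *v state t w))"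
      by (intro mult_left_mono sq_norm_diff state_image_measurable) simp
    also have "\<dots> < top"
      by (simp add: ennreal_mult_less_top state_second_moment_finite)
    finally show ?thesis .
  qed
  have "((\<lambda>h. \<integral>w. indicator S w *\<^sub>R ((K *v state (t + h) w - K *v state t w) /\<^sub>R h) \<partial>M) \<longlongrightarrow> weak (K ** A) S t) (at 0)"
    unfolding weak_def
    by (rule expectation_tendsto_ms[OF _ _ S fin state_second_moment_finite state_ms_derivative[OF KB]]) measurable
  moreover have "(\<integral>w. indicator S w *\<^sub>R ((K *v state (t + h) w - K *v state t w) /\<^sub>R h) \<partial>M) = (weak K S (t + h) - weak K S t) /\<^sub>R h" for h
  proof -
    have "(\<integral>w. indicator S w *\<^sub>R ((K *v state (t + h) w - K *v state t w) /\<^sub>R h) \<partial>M) =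
        (\<integral>w. (indicator S w *\<^sub>R (K *v state (t + h) w) - indicator S w *\<^sub>R (K *v state t w)) /\<^sub>R h \<partial>M)"
      by (intro Bochner_Integration.integral_cong) (auto simp: indicator_def)
    also have "\<dots> = (weak K S (t + h) - weak K S t) /\<^sub>R h"
      using weak_integrable[OF S, of K] by (simp add: weak_def Bochner_Integration.integral_diff)
    finally show ?thesis .
  qed
  ultimately show "((\<lambda>h. (weak K S (t + h) - weak K S t) /\<^sub>R h) \<longlongrightarrow> weak (K ** A) S t) (at 0)"
    by simp
qed

text \<open>The variation of constants formula is verified after integration over an arbitrary event,
  where it becomes a statement about a deterministic linear differential equation.\<close>

lemma inverse_representation:
  fixes T :: "real^'n^'q" and G :: "real^'q^'q" and H :: "real^'l^'q" and R :: "real^'n^'l"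
    and Y :: "real \<Rightarrow> 'a \<Rightarrow> real^'l"
  assumes TB: "T ** B = 0" and TA: "T ** A = G ** T + H ** R"
    and G: "exp_decay (\<lambda>t. mat_exp (t *\<^sub>R G))"
    and Y_meas: "measurable_process M Y" and Y: "\<And>t. AE w in M. Y t w = R *v state t w"
  shows "AE w in M. set_integrable lborel {..t} (\<lambda>u. mat_exp ((t - u) *\<^sub>R G) *v (H *v Y u w)) \<and>
    (LINT u:{..t}|lborel. mat_exp ((t - u) *\<^sub>R G) *v (H *v Y u w)) = T *v state t w"
proof -
  define F where "F u w = indicator {..t} u *\<^sub>R (mat_exp ((t - u) *\<^sub>R G) *v (H *v Y u w))" for u w
  interpret LM: pair_sigma_finite lborel M ..
  have [measurable]: "(\<lambda>p. Y (fst p) (snd p)) \<in> borel_measurable (lborel \<Otimes>\<^sub>M M)"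
    using Y_meas by (simp add: measurable_process_def split_beta')
  have Y_t [measurable]: "Y u \<in> borel_measurable M" for u
    using measurable_compose[OF measurable_Pair1'[of u lborel M], of "\<lambda>p. Y (fst p) (snd p)" borel] by simp
  have [measurable]: "(\<lambda>u. mat_exp ((t - u) *\<^sub>R G)) \<in> borel_measurable borel"
    by (intro borel_measurable_continuous_onI continuous_intros)
  have [measurable]: "(\<lambda>x. f x *v g x) \<in> borel_measurable N"
    if "f \<in> borel_measurable N" "g \<in> borel_measurable N" for f :: "_ \<Rightarrow> real^'q^'q" and g N
    using that by (rule borel_measurable_continuous_Pair) (intro mvmult.continuous_on continuous_intros)
  have [measurable]: "(\<lambda>p. F (fst p) (snd p)) \<in> borel_measurable (lborel \<Otimes>\<^sub>M M)"
    unfolding F_def by measurable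
  obtain c \<alpha> where c: "\<alpha> > 0" "\<And>v. v \<ge> 0 \<Longrightarrow> norm (mat_exp (v *\<^sub>R G)) \<le> c * exp (- \<alpha> * v)"
    using G by (auto simp: exp_decay_def)
  have c0: "c \<ge> 0" using order_trans[OF norm_ge_zero c(2)[of 0]] by simp
  obtain d where d: "d \<ge> 0" "\<And>t. sq_norm M (state t) \<le> ennreal d" using state_second_moment by blast
  \<comment> \<open>By x \<le> 1 + x^2, the first moment of the output is at most 1 plus its second
    moment, uniformly in time.\<close>
  define C where "C = 1 + (norm R)\<^sup>2 * d"
  have C: "C \<ge> 0" using d by (simp add: C_def)
  have Y_norm: "(\<integral>\<^sup>+w. ennreal (norm (Y u w)) \<partial>M) \<le> ennreal C" for u
  proof -
    have le: "x \<le> 1 + x\<^sup>2" for x :: real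
      using zero_le_power2[of "x - 1"] zero_le_power2[of x] unfolding power2_diff power_one mult_1_right by linarith
    have "(\<integral>\<^sup>+w. ennreal (norm (Y u w)) \<partial>M) \<le> (\<integral>\<^sup>+w. 1 + ennreal ((norm (Y u w))\<^sup>2) \<partial>M)"
      by (intro nn_integral_mono) (use le in \<open>simp flip: ennreal_1 ennreal_plus\<close>)
    also have "\<dots> = 1 + sq_norm M (Y u)"
      unfolding sq_norm_def by (subst nn_integral_add) (simp_all add: emeasure_space_1)
    also have "sq_norm M (Y u) = sq_norm M (\<lambda>w. R *v state u w)"
      by (rule sq_norm_cong_AE[OF Y])
    also have "\<dots> \<le> ennreal ((norm R)\<^sup>2) * sq_norm M (state u)"
      by (rule sq_norm_le) (auto simp: norm_matrix_vector_mult_le)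
    also have "\<dots> \<le> ennreal ((norm R)\<^sup>2) * ennreal d" by (intro mult_left_mono d) simp
    finally show ?thesis using d by (simp add: C_def ennreal_mult)
  qed
  have F_le: "norm (F u w) \<le> (c * norm H * exp (- \<alpha> * t)) * (exp (\<alpha> * u) * indicator {..t} u) * norm (Y u w)" for u w
  proof (cases "u \<le> t")
    case True
    have "norm (F u w) \<le> norm (mat_exp ((t - u) *\<^sub>R G)) * norm (H *v Y u w)"
      using True by (simp add: F_def norm_matrix_vector_mult_le)
    also have "\<dots> \<le> (c * exp (- \<alpha> * (t - u))) * (norm H * norm (Y u w))"
      using True c(2)[of "t - u"] c0 by (intro mult_mono norm_matrix_vector_mult_le) auto
    also have "exp (- \<alpha> * (t - u)) = exp (- \<alpha> * t) * exp (\<alpha> * u)"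
      by (simp add: algebra_simps flip: exp_add)
    finally show ?thesis using True by (simp add: mult_ac)
  qed (simp add: F_def)
  \<comment> \<open>Integrability on the product space yields both the integrability of almost every
    path over the half-line and the interchange of expectation and time integral.\<close>
  have F_int: "integrable (lborel \<Otimes>\<^sub>M M) (\<lambda>p. F (fst p) (snd p))"
  proof (rule integrableI_bounded)
    have "(\<integral>\<^sup>+p. ennreal (norm (F (fst p) (snd p))) \<partial>(lborel \<Otimes>\<^sub>M M)) = (\<integral>\<^sup>+u. \<integral>\<^sup>+w. ennreal (norm (F u w)) \<partial>M \<partial>lborel)"
    proof -
      have "(\<lambda>p. ennreal (norm (F (fst p) (snd p)))) \<in> borel_measurable (lborel \<Otimes>\<^sub>M M)" by measurable
      from nn_integral_fst[OF this] show ?thesis by simp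
    qed
    also have "\<dots> \<le> (\<integral>\<^sup>+u. ennreal (c * norm H * exp (- \<alpha> * t) * C) * (ennreal (exp (\<alpha> * u)) * indicator {..t} u) \<partial>lborel)"
    proof (rule nn_integral_mono)
      fix u
      let ?r = "(c * norm H * exp (- \<alpha> * t)) * (exp (\<alpha> * u) * indicator {..t} u)"
      have r: "?r \<ge> 0" using c0 by simp
      have "(\<integral>\<^sup>+w. ennreal (norm (F u w)) \<partial>M) \<le> (\<integral>\<^sup>+w. ennreal ?r * ennreal (norm (Y u w)) \<partial>M)"
        using r F_le[of u] by (intro nn_integral_mono) (simp only: ennreal_mult[symmetric] norm_ge_zero ennreal_leI)
      also have "\<dots> = ennreal ?r * (\<integral>\<^sup>+w. ennreal (norm (Y u w)) \<partial>M)"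
        by (rule nn_integral_cmult) measurable
      also have "\<dots> \<le> ennreal ?r * ennreal C" by (intro mult_left_mono Y_norm) simp
      also have "\<dots> = ennreal (c * norm H * exp (- \<alpha> * t) * C) * (ennreal (exp (\<alpha> * u)) * indicator {..t} u)"
        using C c0 by (auto simp: indicator_def ennreal_mult'[symmetric] mult_ac)
      finally show "(\<integral>\<^sup>+w. ennreal (norm (F u w)) \<partial>M) \<le>
        ennreal (c * norm H * exp (- \<alpha> * t) * C) * (ennreal (exp (\<alpha> * u)) * indicator {..t} u)" .
    qed
    also have "\<dots> < \<infinity>"
      by (subst nn_integral_cmult) (simp_all add: nn_integral_exp_atMost[OF c(1)] ennreal_mult_less_top)
    finally show "(\<integral>\<^sup>+p. ennreal (norm (F (fst p) (snd p))) \<partial>(lborel \<Otimes>\<^sub>M M)) < \<infinity>" .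
  qed measurable
  define V where "V w = (\<integral>u. F u w \<partial>lborel)" for w
  have F_case: "integrable (lborel \<Otimes>\<^sub>M M) (\<lambda>(u, w). F u w)"
    using F_int by (simp add: split_beta')
  have V_int: "integrable M V" unfolding V_def by (rule LM.integrable_snd[OF F_case])
  have "(\<integral>w. indicator S w *\<^sub>R V w \<partial>M) = weak T S t" if S [measurable]: "S \<in> sets M" for S
  proof -
    let ?z = "\<lambda>u. mat_exp ((t - u) *\<^sub>R G) *v weak T S u"
    let ?z' = "\<lambda>u. mat_exp ((t - u) *\<^sub>R G) *v (H *v weak R S u)"
    have SF: "integrable (lborel \<Otimes>\<^sub>M M) (\<lambda>(u, w). indicator S w *\<^sub>R F u w)"
      by (rule Bochner_Integration.integrable_bound[OF F_int]) (auto simp: indicator_def split_beta')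
    have inner: "(\<integral>w. indicator S w *\<^sub>R F u w \<partial>M) = indicator {..t} u *\<^sub>R ?z' u" for u
    proof -
      have "(\<integral>w. indicator S w *\<^sub>R F u w \<partial>M) =
          (\<integral>w. indicator {..t} u *\<^sub>R (mat_exp ((t - u) *\<^sub>R G) *v (H *v (indicator S w *\<^sub>R (R *v state u w)))) \<partial>M)"
        using Y[of u] by (intro integral_cong_AE) (auto simp: F_def mvmult.scaleR_right elim!: eventually_mono)
      also have "\<dots> = indicator {..t} u *\<^sub>R ?z' u"
        unfolding weak_def
        by (rule integral_bounded_linear[OF bounded_linear_compose[OF bounded_linear_scaleR_right
              bounded_linear_compose[OF mvmult.bounded_linear_right mvmult.bounded_linear_right]] weak_integrable[OF S]])
      finally show ?thesis .
    qed
    have "(\<integral>w. indicator S w *\<^sub>R V w \<partial>M) = (\<integral>w. \<integral>u. indicator S w *\<^sub>R F u w \<partial>lborel \<partial>M)"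
      by (simp add: V_def)
    also have "\<dots> = (\<integral>u. \<integral>w. indicator S w *\<^sub>R F u w \<partial>M \<partial>lborel)"
      by (rule LM.Fubini_integral[OF SF])
    also have "\<dots> = (LINT u:{..t}|lborel. ?z' u)"
      by (simp add: inner set_lebesgue_integral_def)
    finally have V: "(\<integral>w. indicator S w *\<^sub>R V w \<partial>M) = (LINT u:{..t}|lborel. ?z' u)" .
    have z'_int: "set_integrable lborel {..t} ?z'"
      using LM.integrable_fst[OF SF] by (simp add: inner set_integrable_def)
    \<comment> \<open>By \<open>TA\<close> the derivative of the weak state is G times itself plus
      the contribution of the output. The first part cancels against the derivative of the
      exponential.\<close>
    have z_deriv: "(?z has_vector_derivative ?z' u) (at u)" for u
    proof -
      have "((\<lambda>r. t - r) has_vector_derivative -1) (at u)"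
        by (auto intro!: derivative_eq_intros)
      from vector_diff_chain_at[OF this mat_exp_has_vector_derivative[of G]]
      have "((\<lambda>u. mat_exp ((t - u) *\<^sub>R G)) has_vector_derivative - (G ** mat_exp ((t - u) *\<^sub>R G))) (at u)"
        by (simp add: o_def)
      from mvmult.has_vector_derivative[OF this weak_derivative[OF TB S, of u]] show ?thesis
        by (simp add: TA weak_add[OF S] weak_mult[OF S] mvmult.minus_left mvmult.add_right
            mat_exp_commute matrix_vector_mul_assoc matrix_mul_assoc)
    qed
    have FTC: "(LINT u:{s..t}|lborel. ?z' u) = weak T S t - ?z s" if "s \<le> t" for s
    proof -
      have "has_bochner_integral lborel (\<lambda>u. indicator {s..t} u *\<^sub>R ?z' u) (?z t - ?z s)"
      proof (rule has_bochner_integral_FTC_Icc[OF that])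
        show "(?z has_vector_derivative ?z' u) (at u within {s..t})" for u
          by (rule has_vector_derivative_at_within[OF z_deriv])
        show "continuous_on {s..t} ?z'"
          by (intro mvmult.continuous_on continuous_intros continuous_on_subset[OF weak_continuous[OF S]]) auto
      qed
      then show ?thesis by (simp add: set_lebesgue_integral_def has_bochner_integral_iff)
    qed
    \<comment> \<open>The boundary term decays because G is stable and the weak state stays
      bounded.\<close>
    have z_lim: "(?z \<longlongrightarrow> 0) at_bot"
    proof -
      obtain b where "\<And>u. S \<in> sets M \<Longrightarrow> norm (weak T S u) \<le> b"
        by (rule weak_bounded[of S T]) iprover
      note b = this[OF S]
      have b0: "b \<ge> 0" using order_trans[OF norm_ge_zero b] .
      show ?thesis
      proof (rule Lim_null_comparison)
        show "\<forall>\<^sub>F u in at_bot. norm (?z u) \<le> (c * exp (- \<alpha> * t) * b) * exp (\<alpha> * u)"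
          using eventually_le_at_bot[of t]
        proof eventually_elim
          case (elim u)
          have "norm (?z u) \<le> norm (mat_exp ((t - u) *\<^sub>R G)) * norm (weak T S u)"
            by (rule norm_matrix_vector_mult_le)
          also have "\<dots> \<le> (c * exp (- \<alpha> * (t - u))) * b"
            using elim c(2)[of "t - u"] c0 b by (intro mult_mono) auto
          also have "exp (- \<alpha> * (t - u)) = exp (- \<alpha> * t) * exp (\<alpha> * u)"
            by (simp add: algebra_simps flip: exp_add)
          finally show ?case by (simp add: mult_ac)
        qed
        have "((\<lambda>u. (c * exp (- \<alpha> * t) * b) * exp (\<alpha> * u)) \<longlongrightarrow> (c * exp (- \<alpha> * t) * b) * 0) at_bot"
          by (intro tendsto_intros filterlim_compose[OF exp_at_bot]
              filterlim_tendsto_pos_mult_at_bot[OF tendsto_const c(1) filterlim_ident])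
        then show "((\<lambda>u. (c * exp (- \<alpha> * t) * b) * exp (\<alpha> * u)) \<longlongrightarrow> 0) at_bot" by simp
      qed
    qed
    have "((\<lambda>s. weak T S t - ?z s) \<longlongrightarrow> weak T S t) at_bot"
      using tendsto_diff[OF tendsto_const z_lim] by simp
    moreover have "\<forall>\<^sub>F s in at_bot. weak T S t - ?z s = (LINT u:{s..t}|lborel. ?z' u)"
      using eventually_le_at_bot[of t] by eventually_elim (simp add: FTC)
    ultimately have "((\<lambda>s. LINT u:{s..t}|lborel. ?z' u) \<longlongrightarrow> weak T S t) at_bot"
      by (rule Lim_transform_eventually)
    moreover have "((\<lambda>s. LINT u:{s..t}|lborel. ?z' u) \<longlongrightarrow> (LINT u:{..t}|lborel. ?z' u)) at_bot"
      by (rule tendsto_set_lebesgue_integral_at_bot[OF _ z'_int]) auto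
    ultimately show ?thesis
      unfolding V using tendsto_unique trivial_limit_at_bot_linorder by blast
  qed
  then have eq: "(\<integral>w. indicator S w *\<^sub>R V w \<partial>M) = (\<integral>w. indicator S w *\<^sub>R (T *v state t w) \<partial>M)" if "S \<in> sets M" for S
    using that by (simp add: weak_def)
  have T_int: "integrable M (\<lambda>w. T *v state t w)"
    by (rule norm_expectation_le(1)[OF state_image_measurable state_second_moment_finite])
  \<comment> \<open>Two integrable real functions with the same integral over every event agree
    almost surely; this is applied to each component.\<close>
  have "AE w in M. V w $ i = (T *v state t w) $ i" for i
  proof (rule density_unique_real)
    show "integrable M (\<lambda>w. V w $ i)" "integrable M (\<lambda>w. (T *v state t w) $ i)"
      by (rule integrable_bounded_linear[OF bounded_linear_vec_nth], fact)+
    fix S assume S: "S \<in> sets M"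
    have nth: "(LINT w:S|M. X w $ i) = (\<integral>w. indicator S w *\<^sub>R X w \<partial>M) $ i" if "integrable M X" for X :: "'a \<Rightarrow> real^'q"
      using integral_bounded_linear[OF bounded_linear_vec_nth integrable_mult_indicator[OF S that], of i]
      by (simp add: set_lebesgue_integral_def)
    show "(LINT w:S|M. V w $ i) = (LINT w:S|M. (T *v state t w) $ i)"
      using nth[OF V_int] nth[OF T_int] eq[OF S] by simp
  qed
  then have "AE w in M. \<forall>i. V w $ i = (T *v state t w) $ i"
    by (simp add: AE_all_countable)
  moreover have "AE w in M. integrable lborel (\<lambda>u. F u w)"
    using LM.AE_integrable_snd[OF F_case] by simp
  ultimately show ?thesis
    by eventually_elim (simp add: set_integrable_def set_lebesgue_integral_def F_def V_def vec_eq_iff)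
qed

end

text \<open>Absolute integrability over the half-line makes the integrals over [s, t] converge as s
  tends to minus infinity. T will be a coefficient matrix followed by the choice of a
  component.\<close>

lemma has_integral_from_minus_inf_linear:
  fixes f :: "real \<Rightarrow> 'b::{banach, second_countable_topology}" and T :: "'b \<Rightarrow> real"
  assumes T: "bounded_linear T" and f: "set_integrable lborel {..t} f"
  shows "has_integral_from_minus_inf (\<lambda>u. T (f u)) t (T (LINT u:{..t}|lborel. f u))"
proof -
  have scale: "indicator S u *\<^sub>R T (f u) = T (indicator S u *\<^sub>R f u)" for S u
    by (simp add: linear_scale[OF bounded_linear.linear[OF T]])
  have Tf: "set_integrable lborel {..t} (\<lambda>u. T (f u))"
    unfolding set_integrable_def scale
    by (rule integrable_bounded_linear[OF T f[unfolded set_integrable_def]])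
  have "(LINT u:{..t}|lborel. T (f u)) = T (LINT u:{..t}|lborel. f u)"
    unfolding set_lebesgue_integral_def scale
    by (rule integral_bounded_linear[OF T f[unfolded set_integrable_def]])
  moreover have "((\<lambda>s. LINT u:{s..t}|lborel. T (f u)) \<longlongrightarrow> (LINT u:{..t}|lborel. T (f u))) at_bot"
    by (rule tendsto_set_lebesgue_integral_at_bot[OF _ Tf]) simp
  moreover have "set_integrable lborel {s..t} (\<lambda>u. T (f u))" for s
    by (rule set_integrable_subset[OF Tf]) auto
  ultimately show ?thesis by (simp add: has_integral_from_minus_inf_def)
qed

theorem theorem3p2:
  fixes M :: "'a measure"
    and L Y :: "real \<Rightarrow> 'a \<Rightarrow> real^'k"
    and X :: "real \<Rightarrow> 'a \<Rightarrow> real^('p::{finite,linorder} \<times> 'k)"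
    and A C :: "nat \<Rightarrow> real^'k^'k"
    and p q :: nat
    and AA :: "real^('p \<times> 'k)^('p \<times> 'k)"
    and CC CS :: "real^('p \<times> 'k)^'k"
    and \<Lambda> :: "real^('q::{finite,linorder} \<times> 'k)^('q \<times> 'k)"
    and \<Theta> :: "real^'k^('q \<times> 'k)"
    and t h :: real and a :: 'k
  defines "AA \<equiv> state_A A"
    and "CC \<equiv> state_C q C"
    and "CS \<equiv> state_C_shift q C"
    and "\<Lambda> \<equiv> inv_Lambda C"
    and "\<Theta> \<equiv> inv_Theta C"
  assumes p: "p = CARD('p)" and q: "q = CARD('q)" and pq: "p > q" "q > 0"
    and M: "prob_space M"
    and levy: "levy_process M L"
    and levy_mean: "(\<integral>\<omega>. L 1 \<omega> \<partial>M) = 0"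
    and levy_square: "integrable M (\<lambda>\<omega>. (norm (L 1 \<omega>))\<^sup>2)"
    and coprime: "right_coprime (poly_P p A) (poly_Q q C)"
    and rank_C: "rank (C q) = CARD('k)"
    and zeros_P: "\<And>z. det (poly_P p A z) = 0 \<Longrightarrow> Re z < 0"
    and zeros_Q: "\<And>z. det (poly_Q q C z) = 0 \<Longrightarrow> Re z < 0"
    and X: "is_input_process M L A X"
    and Y: "\<And>t \<omega>. Y t \<omega> = CC *v X t \<omega>"
    and Y_meas: "measurable_process M Y"
    and h: "h \<ge> 0"
  shows
    "(AE \<omega> in M. \<exists>I.
        has_integral_from_minus_inf
          (\<lambda>u. ((coeff_int CC AA \<Lambda> h ** mat_exp ((t - u) *\<^sub>R \<Lambda>) ** \<Theta>) *v Y u \<omega>) $ a) t I \<and>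
        Y (t + h) \<omega> $ a =
          I + (\<Sum>m=0..p - q - 1. ((coeff_deriv CC AA \<Lambda> m h ** \<Theta>) *v ms_deriv_n M m Y t \<omega>) $ a)
            + innovation M L CC AA t h \<omega> $ a) \<and>
     (AE \<omega> in M. \<exists>I.
        has_integral_from_minus_inf
          (\<lambda>u. ((coeff_int CS AA \<Lambda> h ** mat_exp ((t - u) *\<^sub>R \<Lambda>) ** \<Theta>) *v Y u \<omega>) $ a) t I \<and>
        ms_deriv_n M (p - q - 1) Y (t + h) \<omega> $ a =
          I + (\<Sum>m=0..p - q - 1. ((coeff_deriv CS AA \<Lambda> m h ** \<Theta>) *v ms_deriv_n M m Y t \<omega>) $ a)
            + innovation M L CS AA t h \<omega> $ a) \<and>
     (AE \<omega> in M. innovation M L CC AA t 0 \<omega> = 0) \<and>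
     (AE \<omega> in M. innovation M L CS AA t 0 \<omega> = 0)"
proof -
  interpret centered_levy M L
    by (rule centered_levy.intro[OF M]) (rule centered_levy_axioms.intro[OF levy levy_mean levy_square])
  have inv: "invertible (C CARD('q))"
  proof -
    have "inj ((*v) (C CARD('q)))" using rank_C q by (simp add: full_rank_injective)
    then show ?thesis
      by (metis invertible_left_inverse matrix_left_invertible_injective)
  qed
  have qp: "CARD('q) < CARD('p)" using pq p q by simp
  interpret stable_system M L AA "state_B :: real^'k^('p \<times> 'k)"
  proof
    show "exp_decay (\<lambda>t. mat_exp (t *\<^sub>R AA))"
      unfolding AA_def by (rule mat_exp_state_A_decay) (use zeros_P p in blast)
  qed
  have \<Lambda>_decay: "exp_decay (\<lambda>t. mat_exp (t *\<^sub>R \<Lambda>))"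
    unfolding \<Lambda>_def by (rule mat_exp_inv_Lambda_decay[where C = C, OF _ inv]) (use zeros_Q q in blast)
  let ?R = "shifted_row q C :: nat \<Rightarrow> real^('p \<times> 'k)^'k"
  let ?T = "E_top :: real^('p \<times> 'k)^('q \<times> 'k)"
  have CC: "CC = ?R 0" unfolding CC_def by (rule state_C_eq_shifted_row)
  have CS: "CS = ?R (p - q - 1)"
    unfolding CS_def p by (rule state_C_shift_eq_shifted_row) (use pq p in simp)
  have X_state: "AE \<omega> in M. X s \<omega> = state s \<omega>" for s
    using X by (simp add: is_input_process_def state_def flip: AA_def)
  have Y_state: "AE \<omega> in M. Y s \<omega> = ?R 0 *v state s \<omega>" for s
    using X_state[of s] by eventually_elim (simp add: Y CC)
  \<comment> \<open>Passing from m to m + 1 requires m + q + 1 < p, which holds exactly while m + 1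
    \<le> p - q - 1. The induction runs over all times s, since a derivative involves neighbouring
    times.\<close>
  have DY_state: "AE \<omega> in M. ms_deriv_n M m Y s \<omega> = ?R m *v state s \<omega>" if "m \<le> p - q - 1" for m s
    using that
  proof (induction m arbitrary: s)
    case 0
    then show ?case using Y_state[of s] by (simp add: ms_deriv_n_def)
  next
    case (Suc m)
    then have m: "m + q + 1 < CARD('p)" using pq p by simp
    have "AE \<omega> in M. ms_deriv M (ms_deriv_n M m Y) s \<omega> = (?R m ** AA) *v state s \<omega>"
      by (rule ms_deriv_state[OF shifted_row_mult_state_B[OF m] Suc.IH]) (use Suc.prems in simp)
    then show ?case
      by (simp add: ms_deriv_n_def AA_def shifted_row_mult_state_A[OF m])
  qed
  have TA: "?T ** AA = \<Lambda> ** ?T + \<Theta> ** ?R 0"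
    unfolding AA_def \<Lambda>_def \<Theta>_def q by (rule E_top_mult_state_A[where C = C, OF qp inv])
  have inverse: "AE \<omega> in M. set_integrable lborel {..t} (\<lambda>u. mat_exp ((t - u) *\<^sub>R \<Lambda>) *v (\<Theta> *v Y u \<omega>)) \<and>
      (LINT u:{..t}|lborel. mat_exp ((t - u) *\<^sub>R \<Lambda>) *v (\<Theta> *v Y u \<omega>)) = ?T *v state t \<omega>"
    by (rule inverse_representation[OF E_top_mult_state_B[OF qp] TA \<Lambda>_decay Y_meas Y_state])
  have DY: "AE \<omega> in M. \<forall>m\<in>{0..p - q - 1}. ms_deriv_n M m Y t \<omega> = ?R m *v state t \<omega>"
    by (rule AE_finite_allI) (use DY_state in auto)
  have innov: "innovation M L K AA t r \<omega> = K *v noise t (t + r) \<omega>" for K r \<omega>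
    by (simp add: innovation_def noise_def)
  \<comment> \<open>Both representations are instances for a row K applied to the state at time t +
    h. They differ only in what this row yields: Y itself, or its highest derivative.\<close>
  have main: "AE \<omega> in M. \<exists>I.
      has_integral_from_minus_inf
        (\<lambda>u. ((coeff_int K AA \<Lambda> h ** mat_exp ((t - u) *\<^sub>R \<Lambda>) ** \<Theta>) *v Y u \<omega>) $ a) t I \<and>
      (K *v state (t + h) \<omega>) $ a =
        I + (\<Sum>m=0..p - q - 1. ((coeff_deriv K AA \<Lambda> m h ** \<Theta>) *v ms_deriv_n M m Y t \<omega>) $ a)
          + innovation M L K AA t h \<omega> $ a" for K
  proof -
    \<comment> \<open>K applied to the propagated state is rewritten by the blocks recovered from
      the past of Y and the rows that give the derivatives of Y at time t.\<close>
    have expansion: "K ** E h = coeff_int K AA \<Lambda> h ** ?T + (\<Sum>m=0..p - q - 1. coeff_deriv K AA \<Lambda> m h ** \<Theta> ** ?R m)"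
      unfolding AA_def \<Lambda>_def \<Theta>_def p q by (rule state_expansion[where C = C, OF qp inv])
    have step: "AE \<omega> in M. state (t + h) \<omega> = E h *v state t \<omega> + noise t (t + h) \<omega>"
      using state_step[of t "t + h"] h by simp
    show ?thesis
      using inverse DY step
    proof eventually_elim
      case (elim \<omega>)
      let ?J = "coeff_int K AA \<Lambda> h"
      have lin: "bounded_linear (\<lambda>x. (?J *v x) $ a)"
        by (intro bounded_linear_compose[OF bounded_linear_vec_nth] mvmult.bounded_linear_right)
      have "has_integral_from_minus_inf (\<lambda>u. (?J *v (mat_exp ((t - u) *\<^sub>R \<Lambda>) *v (\<Theta> *v Y u \<omega>))) $ a) t ((?J *v (?T *v state t \<omega>)) $ a)"
        using has_integral_from_minus_inf_linear[OF lin conjunct1[OF elim(1)]] unfolding conjunct2[OF elim(1)] .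
      moreover have "(K *v state (t + h) \<omega>) $ a = (?J *v (?T *v state t \<omega>)) $ a +
          (\<Sum>m=0..p - q - 1. ((coeff_deriv K AA \<Lambda> m h ** \<Theta>) *v ms_deriv_n M m Y t \<omega>) $ a) + innovation M L K AA t h \<omega> $ a"
      proof -
        have "K *v state (t + h) \<omega> = (K ** E h) *v state t \<omega> + innovation M L K AA t h \<omega>"
          by (simp add: elim(3) innov mvmult.add_right matrix_vector_mul_assoc)
        also have "(K ** E h) *v state t \<omega> = ?J *v (?T *v state t \<omega>) +
            (\<Sum>m=0..p - q - 1. (coeff_deriv K AA \<Lambda> m h ** \<Theta>) *v (?R m *v state t \<omega>))"
          unfolding expansion by (simp add: mvmult.add_left mvmult.sum_left matrix_vector_mul_assoc)
        also have "(\<Sum>m=0..p - q - 1. (coeff_deriv K AA \<Lambda> m h ** \<Theta>) *v (?R m *v state t \<omega>)) =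
            (\<Sum>m=0..p - q - 1. (coeff_deriv K AA \<Lambda> m h ** \<Theta>) *v ms_deriv_n M m Y t \<omega>)"
          using elim(2) by (intro sum.cong) auto
        finally show ?thesis by simp
      qed
      ultimately show ?case
        by (auto simp: matrix_vector_mul_assoc[symmetric])
    qed
  qed
  have innov_0: "AE \<omega> in M. innovation M L K AA t 0 \<omega> = 0" for K
    unfolding innov using noise_eq_0[of t] by eventually_elim simp
  show ?thesis
  proof (intro conjI innov_0)
    show "AE \<omega> in M. \<exists>I.
        has_integral_from_minus_inf
          (\<lambda>u. ((coeff_int CC AA \<Lambda> h ** mat_exp ((t - u) *\<^sub>R \<Lambda>) ** \<Theta>) *v Y u \<omega>) $ a) t I \<and>
        Y (t + h) \<omega> $ a =
          I + (\<Sum>m=0..p - q - 1. ((coeff_deriv CC AA \<Lambda> m h ** \<Theta>) *v ms_deriv_n M m Y t \<omega>) $ a)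
            + innovation M L CC AA t h \<omega> $ a"
      using main[of CC] Y_state[of "t + h"] by eventually_elim (simp only: CC)
    show "AE \<omega> in M. \<exists>I.
        has_integral_from_minus_inf
          (\<lambda>u. ((coeff_int CS AA \<Lambda> h ** mat_exp ((t - u) *\<^sub>R \<Lambda>) ** \<Theta>) *v Y u \<omega>) $ a) t I \<and>
        ms_deriv_n M (p - q - 1) Y (t + h) \<omega> $ a =
          I + (\<Sum>m=0..p - q - 1. ((coeff_deriv CS AA \<Lambda> m h ** \<Theta>) *v ms_deriv_n M m Y t \<omega>) $ a)
            + innovation M L CS AA t h \<omega> $ a"
      using main[of CS] DY_state[of "p - q - 1" "t + h", OF order_refl] by eventually_elim (simp only: CS)
  qed
qed

end
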